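(* Let $Q$ be the infinitesimal generator of an ergodic regular-jump Markov chain $\{(X(t),J(t));t\ge 0\}$ on $\mathbb F$ with stationary distribution $\pi$, and assume that for each $n\in\mathbb N$ the LC-block-augmented truncation ${}_{(n)}Q$ has a unique closed communicating class in $\mathbb F_n$; let ${}_{(n)}\pi$ be its stationary distribution. Suppose there exist $b>0$, $K\in\mathbb Z_+$ and column vectors $v=(v(k,i))_{(k,i)\in\mathbb F}\ge 0$, $f=(f(k,i))_{(k,i)\in\mathbb F}\ge e$ such that $$Qv\le -f+b\,1_{\mathbb F_K}.$$ Let $\beta>0$. If $\pi v<\infty$, then for all $n\in\mathbb N$, $$|\pi-{}_{(n)}\pi|\,g\le \frac{\pi g+1}{2}\,E(n)\quad\text{for all column vectors } g \text{ with } 0\le g\le f,$$ $$\sup_{e\le g\le f}\frac{|\pi-{}_{(n)}\pi|\,g}{\pi g}\le E(n),$$ where $$E(n)=2\sum_{k=0}^n {}_{(n)}\pi(k)\sum_{m=n+1}^\infty Q(k;m)\left\{v(m)+v(n)+2\left(\pi v+\frac{2b}{\beta\,\overline\phi_K^{(\beta)}}\right)e\right\},\qquad n\in\mathbb N.$$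
   Context: Notation: $\mathbb Z_+=\{0,1,2,\dots\}$, $\mathbb N=\{1,2,\dots\}$. For $k\in\mathbb Z_+$, $\mathbb S_k=\{0,1,\dots,S_k\}$ with $S_k\in\mathbb Z_+$, and $S_k=S_1$ for all $k\in\mathbb N$. Levels: $\mathbb L_k=\{k\}\times\mathbb S_k$; $\mathbb F=\bigcup_{k\ge0}\mathbb L_k$, $\mathbb F_n=\bigcup_{k=0}^n\mathbb L_k$. For a vector $x=(x(k,i))_{(k,i)\in\mathbb F}$, $x(k)=(x(k,i))_{i\in\mathbb S_k}$ is its subvector for level $k$. $e$ is a column vector of ones of appropriate size, $1_{\mathbb C}$ is the column indicator vector of $\mathbb C\subseteq\mathbb F$; inequalities and absolute values $|\cdot|$ of vectors and matrices are entrywise. $\{(X(t),J(t))\}$ is a continuous-time regular-jump (non-explosive) Markov chain with state space $\mathbb F$, transition matrix function $P^{(t)}=(p^{(t)}(k,i;\ell,j))$ and stable, conservative infinitesimal generator $Q=(q(k,i;\ell,j))$ with blocks $Q(k;\ell)=(q(k,i;\ell,j))_{i\in\mathbb S_k,\,j\in\mathbb S_\ell}$. Ergodic means irreducible and positive recurrent; $\pi$ is the unique stationary distribution (row vector, $\pi Q=0$, $\pi e=1$). For $n\in\mathbb N$, the last-column-block-augmented (LC-block-augmented) truncation ${}_{(n)}Q$ of $Q$ is the conservative $q$-matrix on $\mathbb F$ with blocks $${}_{(n)}Q(k;\ell)=\begin{cases}Q(k;\ell),&k\in\mathbb Z_+,\ 0\le\ell\le n-1,\\ Q(k;n)+\sum_{m>n,\,m\ne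 k}Q(k;m),&k\in\mathbb Z_+,\ \ell=n,\\ Q(k;k),&k=\ell\ge n+1,\\ O,&\text{otherwise.}\end{cases}$$ ${}_{(n)}\pi=({}_{(n)}\pi(k,i))_{(k,i)\in\mathbb F}$ is its unique stationary distribution (row vector); ${}_{(n)}\pi(k)=0$ for $k\ge n+1$. For $\beta>0$: $\Phi^{(\beta)}=(\phi^{(\beta)}(k,i;\ell,j))=\int_0^\infty\beta e^{-\beta t}P^{(t)}\,dt$ (entrywise positive by ergodicity), and $\overline\phi_K^{(\beta)}=\sup_{(\ell,j)\in\mathbb F}\min_{(k,i)\in\mathbb F_K}\phi^{(\beta)}(k,i;\ell,j)>0$. *)

theory Defs
  imports "HOL-Probability.Probability"
begin

type_synonym state = "nat \<times> nat"

type_synonym qmatrix = "state \<Rightarrow> state \<Rightarrow> real"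

definition level :: "(nat \<Rightarrow> nat) \<Rightarrow> nat \<Rightarrow> state set" where
  "level S k = {k} \<times> {0..S k}"

definition states :: "(nat \<Rightarrow> nat) \<Rightarrow> state set" where
  "states S = (\<Union>k. level S k)"

definition states_upto :: "(nat \<Rightarrow> nat) \<Rightarrow> nat \<Rightarrow> state set" where
  "states_upto S n = (\<Union>k\<le>n. level S k)"

text \<open>Vectors and matrices indexed by the states are total functions; only their values on
  \<^term>\<open>states S\<close> matter.\<close>

definition row_times_col :: "(nat \<Rightarrow> nat) \<Rightarrow> (state \<Rightarrow> real) \<Rightarrow> (state \<Rightarrow> real) \<Rightarrow> real" where
  "row_times_col S x g = (\<Sum>\<^sub>\<infinity>s\<in>states S. x s * g s)"


text \<open>A Markov chain is given by a process \<open>Z\<close>, with \<open>Z t\<close> standing for the pair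
  \<open>(X(t), J(t))\<close>, together with its laws \<open>M x\<close>, one for each initial state \<open>x\<close>.\<close>

definition trans_prob ::
  "(state \<Rightarrow> 'w measure) \<Rightarrow> (real \<Rightarrow> 'w \<Rightarrow> state) \<Rightarrow> real \<Rightarrow> qmatrix" where
  "trans_prob M Z t x y = measure (M x) {\<omega> \<in> space (M x). Z t \<omega> = y}"

text \<open>The last clause is the time-homogeneous Markov property
  \<open>P(Z(s+t) = z | Z(s) = y, Z(u) = \<xi>(u) for u \<in> T) = P\<^sup>t(y,z)\<close>, multiplied out so that
  conditioning events of probability zero need no special treatment.\<close>

definition markov_chain ::
  "(nat \<Rightarrow> nat) \<Rightarrow> (state \<Rightarrow> 'w measure) \<Rightarrow> (real \<Rightarrow> 'w \<Rightarrow> state) \<Rightarrow> bool" where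
  "markov_chain S M Z \<longleftrightarrow>
    (\<forall>x\<in>states S.
      prob_space (M x) \<and>
      (\<forall>t\<ge>0. Z t \<in> measurable (M x) (count_space (states S))) \<and>
      (AE \<omega> in M x. Z 0 \<omega> = x) \<and>
      (\<forall>s\<ge>0. \<forall>t\<ge>0. \<forall>T \<xi>. \<forall>y\<in>states S. \<forall>z\<in>states S. finite T \<longrightarrow> T \<subseteq> {0..s} \<longrightarrow>
        measure (M x) {\<omega> \<in> space (M x). (\<forall>u\<in>T. Z u \<omega> = \<xi> u) \<and> Z s \<omega> = y \<and> Z (s + t) \<omega> = z} =
        measure (M x) {\<omega> \<in> space (M x). (\<forall>u\<in>T. Z u \<omega> = \<xi> u) \<and> Z s \<omega> = y} *
          trans_prob M Z t y z))"

text \<open>Regular-jump paths: right-continuous for the discrete topology, with finitely many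
  discontinuities in every bounded time interval (no explosion). The topology of type
  \<^typ>\<open>state\<close> is discrete.\<close>

definition regular_jump_path :: "(real \<Rightarrow> state) \<Rightarrow> bool" where
  "regular_jump_path z \<longleftrightarrow>
    (\<forall>t\<ge>0. \<exists>\<epsilon>>0. \<forall>s\<in>{t..<t + \<epsilon>}. z s = z t) \<and>
    (\<forall>c\<ge>0. finite {t\<in>{0..c}. \<not> continuous (at t within {0..}) z})"

definition regular_jump_chain ::
  "(nat \<Rightarrow> nat) \<Rightarrow> (state \<Rightarrow> 'w measure) \<Rightarrow> (real \<Rightarrow> 'w \<Rightarrow> state) \<Rightarrow> bool" where
  "regular_jump_chain S M Z \<longleftrightarrow>
    markov_chain S M Z \<and>
    (\<forall>x\<in>states S. AE \<omega> in M x. regular_jump_path (\<lambda>t. Z t \<omega>))"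

text \<open>Stability, i.e. finiteness of the diagonal, is implicit in \<open>Q\<close> being real-valued.\<close>

definition generator ::
  "(nat \<Rightarrow> nat) \<Rightarrow> (state \<Rightarrow> 'w measure) \<Rightarrow> (real \<Rightarrow> 'w \<Rightarrow> state) \<Rightarrow> qmatrix \<Rightarrow> bool" where
  "generator S M Z Q \<longleftrightarrow>
    (\<forall>x\<in>states S. \<forall>y\<in>states S.
      ((\<lambda>h. (trans_prob M Z h x y - (if x = y then 1 else 0)) / h) \<longlongrightarrow> Q x y) (at_right 0))"

definition conservative :: "(nat \<Rightarrow> nat) \<Rightarrow> qmatrix \<Rightarrow> bool" where
  "conservative S Q \<longleftrightarrow> (\<forall>x\<in>states S. (Q x has_sum 0) (states S))"

definition irreducible_chain ::
  "(nat \<Rightarrow> nat) \<Rightarrow> (state \<Rightarrow> 'w measure) \<Rightarrow> (real \<Rightarrow> 'w \<Rightarrow> state) \<Rightarrow> bool" where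
  "irreducible_chain S M Z \<longleftrightarrow>
    (\<forall>x\<in>states S. \<forall>y\<in>states S. \<exists>t\<ge>0. trans_prob M Z t x y > 0)"

text \<open>First time the path is at \<open>x\<close> after having been elsewhere (infinite if there is none).\<close>

definition return_time :: "(real \<Rightarrow> 'w \<Rightarrow> state) \<Rightarrow> state \<Rightarrow> 'w \<Rightarrow> ennreal" where
  "return_time Z x \<omega> = (INF t\<in>{t. 0 < t \<and> Z t \<omega> = x \<and> (\<exists>s. 0 < s \<and> s < t \<and> Z s \<omega> \<noteq> x)}. ennreal t)"

definition positive_recurrent ::
  "(nat \<Rightarrow> nat) \<Rightarrow> (state \<Rightarrow> 'w measure) \<Rightarrow> (real \<Rightarrow> 'w \<Rightarrow> state) \<Rightarrow> bool" where
  "positive_recurrent S M Z \<longleftrightarrow>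
    (\<forall>x\<in>states S. (\<integral>\<^sup>+ \<omega>. return_time Z x \<omega> \<partial>M x) < \<infinity>)"

definition ergodic_chain ::
  "(nat \<Rightarrow> nat) \<Rightarrow> (state \<Rightarrow> 'w measure) \<Rightarrow> (real \<Rightarrow> 'w \<Rightarrow> state) \<Rightarrow> bool" where
  "ergodic_chain S M Z \<longleftrightarrow> irreducible_chain S M Z \<and> positive_recurrent S M Z"

definition stationary_distribution ::
  "(nat \<Rightarrow> nat) \<Rightarrow> qmatrix \<Rightarrow> (state \<Rightarrow> real) \<Rightarrow> bool" where
  "stationary_distribution S Q p \<longleftrightarrow>
    (\<forall>x\<in>states S. 0 \<le> p x) \<and>
    (p has_sum 1) (states S) \<and>
    (\<forall>y\<in>states S. ((\<lambda>x. p x * Q x y) has_sum 0) (states S))"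


fun lc_trunc :: "qmatrix \<Rightarrow> nat \<Rightarrow> qmatrix" where
  "lc_trunc Q n (k, i) (l, j) =
    (if l < n then Q (k, i) (l, j)
     else if l = n then Q (k, i) (n, j) + (\<Sum>\<^sub>\<infinity>m\<in>{m. m > n \<and> m \<noteq> k}. Q (k, i) (m, j))
     else if l = k then Q (k, i) (k, j)
     else 0)"

text \<open>The truncation comes as a \<open>q\<close>-matrix without an underlying process, so accessibility is read
  off its transition graph.\<close>

definition accessible :: "(nat \<Rightarrow> nat) \<Rightarrow> qmatrix \<Rightarrow> state \<Rightarrow> state \<Rightarrow> bool" where
  "accessible S Q x y \<longleftrightarrow>
    (x, y) \<in> {(a, b). a \<in> states S \<and> b \<in> states S \<and> a \<noteq> b \<and> Q a b > 0}\<^sup>*"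

definition communicating_class :: "(nat \<Rightarrow> nat) \<Rightarrow> qmatrix \<Rightarrow> state set \<Rightarrow> bool" where
  "communicating_class S Q C \<longleftrightarrow>
    (\<exists>x\<in>states S. C = {y \<in> states S. accessible S Q x y \<and> accessible S Q y x})"

definition closed_class :: "(nat \<Rightarrow> nat) \<Rightarrow> qmatrix \<Rightarrow> state set \<Rightarrow> bool" where
  "closed_class S Q C \<longleftrightarrow> (\<forall>x\<in>C. \<forall>y\<in>states S. accessible S Q x y \<longrightarrow> y \<in> C)"


text \<open>The drift condition \<open>Q v \<le> - f + b 1\<^bsub>F_K\<^esub>\<close>; finiteness of \<open>Q v\<close> is part of it, since
  \<open>infsum\<close> is zero for a divergent sum.\<close>

definition drift_condition ::
  "(nat \<Rightarrow> nat) \<Rightarrow> qmatrix \<Rightarrow> (state \<Rightarrow> real) \<Rightarrow> (state \<Rightarrow> real) \<Rightarrow> real \<Rightarrow> nat \<Rightarrow> bool" where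
  "drift_condition S Q v f b K \<longleftrightarrow>
    (\<forall>x\<in>states S.
      (\<lambda>y. Q x y * v y) summable_on states S \<and>
      (\<Sum>\<^sub>\<infinity>y\<in>states S. Q x y * v y) \<le> - f x + b * indicator (states_upto S K) x)"

definition resolvent ::
  "(state \<Rightarrow> 'w measure) \<Rightarrow> (real \<Rightarrow> 'w \<Rightarrow> state) \<Rightarrow> real \<Rightarrow> qmatrix" where
  "resolvent M Z \<beta> x y = (LBINT t:{0..}. \<beta> * exp (- \<beta> * t) * trans_prob M Z t x y)"

definition phi_bar ::
  "(nat \<Rightarrow> nat) \<Rightarrow> (state \<Rightarrow> 'w measure) \<Rightarrow> (real \<Rightarrow> 'w \<Rightarrow> state) \<Rightarrow> real \<Rightarrow> nat \<Rightarrow> real" where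
  "phi_bar S M Z \<beta> K = (SUP y\<in>states S. MIN x\<in>states_upto S K. resolvent M Z \<beta> x y)"

text \<open>In the truncation error bound \<open>E(n)\<close> below, \<open>c\<close> is \<open>\<pi> v + 2 b / (\<beta> \<phi>)\<close> with
  \<open>\<phi>\<close> the constant \<^const>\<open>phi_bar\<close>, and \<open>pn\<close> is the stationary distribution of the truncation.
  The subvectors \<open>v(m)\<close> and \<open>v(n)\<close> have the same length because \<open>m, n \<ge> 1\<close>.\<close>

definition error_bound ::
  "(nat \<Rightarrow> nat) \<Rightarrow> (state \<Rightarrow> 'w measure) \<Rightarrow> (real \<Rightarrow> 'w \<Rightarrow> state) \<Rightarrow> qmatrix \<Rightarrow>
   (state \<Rightarrow> real) \<Rightarrow> (state \<Rightarrow> real) \<Rightarrow> (state \<Rightarrow> real) \<Rightarrow> real \<Rightarrow> nat \<Rightarrow> real \<Rightarrow> nat \<Rightarrow> real" where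
  "error_bound S M Z Q p pn v b K \<beta> n =
    (let c = row_times_col S p v + 2 * b / (\<beta> * phi_bar S M Z \<beta> K) in
     2 * (\<Sum>k=0..n. \<Sum>i=0..S k. pn (k, i) *
       (\<Sum>\<^sub>\<infinity>m\<in>{n<..}. \<Sum>j=0..S m. Q (k, i) (m, j) * (v (m, j) + v (n, j) + 2 * c))))"

end

theory Submission
  imports Defs
begin

text \<open>Write \<open>p\<close> for the stationary distribution of the truncation.  Testing \<open>\<pi> - p\<close> against
\<open>G = sgn (\<pi> - p) g\<close> turns the weighted error into a difference of two means, hence into
\<open>- p u\<close> for the centred function \<open>u = G - \<pi> G\<close>, for which \<open>\<bar>u\<bar> \<le> (\<pi> g + 1) f\<close>.  If \<open>h\<close> solves the
Poisson equation \<open>Q h = - u\<close>, then invariance of \<open>p\<close> under the truncated generator \<open>Q\<^sub>n\<close> gives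
\<open>p u = p (Q\<^sub>n - Q) h\<close>.  In a row of \<open>Q\<^sub>n - Q\<close> with level at most \<open>n\<close> the rates into each state
\<open>(m, j)\<close> with \<open>m > n\<close> are moved to \<open>(n, j)\<close>, so only the differences \<open>h (n, j) - h (m, j)\<close> enter, and
a bound \<open>\<bar>h\<bar> \<le> (\<pi> g + 1) (v + c)\<close> produces exactly the summand \<open>v (m, j) + v (n, j) + 2 c\<close> of the error
bound (\<open>trunc_row\<close>, \<open>truncation_error\<close>).  It remains to solve the Poisson equation with such a bound.

Drift towards the finite set \<open>F\<^sub>K\<close> is first converted into drift towards a single state.  The
resolvent satisfies \<open>Q \<phi>(\<cdot>, \<alpha>) = \<beta> (\<phi>(\<cdot>, \<alpha>) - 1\<^sub>\<alpha>)\<close>, so for \<open>\<delta> \<le> \<phi>(\<cdot>, \<alpha>)\<close> on \<open>F\<^sub>K\<close> the function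
\<open>w = v + b / (\<beta> \<delta>) (1 - \<phi>(\<cdot>, \<alpha>))\<close> has \<open>Q w \<le> - f\<close> off \<open>\<alpha>\<close>: the extra term contributes at most
\<open>- b\<close> on \<open>F\<^sub>K\<close> (\<open>away_generator\<close>, \<open>atom_poisson_from_drift\<close>).  Choosing \<open>\<alpha>\<close> with \<open>\<delta>\<close> at least half
of the supremum that defines \<open>phi_bar\<close> gives \<open>w \<le> v + 2 b / (\<beta> phi_bar) \<le> v + c\<close>
for the constant \<open>c\<close> of the error bound.

Now let \<open>h(x)\<close> be the integral of \<open>u\<close> along the chain from \<open>x\<close> until it hits \<open>\<alpha>\<close>, computed from
the minimal Green function of the jump rates killed at \<open>\<alpha>\<close>.  Then \<open>\<bar>h\<bar> \<le> w\<close> when \<open>\<bar>u\<bar> \<le> f\<close>, and the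
Poisson equation holds off \<open>\<alpha>\<close> by a first-jump decomposition.  At \<open>\<alpha>\<close> it says that \<open>u\<close> has mean zero
over a cycle, and this follows from \<open>\<pi> u = 0\<close> once \<open>\<pi>\<close> is known to be proportional to the occupation
measure of a cycle (\<open>stationary_cycle_formula\<close>, \<open>poisson_solution\<close>).  The latter needs that \<open>\<alpha>\<close> is hit with
probability one by the minimal chain; it can fail for explosive rates, because the drift only
bounds the smaller of the hitting time and the explosion time.

Non-explosion enters through Reuter's criterion: a function \<open>0 \<le> \<zeta> \<le> 1\<close> with
\<open>\<lambda> \<zeta> \<le> Q \<zeta>\<close> vanishes.  Such a \<open>\<zeta>\<close> lies below the Laplace transform at \<open>\<lambda>\<close> of the \<open>n\<close>-th jump time for
every \<open>n\<close>, which by Fatou's lemma is bounded by the corresponding transforms for the skeletons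
\<open>Z(0), Z(d), Z(2 d), \<dots>\<close> as \<open>d\<close> decreases to zero.  A skeleton changes its state on \<open>[0, t]\<close> no more often than the path jumps,
and a path with finitely many jumps makes \<open>n\<close> of them with a probability that tends to zero
(\<open>regular_rates_R\<close>).\<close>


section \<open>Potentials of jump rates killed at an atom\<close>

text \<open>Extended nonnegative reals make every interchange of sums below unconditional.  A rate matrix is
therefore represented by its off-diagonal part, and \<open>act R (\<lambda>_. 1)\<close> is the vector of exit rates.\<close>

definition act :: "('a \<Rightarrow> 'a \<Rightarrow> ennreal) \<Rightarrow> ('a \<Rightarrow> ennreal) \<Rightarrow> 'a \<Rightarrow> ennreal" where
  "act R u x = (\<integral>\<^sup>+ y. R x y * u y \<partial>count_space UNIV)"

lemma act_mono: "(\<And>y. R x y \<noteq> 0 \<Longrightarrow> u y \<le> u' y) \<Longrightarrow> act R u x \<le> act R u' x"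
  unfolding act_def by (rule nn_integral_mono) (metis mult_left_mono mult_zero_left order_refl zero_le)

lemma act_cong: "(\<And>y. R x y \<noteq> 0 \<Longrightarrow> u y = u' y) \<Longrightarrow> act R u x = act R u' x"
  by (intro antisym act_mono) auto

lemma act_add: "act R (\<lambda>y. u y + u' y) x = act R u x + act R u' x"
  unfolding act_def by (simp add: distrib_left nn_integral_add)

lemma act_cmult: "act R (\<lambda>y. c * u y) x = c * act R u x"
  unfolding act_def by (subst nn_integral_cmult[symmetric]) (auto simp: mult_ac)

lemma act_zero [simp]: "act R (\<lambda>y. 0) x = 0"
  by (simp add: act_def)

lemma act_sum: "finite I \<Longrightarrow> act R (\<lambda>y. \<Sum>i\<in>I. u i y) x = (\<Sum>i\<in>I. act R (u i) x)"
  by (induction I rule: finite_induct) (auto simp: act_add)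

lemma act_suminf: "act R (\<lambda>y. \<Sum>n. u n y) x = (\<Sum>n. act R (u n) x)"
  unfolding act_def by (subst nn_integral_suminf[symmetric]) auto

lemma act_indicator: "act R (indicator {y}) x = R x y"
  unfolding act_def by (simp add: mult.commute)

lemma nn_integral_count_space_swap:
  "(\<integral>\<^sup>+ x. \<integral>\<^sup>+ y. h x y \<partial>count_space UNIV \<partial>count_space UNIV) =
   (\<integral>\<^sup>+ y. \<integral>\<^sup>+ x. h x y \<partial>count_space UNIV \<partial>count_space UNIV)"
  using nn_integral_fst_count_space[of "\<lambda>(x, y). h x y"] nn_integral_snd_count_space[of "\<lambda>(x, y). h x y"]
  by simp

lemma act_nn_integral:
  "act R (\<lambda>z. \<integral>\<^sup>+ y. k z y * u y \<partial>count_space UNIV) x = (\<integral>\<^sup>+ y. act R (\<lambda>z. k z y) x * u y \<partial>count_space UNIV)"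
proof -
  have "act R (\<lambda>z. \<integral>\<^sup>+ y. k z y * u y \<partial>count_space UNIV) x
      = (\<integral>\<^sup>+ z. \<integral>\<^sup>+ y. R x z * k z y * u y \<partial>count_space UNIV \<partial>count_space UNIV)"
    unfolding act_def by (simp add: nn_integral_cmult[symmetric] mult.assoc)
  also have "\<dots> = (\<integral>\<^sup>+ y. \<integral>\<^sup>+ z. R x z * k z y * u y \<partial>count_space UNIV \<partial>count_space UNIV)"
    by (rule nn_integral_count_space_swap)
  also have "\<dots> = (\<integral>\<^sup>+ y. act R (\<lambda>z. k z y) x * u y \<partial>count_space UNIV)"
    unfolding act_def by (simp add: nn_integral_multc[symmetric])
  finally show ?thesis .
qed

text \<open>Reuter's analytic criterion for non-explosion: the minimal chain with rates \<open>R\<close> makes finitely many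
jumps in finite time iff \<open>\<gamma> \<zeta> \<le> Q \<zeta>\<close> has no nonzero solution with values in \<open>[0, 1]\<close>.  With the diagonal
term moved to the left it can be stated without subtraction.\<close>

definition regular_rates :: "('a \<Rightarrow> 'a \<Rightarrow> ennreal) \<Rightarrow> bool" where
  "regular_rates R \<longleftrightarrow>
    (\<forall>(\<gamma>::real)>0. \<forall>\<zeta>. (\<forall>x. \<zeta> x \<le> 1 \<and> (ennreal \<gamma> + act R (\<lambda>_. 1) x) * \<zeta> x \<le> act R \<zeta> x) \<longrightarrow> (\<forall>x. \<zeta> x = 0))"

text \<open>A Lyapunov function \<open>w\<close> for the single state \<open>\<alpha>\<close>: its generator is at most \<open>- f\<close> elsewhere.  Again the
diagonal term is on the right-hand side, to stay within nonnegative quantities.\<close>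

locale atom_drift =
  fixes R :: "'a \<Rightarrow> 'a \<Rightarrow> ennreal" and X :: "'a set" and \<alpha> :: 'a and f w :: "'a \<Rightarrow> ennreal"
  assumes R_outside: "x \<notin> X \<or> y \<notin> X \<Longrightarrow> R x y = 0"
    and no_loop: "R x x = 0"
    and atom: "\<alpha> \<in> X"
    and exit_finite: "act R (\<lambda>_. 1) x < \<infinity>"
    and w_finite: "w x < \<infinity>"
    and drift: "x \<in> X - {\<alpha>} \<Longrightarrow> f x + act R w x \<le> act R (\<lambda>_. 1) x * w x"
    and f_ge_1: "x \<in> X - {\<alpha>} \<Longrightarrow> 1 \<le> f x"
    and regular: "regular_rates R"
begin

abbreviation q :: "'a \<Rightarrow> ennreal" where "q \<equiv> act R (\<lambda>_. 1)"

text \<open>The jump chain killed on hitting \<open>\<alpha>\<close>.  The entries in column \<open>\<alpha>\<close> are kept; as no row leaves \<open>\<alpha>\<close>, they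
only matter in the first step of an iteration and disappear for functions that vanish at \<open>\<alpha>\<close>.\<close>

definition J :: "'a \<Rightarrow> 'a \<Rightarrow> ennreal" where
  "J x y = (if x \<in> X - {\<alpha>} then R x y / q x else 0)"

text \<open>A visit to \<open>x\<close> lasts \<open>1 / q x\<close> on average, so this is the mean contribution of one visit to the
integral of \<open>g\<close> along the path.\<close>

definition per_visit :: "('a \<Rightarrow> ennreal) \<Rightarrow> 'a \<Rightarrow> ennreal" where
  "per_visit g x = (if x \<in> X - {\<alpha>} then g x / q x else 0)"

definition green :: "('a \<Rightarrow> ennreal) \<Rightarrow> 'a \<Rightarrow> ennreal" where
  "green u x = (\<Sum>n. (act J ^^ n) u x)"

text \<open>The expected integral of \<open>g\<close> along the minimal chain until it hits \<open>\<alpha>\<close> or explodes.\<close>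

definition pot :: "('a \<Rightarrow> ennreal) \<Rightarrow> 'a \<Rightarrow> ennreal" where
  "pot g = green (per_visit g)"

text \<open>No state other than \<open>\<alpha>\<close> is absorbing, since the drift inequality would read \<open>f x \<le> 0\<close> there.\<close>

lemma q_pos: assumes "x \<in> X - {\<alpha>}" shows "q x \<noteq> 0"
proof
  assume "q x = 0"
  then have "f x + act R w x \<le> 0" using drift[OF assms] by simp
  then show False using f_ge_1[OF assms] by (simp add: add_eq_0_iff_both_eq_0)
qed

lemma q_cancel: "x \<in> X - {\<alpha>} \<Longrightarrow> q x * (a / q x) = a"
  using q_pos[of x] exit_finite[of x] mult_divide_eq_ennreal[of "q x" a]
  by (simp add: ennreal_times_divide mult.commute less_top)

lemma q_cancel': "x \<in> X - {\<alpha>} \<Longrightarrow> (q x * a) / q x = a"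
  using q_cancel[of x a] by (simp add: ennreal_times_divide)

lemma act_J: "act J u x = per_visit (act R u) x"
proof (cases "x \<in> X - {\<alpha>}")
  case True
  have "act J u x = (\<integral>\<^sup>+ y. R x y * u y * inverse (q x) \<partial>count_space UNIV)"
    unfolding act_def[of J] using True by (simp add: J_def divide_ennreal_def mult_ac)
  also have "\<dots> = act R u x * inverse (q x)"
    by (subst nn_integral_multc) (auto simp: act_def)
  finally show ?thesis using True by (simp add: per_visit_def divide_ennreal_def)
next
  case False
  then have "J x = (\<lambda>_. 0)" by (auto simp: J_def)
  then show ?thesis using False by (auto simp: per_visit_def act_def)
qed

lemma green_eq: "green u x = u x + act J (green u) x"
proof -
  have "green u x = (\<Sum>n. (act J ^^ (Suc n)) u x) + u x"
    unfolding green_def by (subst suminf_offset[where i=1]) (auto simp: add.commute)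
  also have "(\<Sum>n. (act J ^^ (Suc n)) u x) = act J (green u) x"
    unfolding green_def by (simp add: act_suminf)
  finally show ?thesis by (simp add: add.commute)
qed

lemma sum_iterates_Suc:
  "(\<Sum>j<Suc n. (act J ^^ j) u x) = u x + act J (\<lambda>y. \<Sum>j<n. (act J ^^ j) u y) x"
  by (subst sum.lessThan_Suc_shift) (simp add: act_sum)

text \<open>Minimality of the Green potential: every supersolution dominates all partial sums.\<close>

lemma green_le:
  assumes "\<And>x. u x + act J s x \<le> s x"
  shows "green u x \<le> s x"
proof -
  have "(\<Sum>j<n. (act J ^^ j) u x) \<le> s x" for n x
  proof (induction n arbitrary: x)
    case (Suc n)
    have "u x + act J (\<lambda>y. \<Sum>j<n. (act J ^^ j) u y) x \<le> u x + act J s x"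
      by (intro add_left_mono act_mono Suc)
    then show ?case unfolding sum_iterates_Suc using assms order_trans by blast
  qed simp
  then show ?thesis unfolding green_def by (intro suminf_le_const) auto
qed

lemma J_outside: "x \<notin> X - {\<alpha>} \<Longrightarrow> act J u x = 0"
  by (auto simp: act_J per_visit_def)

lemma green_outside: "u x = 0 \<Longrightarrow> x \<notin> X - {\<alpha>} \<Longrightarrow> green u x = 0"
  by (subst green_eq) (simp add: J_outside)

lemma pot_atom: "pot g \<alpha> = 0"
  unfolding pot_def by (rule green_outside) (auto simp: per_visit_def)

text \<open>The drift inequality says that \<open>w\<close>, set to zero outside \<open>X - {\<alpha>}\<close>, is a supersolution.\<close>

lemma pot_le:
  assumes "\<And>x. x \<in> X - {\<alpha>} \<Longrightarrow> g x \<le> f x"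
  shows "pot g x \<le> w x"
proof -
  let ?w = "\<lambda>x. if x \<in> X - {\<alpha>} then w x else 0"
  have "pot g x \<le> ?w x"
    unfolding pot_def
  proof (rule green_le)
    fix x
    show "per_visit g x + act J ?w x \<le> ?w x"
    proof (cases "x \<in> X - {\<alpha>}")
      case True
      have "per_visit g x + act J ?w x = (g x + act R ?w x) / q x"
        using True by (simp add: per_visit_def act_J add_divide_distrib_ennreal)
      also have "\<dots> \<le> (f x + act R w x) / q x"
        using True by (intro divide_right_mono_ennreal add_mono assms act_mono) auto
      also have "\<dots> \<le> (q x * w x) / q x"
        using True by (intro divide_right_mono_ennreal drift)
      also have "\<dots> = w x" using True by (rule q_cancel')
      finally show ?thesis using True by simp
    qed (auto simp: per_visit_def act_J)
  qed
  then show ?thesis by (auto split: if_splits)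
qed

lemma pot_eq: 
  assumes "x \<in> X - {\<alpha>}"
  shows "q x * pot g x = g x + act R (pot g) x"
proof -
  have "pot g x = (g x + act R (pot g) x) / q x"
    using assms unfolding pot_def
    by (subst green_eq) (simp add: per_visit_def act_J add_divide_distrib_ennreal)
  then show ?thesis using q_cancel[OF assms] by simp
qed

text \<open>For \<open>g x = R x \<alpha>\<close> the potential is the probability that the minimal chain hits \<open>\<alpha>\<close>.  Its complement \<open>z\<close>
is bounded and harmonic off \<open>\<alpha>\<close>.  The drift makes \<open>z - \<gamma> w\<close>, cut off at zero, a solution of the
inequality in Reuter's criterion for every \<open>\<gamma> > 0\<close>; hence \<open>z \<le> \<gamma> w\<close>, and \<open>z = 0\<close> as \<open>w\<close> is finite.\<close>

lemma hit_surely: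
  assumes "x \<in> X - {\<alpha>}"
  shows "pot (\<lambda>x. R x \<alpha>) x = 1"
proof -
  let ?r = "\<lambda>x. R x \<alpha>"
  define H where "H = pot ?r"
  define D :: "'a \<Rightarrow> ennreal" where "D = indicator (X - {\<alpha>})"
  have split1: "act R D x + R x \<alpha> = q x" if "x \<in> X - {\<alpha>}" for x
  proof -
    have "act R (\<lambda>y. D y + indicator {\<alpha>} y) x = q x"
      by (rule act_cong) (use R_outside in \<open>force simp: D_def indicator_def\<close>)
    then show ?thesis by (simp add: act_add act_indicator)
  qed
  have H_le: "H x \<le> D x" for x
    unfolding H_def pot_def
  proof (rule green_le)
    fix x show "per_visit ?r x + act J D x \<le> D x"
      using split1[of x] q_cancel'[of x 1]
      by (auto simp: per_visit_def act_J D_def add.commute simp flip: add_divide_distrib_ennreal)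
  qed
  \<comment> \<open>The probability of never hitting the atom, as a function that vanishes at the atom and off the state space.\<close>
  define z where "z x = D x - H x" for x
  have zH: "D y = z y + H y" for y
    using H_le[of y] unfolding z_def by (simp add: diff_add_self_ennreal)
  have H_fin: "H y < \<infinity>" for y
    by (rule le_less_trans[OF H_le]) (simp add: D_def indicator_def)
  have z_harm: "q x * z x = act R z x" if x: "x \<in> X - {\<alpha>}" for x
  proof -
    have "act R H x + R x \<alpha> + act R z x = act R D x + R x \<alpha>"
      using act_add[of R z H x] by (simp add: zH[abs_def] add_ac)
    also have "\<dots> = q x * (z x + H x)"
      using split1[OF x] x zH[of x] by (simp add: D_def)
    also have "\<dots> = q x * z x + (R x \<alpha> + act R H x)"
      using pot_eq[OF x, of ?r] by (simp add: distrib_left H_def)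
    finally have "(act R H x + R x \<alpha>) + act R z x = (act R H x + R x \<alpha>) + q x * z x"
      by (simp add: add_ac)
    moreover have "act R H x + R x \<alpha> \<noteq> \<infinity>"
    proof -
      have "act R H x + R x \<alpha> = q x * H x" using pot_eq[OF x, of ?r] by (simp add: H_def add.commute)
      then show ?thesis using exit_finite[of x] H_fin[of x] by (auto simp: ennreal_mult_eq_top_iff)
    qed
    ultimately show ?thesis by (simp add: ennreal_add_left_cancel)
  qed
  have z_bound: "z x \<le> ennreal \<gamma> * w x" if "\<gamma> > 0" for \<gamma> :: real and x
  proof -
    \<comment> \<open>Subtraction of extended nonnegative reals cuts off at zero.\<close>
    define \<zeta> where "\<zeta> y = z y - ennreal \<gamma> * w y" for y
    have z_le: "z y \<le> \<zeta> y + ennreal \<gamma> * w y" for y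
      unfolding \<zeta>_def by (auto simp: diff_add_self_ennreal)
    have z1: "z y \<le> 1" for y 
      unfolding z_def D_def by (rule order_trans[OF diff_le_self_ennreal]) (auto simp: indicator_def)
    have "(ennreal \<gamma> + q y) * \<zeta> y \<le> act R \<zeta> y" for y
    proof (cases "\<zeta> y = 0")
      case False
      then have pos: "z y > ennreal \<gamma> * w y"
        using le_less_trans[OF z1[of y] ennreal_one_less_top]
        unfolding \<zeta>_def by (auto simp: diff_eq_0_iff_ennreal)
      then have y: "y \<in> X - {\<alpha>}" by (cases "y \<in> X - {\<alpha>}") (auto simp: z_def D_def)
      have eq: "z y = \<zeta> y + ennreal \<gamma> * w y"
        unfolding \<zeta>_def using pos by (auto simp: diff_add_self_ennreal)
      have \<zeta>1: "\<zeta> y \<le> 1" using z1[of y] unfolding \<zeta>_def by (rule ennreal_diff_le_mono_left)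
      let ?L = "ennreal \<gamma> * act R w y"
      have "?L + (ennreal \<gamma> + q y) * \<zeta> y \<le> ?L + (ennreal \<gamma> * f y + q y * \<zeta> y)"
                unfolding distrib_right
        by (intro add_left_mono add_right_mono mult_left_mono order_trans[OF \<zeta>1 f_ge_1[OF y]]) simp
      also have "\<dots> = ennreal \<gamma> * (f y + act R w y) + q y * \<zeta> y"
        by (simp add: distrib_left add_ac)
      also have "\<dots> \<le> ennreal \<gamma> * (q y * w y) + q y * \<zeta> y"
        using drift[OF y] by (intro add_mono mult_left_mono) auto
      also have "\<dots> = q y * z y" by (simp add: eq distrib_left mult_ac add_ac)
      also have "\<dots> = act R z y" by (rule z_harm[OF y])
      also have "\<dots> \<le> act R (\<lambda>y. \<zeta> y + ennreal \<gamma> * w y) y" by (intro act_mono z_le)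
      also have "\<dots> = ?L + act R \<zeta> y" by (simp add: act_add act_cmult add.commute)
      finally show ?thesis
      proof (subst (asm) ennreal_add_left_cancel_le, elim disjE)
        assume "?L = \<infinity>"
        moreover have "act R w y < \<infinity>"
        proof (rule le_less_trans)
          show "act R w y \<le> q y * w y"
            using drift[OF y] by (rule order_trans[rotated]) simp
          show "q y * w y < \<infinity>"
            using exit_finite[of y] w_finite[of y] by (simp add: ennreal_mult_less_top)
        qed
        ultimately show ?thesis by (simp add: ennreal_mult_eq_top_iff)
      qed
    qed simp
    moreover have "\<zeta> y \<le> 1" for y
      unfolding \<zeta>_def using z1[of y] by (rule ennreal_diff_le_mono_left)
    ultimately have "\<zeta> x = 0"
      using regular \<open>\<gamma> > 0\<close> unfolding regular_rates_def by blast
    then show ?thesis using z_le[of x] by simp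
  qed
  have "z x = 0"
  proof -
    obtain c where c: "w x = ennreal c" "c \<ge> 0" using w_finite[of x] by (cases "w x") auto
    have "z x \<le> 0 + ennreal e" if "e > 0" for e :: real
    proof -
      have "z x \<le> ennreal (e / (c + 1)) * ennreal c" using z_bound[of "e / (c+1)" x] c that by simp
      also have "\<dots> = ennreal (e / (c + 1) * c)" using c that by (subst ennreal_mult) auto
      also have "\<dots> \<le> ennreal e" using c that by (intro ennreal_leI) (simp add: field_simps)
      finally show ?thesis by simp
    qed
    then show ?thesis by (metis ennreal_le_epsilon le_zero_eq)
  qed
  then show ?thesis using zH[of x] assms by (simp add: D_def H_def)
qed

lemma iterate_kernel:
  "(act J ^^ n) u x = (\<integral>\<^sup>+ y. (act J ^^ n) (indicator {y}) x * u y \<partial>count_space UNIV)"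
proof (induction n arbitrary: x)
  case 0 
  have "(\<integral>\<^sup>+ y. indicator {y} x * u y \<partial>count_space UNIV) = (\<integral>\<^sup>+ y. u y * indicator {x} y \<partial>count_space UNIV)"
    by (intro nn_integral_cong) (auto simp: indicator_def)
  then show ?case by simp
next
  case (Suc n)
  show ?case
    unfolding funpow.simps comp_def Suc[abs_def] by (simp add: act_nn_integral)
qed

lemma green_kernel:
  "green u x = (\<integral>\<^sup>+ y. green (indicator {y}) x * u y \<partial>count_space UNIV)"
  unfolding green_def
  by (subst iterate_kernel) (simp add: nn_integral_suminf[symmetric])

end

text \<open>Global balance for a measure \<open>\<pi>\<close> that is only assumed to be finite at each state.\<close>

locale atom_drift_stationary = atom_drift +
  fixes \<pi> :: "'a \<Rightarrow> ennreal"
  assumes pi_outside: "x \<notin> X \<Longrightarrow> \<pi> x = 0"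
    and pi_finite: "\<pi> x < \<infinity>"
    and balance: "(\<integral>\<^sup>+ x. \<pi> x * R x y \<partial>count_space UNIV) = \<pi> y * act R (\<lambda>_. 1) y"
begin

text \<open>The measure \<open>x \<mapsto> \<pi> x * q x\<close> is the stationary flow of the jump chain.  It may be infinite, so
convergence of integrals against it has to be argued state by state.\<close>

definition flow :: "('a \<Rightarrow> ennreal) \<Rightarrow> ennreal" where
  "flow u = (\<integral>\<^sup>+ x. \<pi> x * q x * u x \<partial>count_space UNIV)"

text \<open>Balance in integrated form: flow into the complement of \<open>\<alpha>\<close> comes either from \<open>\<alpha>\<close> or from the
complement itself.\<close>

lemma flow_step:
  assumes "u \<alpha> = 0"
  shows "flow u = \<pi> \<alpha> * act R u \<alpha> + flow (act J u)"
proof -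
  have "flow u = (\<integral>\<^sup>+ y. \<integral>\<^sup>+ x. \<pi> x * R x y * u y \<partial>count_space UNIV \<partial>count_space UNIV)"
    unfolding flow_def balance[symmetric] by (simp add: nn_integral_multc[symmetric])
  also have "\<dots> = (\<integral>\<^sup>+ x. \<integral>\<^sup>+ y. \<pi> x * R x y * u y \<partial>count_space UNIV \<partial>count_space UNIV)"
    by (rule nn_integral_count_space_swap)
  also have "\<dots> = (\<integral>\<^sup>+ x. \<pi> x * act R u x \<partial>count_space UNIV)"
    unfolding act_def by (simp add: nn_integral_cmult[symmetric] mult.assoc)
  also have "\<dots> = (\<integral>\<^sup>+ x. \<pi> \<alpha> * act R u \<alpha> * indicator {\<alpha>} x + \<pi> x * q x * act J u x \<partial>count_space UNIV)"
  proof (intro nn_integral_cong)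
    fix x
    show "\<pi> x * act R u x = \<pi> \<alpha> * act R u \<alpha> * indicator {\<alpha>} x + \<pi> x * q x * act J u x"
      using pi_outside[of x] q_cancel[of x "act R u x"]
      by (cases "x \<in> X"; cases "x = \<alpha>") (auto simp: act_J per_visit_def mult.assoc)
  qed
  also have "\<dots> = \<pi> \<alpha> * act R u \<alpha> + flow (act J u)"
    by (subst nn_integral_add) (auto simp: flow_def nn_integral_cmult_indicator)
  finally show ?thesis .
qed

lemma iterate_atom: "u \<alpha> = 0 \<Longrightarrow> (act J ^^ n) u \<alpha> = 0"
  by (cases n) (auto simp: J_outside)

lemma flow_iterate:
  assumes "u \<alpha> = 0"
  shows "flow u = (\<Sum>j<n. \<pi> \<alpha> * act R ((act J ^^ j) u) \<alpha>) + flow ((act J ^^ n) u)"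
proof (induction n)
  case (Suc n)
  show ?case using flow_step[of "(act J ^^ n) u"] iterate_atom[of u n] assms Suc by (simp add: add_ac)
qed simp

lemma return_sum: "(\<Sum>j. \<pi> \<alpha> * act R ((act J ^^ j) u) \<alpha>) = \<pi> \<alpha> * act R (green u) \<alpha>"
  unfolding green_def by (simp add: act_suminf)

text \<open>By balance the total flow into \<open>\<alpha>\<close> is \<open>\<pi> \<alpha> * q \<alpha>\<close>.  As \<open>\<alpha>\<close> is hit surely, the excursions that start at
\<open>\<alpha>\<close> return exactly this amount.  What enters \<open>\<alpha>\<close> after having avoided it for at least \<open>n\<close> steps is therefore
the tail of a convergent series.\<close>

lemma flow_to_atom_vanishes:
  "(\<lambda>n. flow ((act J ^^ n) (per_visit (\<lambda>x. R x \<alpha>)))) \<longlonglongrightarrow> 0"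
proof -
  let ?s = "per_visit (\<lambda>x. R x \<alpha>)"
  let ?c = "\<lambda>j. \<pi> \<alpha> * act R ((act J ^^ j) ?s) \<alpha>"
  have s0: "?s \<alpha> = 0" by (simp add: per_visit_def)
  have fin: "\<pi> \<alpha> * q \<alpha> \<noteq> \<infinity>"
    using pi_finite[of \<alpha>] exit_finite[of \<alpha>] by (auto simp: ennreal_mult_eq_top_iff)
  have "flow ?s = (\<integral>\<^sup>+ x. \<pi> x * R x \<alpha> \<partial>count_space UNIV)"
    unfolding flow_def
  proof (intro nn_integral_cong)
    fix x show "\<pi> x * q x * ?s x = \<pi> x * R x \<alpha>"
      using pi_outside[of x] q_cancel[of x "R x \<alpha>"] no_loop[of \<alpha>]
      by (cases "x \<in> X"; cases "x = \<alpha>") (auto simp: per_visit_def mult.assoc)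
  qed
  then have fs: "flow ?s = \<pi> \<alpha> * q \<alpha>" by (simp add: balance)
  have "act R (green ?s) \<alpha> = q \<alpha>"
  proof (rule act_cong)
    fix y assume "R \<alpha> y \<noteq> 0"
    then have "y \<in> X - {\<alpha>}" using R_outside[of \<alpha> y] no_loop[of \<alpha>] by auto
    then show "green ?s y = 1" using hit_surely[of y] by (simp add: pot_def)
  qed
  then have sums: "(\<Sum>j. ?c j) = \<pi> \<alpha> * q \<alpha>" using return_sum[of ?s] by simp
  have "(\<lambda>n. \<Sum>j<n. ?c j) \<longlonglongrightarrow> \<pi> \<alpha> * q \<alpha>"
    using summable_LIMSEQ[of ?c] unfolding sums by blast
  then have "(\<lambda>n. \<pi> \<alpha> * q \<alpha> - (\<Sum>j<n. ?c j)) \<longlonglongrightarrow> \<pi> \<alpha> * q \<alpha> - \<pi> \<alpha> * q \<alpha>"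
    using fin by (intro tendsto_diff_ennreal tendsto_const) auto
  moreover have "\<pi> \<alpha> * q \<alpha> - (\<Sum>j<n. ?c j) = flow ((act J ^^ n) ?s)" for n
    using flow_iterate[of ?s n, OF s0] fin unfolding fs
    by (metis ennreal_add_diff_cancel_left infinity_ennreal_def ennreal_add_eq_top)
  ultimately show ?thesis using fin by simp
qed

lemma iterate_mono: "(\<And>x. u x \<le> u' x) \<Longrightarrow> (act J ^^ n) u x \<le> (act J ^^ n) u' x"
  by (induction n arbitrary: x) (auto intro!: act_mono)

lemma iterate_cmult: "(act J ^^ n) (\<lambda>x. c * u x) x = c * (act J ^^ n) u x"
proof (induction n arbitrary: x)
  case (Suc n)
  show ?case unfolding funpow.simps comp_def Suc[abs_def] by (rule act_cmult)
qed simp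

text \<open>From \<open>y\<close> the atom is reached in some number \<open>i\<close> of steps with positive probability \<open>e\<close>.  Hence the flow at \<open>y\<close>
that has avoided \<open>\<alpha>\<close> for \<open>n\<close> steps is at most \<open>1 / e\<close> times the flow that enters \<open>\<alpha>\<close> after avoiding it
for \<open>n + i\<close> steps, which tends to zero.  So the flow at \<open>y\<close> is carried by excursions from \<open>\<alpha>\<close>.\<close>

lemma flow_point:
  assumes y: "y \<in> X - {\<alpha>}"
  shows "\<pi> y * q y = \<pi> \<alpha> * act R (green (indicator {y})) \<alpha>"
proof -
  let ?s = "per_visit (\<lambda>x. R x \<alpha>)"
  let ?e = "indicator {y} :: 'a \<Rightarrow> ennreal"
  have e0: "?e \<alpha> = 0" using y by auto
  have "green ?s y = 1" using hit_surely[OF y] by (simp add: pot_def)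
  then have "\<exists>i. (act J ^^ i) ?s y \<noteq> 0"
    by (rule contrapos_pp) (simp add: green_def)
  then obtain i where i: "(act J ^^ i) ?s y \<noteq> 0" by blast
  define e where "e = min 1 ((act J ^^ i) ?s y)"
  have e: "e \<noteq> 0" "e < \<infinity>" using i le_less_trans[of e 1 \<infinity>] by (auto simp: e_def min_def)
  have bound: "e * flow ((act J ^^ n) ?e) \<le> flow ((act J ^^ (n + i)) ?s)" for n
  proof -
    have "e * flow ((act J ^^ n) ?e) = flow (\<lambda>x. e * (act J ^^ n) ?e x)"
      unfolding flow_def by (subst nn_integral_cmult[symmetric]) (auto simp: mult_ac)
    also have "\<dots> = flow ((act J ^^ n) (\<lambda>x. e * ?e x))"
      by (intro arg_cong[where f=flow] ext) (rule iterate_cmult[symmetric])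
    also have "\<dots> \<le> flow ((act J ^^ n) ((act J ^^ i) ?s))"
      unfolding flow_def
      by (intro nn_integral_mono mult_left_mono iterate_mono) (auto simp: e_def indicator_def)
    finally show ?thesis by (simp add: funpow_add)
  qed
  have "(\<lambda>n. e * flow ((act J ^^ n) ?e)) \<longlonglongrightarrow> 0"
  proof (rule tendsto_sandwich[OF _ _ tendsto_const])
    show "(\<lambda>n. flow ((act J ^^ (n + i)) ?s)) \<longlonglongrightarrow> 0"
      using flow_to_atom_vanishes by (rule LIMSEQ_ignore_initial_segment)
  qed (use bound in auto)
  then have "(\<lambda>n. (1/e) * (e * flow ((act J ^^ n) ?e))) \<longlonglongrightarrow> (1/e) * 0"
    using e by (intro ennreal_tendsto_cmult) (auto simp: ennreal_divide_eq_top_iff simp flip: less_top)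
  moreover have "(1/e) * (e * a) = a" for a
    using e mult_divide_eq_ennreal[of e a]
    by (simp add: ennreal_divide_times ennreal_times_divide mult.commute less_top)
  ultimately have lim: "(\<lambda>n. flow ((act J ^^ n) ?e)) \<longlonglongrightarrow> 0" by simp
  have "(\<lambda>n. (\<Sum>j<n. \<pi> \<alpha> * act R ((act J ^^ j) ?e) \<alpha>) + flow ((act J ^^ n) ?e))
      \<longlonglongrightarrow> \<pi> \<alpha> * act R (green ?e) \<alpha> + 0"
    unfolding return_sum[symmetric] by (intro tendsto_add lim summable_LIMSEQ) auto
  then have "(\<lambda>n::nat. flow ?e) \<longlonglongrightarrow> \<pi> \<alpha> * act R (green ?e) \<alpha>"
    by (simp flip: flow_iterate[of ?e, OF e0])
  then have "flow ?e = \<pi> \<alpha> * act R (green ?e) \<alpha>"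
    by (simp add: LIMSEQ_const_iff)
  then show ?thesis unfolding flow_def by simp
qed

text \<open>The ergodic cycle formula: \<open>\<pi>\<close> is proportional to the occupation measure of an excursion from \<open>\<alpha>\<close>.
It follows from \<open>flow_point\<close> by summation over the states.\<close>

lemma stationary_cycle_formula:
  "(\<integral>\<^sup>+ x. \<pi> x * g x * indicator (- {\<alpha>}) x \<partial>count_space UNIV) = \<pi> \<alpha> * act R (pot g) \<alpha>"
proof -
  have "act R (pot g) \<alpha> = (\<integral>\<^sup>+ y. act R (\<lambda>z. green (indicator {y}) z) \<alpha> * per_visit g y \<partial>count_space UNIV)"
    unfolding pot_def by (subst green_kernel[abs_def]) (rule act_nn_integral)
  then have "\<pi> \<alpha> * act R (pot g) \<alpha> =
      (\<integral>\<^sup>+ y. \<pi> \<alpha> * act R (green (indicator {y})) \<alpha> * per_visit g y \<partial>count_space UNIV)"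
    by (simp add: nn_integral_cmult[symmetric] mult.assoc)
  also have "\<dots> = (\<integral>\<^sup>+ x. \<pi> x * g x * indicator (- {\<alpha>}) x \<partial>count_space UNIV)"
  proof (intro nn_integral_cong)
    fix y
    show "\<pi> \<alpha> * act R (green (indicator {y})) \<alpha> * per_visit g y = \<pi> y * g y * indicator (- {\<alpha>}) y"
      using q_cancel[of y "g y"] pi_outside[of y]
      by (cases "y \<in> X - {\<alpha>}") (auto simp: per_visit_def mult.assoc flow_point[of y, symmetric])
  qed
  finally show ?thesis by simp
qed

end

section \<open>Jump times and the changes of a discrete skeleton\<close>

primrec path_weight :: "('a \<Rightarrow> 'a \<Rightarrow> ennreal) \<Rightarrow> 'a \<Rightarrow> 'a list \<Rightarrow> ennreal" where
  "path_weight p x [] = 1"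
| "path_weight p x (y # ys) = p x y * path_weight p y ys"

primrec changes :: "'a \<Rightarrow> 'a list \<Rightarrow> nat" where
  "changes x [] = 0"
| "changes x (y # ys) = (if y = x then 0 else 1) + changes y ys"

lemma path_weight_snoc: "path_weight p x (ys @ [y]) = path_weight p x ys * p (last (x # ys)) y"
  by (induction ys arbitrary: x) (auto simp: mult_ac)

lemma changes_snoc: "changes x (ys @ [y]) = changes x ys + (if y = last (x # ys) then 0 else 1)"
  by (induction ys arbitrary: x) auto

text \<open>The probability that a discrete chain with transition matrix \<open>p\<close> started at \<open>x\<close> changes its state at
least \<open>n\<close> times within \<open>m\<close> steps.\<close>

definition many_changes :: "('a \<Rightarrow> 'a \<Rightarrow> ennreal) \<Rightarrow> nat \<Rightarrow> nat \<Rightarrow> 'a \<Rightarrow> ennreal" where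
  "many_changes p n m x =
    (\<integral>\<^sup>+ ys. (if length ys = m \<and> n \<le> changes x ys then path_weight p x ys else 0) \<partial>count_space UNIV)"

lemma many_changes_Suc:
  "many_changes p n (Suc m) x = act p (\<lambda>y. many_changes p (if y = x then n else n - 1) m y) x"
proof -
  let ?g = "\<lambda>ys. if length ys = Suc m \<and> n \<le> changes x ys then path_weight p x ys else 0"
  have "many_changes p n (Suc m) x = (\<integral>\<^sup>+ ys. ?g ys \<partial>count_space {ys. ys \<noteq> []})"
    unfolding many_changes_def by (intro nn_integral_count_space_eq) auto
  also have "\<dots> = (\<integral>\<^sup>+ (y, ys). ?g (y # ys) \<partial>count_space UNIV)"
  proof -
    have "bij_betw (\<lambda>(y, ys). y # ys) UNIV {ys :: 'a list. ys \<noteq> []}"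
      by (rule bij_betwI[where g="\<lambda>ys. (hd ys, tl ys)"]) auto
    from nn_integral_bij_count_space[OF this, of ?g] show ?thesis
      by (simp only: case_prod_unfold)
  qed
  also have "\<dots> = (\<integral>\<^sup>+ y. \<integral>\<^sup>+ ys. ?g (y # ys) \<partial>count_space UNIV \<partial>count_space UNIV)"
    using nn_integral_fst_count_space[of "\<lambda>(y, ys). ?g (y # ys)"] by simp
  also have "\<dots> = (\<integral>\<^sup>+ y. p x y * many_changes p (if y = x then n else n - 1) m y \<partial>count_space UNIV)"
    unfolding many_changes_def
    by (intro nn_integral_cong, subst nn_integral_cmult[symmetric]) (auto intro!: nn_integral_cong)
  finally show ?thesis by (simp add: act_def)
qed

lemma many_changes_0_0:
  fixes x :: 'a
  shows "many_changes p 0 0 x = 1"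
proof -
  have "many_changes p 0 0 x = (\<integral>\<^sup>+ (ys :: 'a list). 1 * indicator {[]} ys \<partial>count_space UNIV)"
    unfolding many_changes_def by (intro nn_integral_cong) (simp add: indicator_def)
  then show ?thesis by simp
qed

text \<open>The generating function at \<open>r\<close> of the time of the \<open>n\<close>-th change of state.  The factor sums the geometric
series over the number of steps spent at \<open>x\<close> before it is left.\<close>

primrec discounted :: "('a \<Rightarrow> 'a \<Rightarrow> ennreal) \<Rightarrow> ennreal \<Rightarrow> nat \<Rightarrow> 'a \<Rightarrow> ennreal" where
  "discounted p r 0 x = 1"
| "discounted p r (Suc n) x =
    act (\<lambda>x y. if y = x then 0 else r * p x y / (1 - r * p x x)) (discounted p r n) x"

lemma act_off_diagonal: "act p u x = p x x * u x + act (\<lambda>x y. if y = x then 0 else p x y) u x"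
proof -
  have "p x x * u x + act (\<lambda>x y. if y = x then 0 else p x y) u x =
    (\<integral>\<^sup>+ y. p x x * u x * indicator {x} y + (if y = x then 0 else p x y) * u y \<partial>count_space UNIV)"
    unfolding act_def by (subst nn_integral_add) auto
  also have "\<dots> = act p u x"
    unfolding act_def by (intro nn_integral_cong) (auto simp: indicator_def)
  finally show ?thesis by simp
qed

lemma discounted_Suc:
  "discounted p r (Suc n) x =
    r * act (\<lambda>x y. if y = x then 0 else p x y) (discounted p r n) x / (1 - r * p x x)"
proof -
  have "discounted p r (Suc n) x = (\<integral>\<^sup>+ y. r * inverse (1 - r * p x x) *
      ((if y = x then 0 else p x y) * discounted p r n y) \<partial>count_space UNIV)"
    unfolding discounted.simps act_def
    by (intro nn_integral_cong) (auto simp: divide_ennreal_def mult_ac)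
  also have "\<dots> = r * act (\<lambda>x y. if y = x then 0 else p x y) (discounted p r n) x / (1 - r * p x x)"
    by (subst nn_integral_cmult) (auto simp: act_def divide_ennreal_def mult_ac)
  finally show ?thesis .
qed

lemma substochastic_diagonal:
  assumes "act p (\<lambda>_. 1) x \<le> 1" shows "p x x \<le> 1"
proof -
  have "act p (indicator {x}) x \<le> act p (\<lambda>_. 1) x" by (intro act_mono) (auto simp: indicator_def)
  then show ?thesis using assms by (simp add: act_indicator)
qed

lemma discounted_le_1:
  assumes sub: "\<And>x. act p (\<lambda>_. 1) x \<le> 1" and r: "r < 1"
  shows "discounted p r n x \<le> 1"
proof (induction n arbitrary: x)
  case (Suc n)
  let ?a = "1 - r * p x x" and ?off = "\<lambda>x y. if y = x then 0 else p x y"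
  have rp: "r * p x x < 1"
    using mult_left_mono[OF substochastic_diagonal[of p x, OF sub], of r] r by simp
  have "r * act ?off (discounted p r n) x \<le> r * act ?off (\<lambda>_. 1) x"
    by (intro mult_left_mono act_mono Suc) simp
  moreover have "r * act ?off (\<lambda>_. 1) x + r * p x x \<le> 1"
  proof -
    have "r * act ?off (\<lambda>_. 1) x + r * p x x = r * act p (\<lambda>_. 1) x"
      by (subst (2) act_off_diagonal) (simp add: distrib_left add.commute)
    also have "\<dots> \<le> 1 * 1" using sub[of x] r by (intro mult_mono) (auto simp: less_imp_le)
    finally show ?thesis by simp
  qed
  ultimately have "r * act ?off (discounted p r n) x \<le> ?a"
    by (subst ennreal_le_minus_iff) (auto intro: order_trans add_right_mono)
  then show ?case
    using rp unfolding discounted_Suc by (auto intro!: divide_le_posI_ennreal simp: diff_gr0_ennreal)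
qed simp

text \<open>If \<open>N\<close> is the time of the \<open>n\<close>-th change, then \<open>r ^ N \<le> 1\<close> when \<open>N \<le> m\<close> and \<open>r ^ N \<le> r ^ m\<close> otherwise.
The induction on \<open>m\<close> conditions on the first step.\<close>

lemma discounted_le_many_changes:
  fixes r :: ennreal
  assumes sub: "\<And>x. act p (\<lambda>_. 1) x \<le> 1" and stoch: "\<And>x. x \<in> X \<Longrightarrow> act p (\<lambda>_. 1) x = 1"
    and stay: "\<And>x y. p x y \<noteq> 0 \<Longrightarrow> y \<in> X"
    and r: "r < 1" and x: "x \<in> X"
  shows "discounted p r n x \<le> many_changes p n m x + r ^ m"
proof -
  have rec: "discounted p r (Suc n) x = r * act p (\<lambda>y. discounted p r (if y = x then Suc n else n) y) x" for n x
  proof -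
    let ?V = "discounted p r" and ?off = "\<lambda>x y. if y = x then 0 else p x y" and ?a = "1 - r * p x x"
    have "r * p x x < 1"
      using mult_left_mono[OF substochastic_diagonal[of p x, OF sub], of r] r by simp
    then have a: "?a \<noteq> 0" "?a \<noteq> \<top>" "?a + r * p x x = 1"
      by (auto simp: diff_add_cancel_ennreal diff_eq_0_iff_ennreal less_imp_le)
    have Va: "?V (Suc n) x * ?a = r * act ?off (?V n) x"
      unfolding discounted_Suc
      using a mult_divide_eq_ennreal[of ?a] by (simp add: ennreal_divide_times ennreal_times_divide)
    have "?V (Suc n) x = ?V (Suc n) x * ?a + r * (p x x * ?V (Suc n) x)"
      using a(3) by (metis distrib_left mult.commute mult.left_commute mult.right_neutral)
    also have "\<dots> = r * (p x x * ?V (Suc n) x + act ?off (?V n) x)"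
      unfolding Va by (simp add: distrib_left add.commute)
    also have "p x x * ?V (Suc n) x + act ?off (?V n) x =
        act p (\<lambda>y. ?V (if y = x then Suc n else n) y) x"
      by (subst act_off_diagonal[of p]) (auto intro!: arg_cong2[where f=plus] nn_integral_cong simp: act_def)
    finally show ?thesis .
  qed
  show ?thesis
    using x
  proof (induction m arbitrary: n x)
    case 0
    then show ?case using discounted_le_1[of p r n x, OF sub r] by (simp add: add_increasing)
  next
    case (Suc m)
    have mc0: "many_changes p 0 m x = 1" if "x \<in> X" for m x
      using that
    proof (induction m arbitrary: x)
      case (Suc m)
      have "many_changes p 0 (Suc m) x = act p (\<lambda>_. 1) x"
        unfolding many_changes_Suc by (intro act_cong) (use Suc stay in auto)
      then show ?case using stoch[OF Suc.prems] by simp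
    qed (simp add: many_changes_0_0)
    show ?case
    proof (cases n)
      case 0
      then show ?thesis using mc0[OF Suc.prems, of "Suc m"] by simp
    next
      case (Suc n')
      let ?F = "\<lambda>y. many_changes p (if y = x then n else n - 1) m y"
      have "discounted p r n x = r * act p (\<lambda>y. discounted p r (if y = x then n else n - 1) y) x"
        using rec[of n' x] unfolding Suc by (simp only: diff_Suc_1)
      also have "\<dots> \<le> r * act p (\<lambda>y. ?F y + r ^ m) x"
        by (intro mult_left_mono act_mono Suc.IH) (auto intro: stay)
      also have "\<dots> = r * many_changes p n (Suc m) x + r ^ Suc m"
        using act_cmult[of p "r ^ m" "\<lambda>_. 1" x] stoch[OF Suc.prems]
        by (simp add: act_add distrib_left many_changes_Suc)
      also have "\<dots> \<le> many_changes p n (Suc m) x + r ^ Suc m"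
        using mult_right_mono[of r 1 "many_changes p n (Suc m) x"] r by (intro add_right_mono) (auto simp: less_imp_le)
      finally show ?thesis .
    qed
  qed
qed

text \<open>The Laplace transform at \<open>l\<close> of the \<open>n\<close>-th jump time of the minimal chain with rates \<open>R\<close>.\<close>

primrec exit_discounted :: "('a \<Rightarrow> 'a \<Rightarrow> ennreal) \<Rightarrow> ennreal \<Rightarrow> nat \<Rightarrow> 'a \<Rightarrow> ennreal" where
  "exit_discounted R l 0 x = 1"
| "exit_discounted R l (Suc n) x =
    act (\<lambda>x y. R x y / (l + act R (\<lambda>_. 1) x)) (exit_discounted R l n) x"

lemma subsolution_le_exit_discounted:
  assumes "\<And>x. \<zeta> x \<le> 1" "\<And>x. (l + act R (\<lambda>_. 1) x) * \<zeta> x \<le> act R \<zeta> x" 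
    and "l \<noteq> 0" "l < \<infinity>" "\<And>x. act R (\<lambda>_. 1) x < \<infinity>"
  shows "\<zeta> x \<le> exit_discounted R l n x"
proof (induction n arbitrary: x)
  case (Suc n)
  let ?b = "l + act R (\<lambda>_. 1) x"
  have b: "?b \<noteq> 0" "?b \<noteq> \<top>" using assms(3-4) assms(5)[of x] by auto
  have "\<zeta> x = ?b * \<zeta> x / ?b"
    using mult_divide_eq_ennreal[OF b, of "\<zeta> x"] by (simp add: mult.commute)
  also have "\<dots> \<le> act R (exit_discounted R l n) x / ?b"
    by (intro divide_right_mono_ennreal order_trans[OF assms(2)] act_mono Suc)
  also have "\<dots> = (\<integral>\<^sup>+ y. inverse ?b * (R x y * exit_discounted R l n y) \<partial>count_space UNIV)"
    by (subst nn_integral_cmult) (auto simp: act_def divide_ennreal_def mult_ac)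
  also have "\<dots> = exit_discounted R l (Suc n) x"
    unfolding exit_discounted.simps act_def[of "\<lambda>x y. R x y / _ x"]
    by (intro nn_integral_cong) (auto simp: divide_ennreal_def mult_ac)
  finally show ?case .
qed (use assms in simp)

lemma mult_liminf_le:
  fixes a c :: "nat \<Rightarrow> ennreal"
  assumes "a \<longlonglongrightarrow> A" "A < \<infinity>" and "\<And>k. c k \<le> 1"
  shows "A * liminf c \<le> liminf (\<lambda>k. a k * c k)"
proof -
  \<comment> \<open>Replacing the sequence by its increasing lower envelope makes it convergent.\<close>
  let ?d = "\<lambda>k. INF j\<in>{k..}. c j"
  have d: "?d k \<le> c k" for k by (rule INF_lower) simp
  have "incseq ?d" by (auto simp: incseq_def intro!: INF_superset_mono)
  then have "?d \<longlonglongrightarrow> liminf c" unfolding liminf_SUP_INF by (rule LIMSEQ_SUP)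
  moreover have "liminf c < \<infinity>"
  proof -
    have "liminf c \<le> liminf (\<lambda>_::nat. 1::ennreal)" by (intro Liminf_mono) (use assms in auto)
    also have "\<dots> = 1" by (rule Liminf_const) simp
    finally show ?thesis using le_less_trans by fastforce
  qed
  ultimately have "(\<lambda>k. a k * ?d k) \<longlonglongrightarrow> A * liminf c"
    using assms by (intro tendsto_mult_ennreal) auto
  then have "A * liminf c = liminf (\<lambda>k. a k * ?d k)"
    by (metis lim_imp_Liminf sequentially_bot)
  also have "\<dots> \<le> liminf (\<lambda>k. a k * c k)"
    by (intro Liminf_mono always_eventually allI mult_left_mono d) simp
  finally show ?thesis .
qed

text \<open>Convergence of the one-step kernels passes through the \<open>n\<close>-fold iteration as an inequality, by Fatou's
lemma in each step.\<close>

lemma exit_discounted_le_liminf: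
  fixes p :: "nat \<Rightarrow> 'a \<Rightarrow> 'a \<Rightarrow> ennreal"
  assumes conv: "\<And>x y. x \<noteq> y \<Longrightarrow>
      (\<lambda>k. r k * p k x y / (1 - r k * p k x x)) \<longlonglongrightarrow> R x y / (l + act R (\<lambda>_. 1) x)"
    and no_loop: "\<And>x. R x x = 0"
    and fin: "l \<noteq> 0" "\<And>x y. R x y < \<infinity>"
    and le1: "\<And>k n x. discounted (p k) (r k) n x \<le> 1"
  shows "exit_discounted R l n x \<le> liminf (\<lambda>k. discounted (p k) (r k) n x)"
proof (induction n arbitrary: x)
  case 0
  show ?case by (simp add: Liminf_const)
next
  case (Suc n)
  let ?b = "l + act R (\<lambda>_. 1) x"
  have fin': "R x y / ?b < \<infinity>" for y
    using fin(1) fin(2)[of x y] by (auto simp: ennreal_divide_eq_top_iff simp flip: less_top)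
  let ?K = "\<lambda>k y. if y = x then 0 else r k * p k x y / (1 - r k * p k x x)"
  have "exit_discounted R l (Suc n) x = (\<integral>\<^sup>+ y. R x y / ?b * exit_discounted R l n y \<partial>count_space UNIV)"
    by (simp add: act_def)
  also have "\<dots> \<le> (\<integral>\<^sup>+ y. liminf (\<lambda>k. ?K k y * discounted (p k) (r k) n y) \<partial>count_space UNIV)"
  proof (rule nn_integral_mono)
    fix y
    have "(\<lambda>k. ?K k y) \<longlonglongrightarrow> R x y / ?b"
      using conv[of x y] no_loop[of x] by (cases "y = x") auto
    then have "R x y / ?b * liminf (\<lambda>k. discounted (p k) (r k) n y) 
        \<le> liminf (\<lambda>k. ?K k y * discounted (p k) (r k) n y)"
      using fin' le1 by (intro mult_liminf_le) auto
    then show "R x y / ?b * exit_discounted R l n y \<le> liminf (\<lambda>k. ?K k y * discounted (p k) (r k) n y)"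
      by (rule order_trans[rotated]) (intro mult_left_mono Suc, simp)
  qed
  also have "\<dots> \<le> liminf (\<lambda>k. \<integral>\<^sup>+ y. ?K k y * discounted (p k) (r k) n y \<partial>count_space UNIV)"
    by (intro nn_integral_liminf) auto
  also have "\<dots> = liminf (\<lambda>k. discounted (p k) (r k) (Suc n) x)"
    by (simp add: act_def)
  finally show ?case .
qed

section \<open>From regular paths to regular rates\<close>

lemma nn_integral_extend_zero:
  "(\<integral>\<^sup>+ x. (if x \<in> A then g x else 0) \<partial>count_space UNIV) = (\<integral>\<^sup>+ x. g x \<partial>count_space A)"
proof -
  have "(\<integral>\<^sup>+ x. (if x \<in> A then g x else 0) \<partial>count_space UNIV) =
      (\<integral>\<^sup>+ x. (if x \<in> A then g x else 0) \<partial>count_space A)"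
    by (rule nn_integral_count_space_eq) auto
  also have "\<dots> = (\<integral>\<^sup>+ x. g x \<partial>count_space A)"
    by (intro nn_integral_cong) auto
  finally show ?thesis .
qed

lemma act_restrict:
  assumes "\<And>y. y \<notin> A \<Longrightarrow> K x y = 0"
  shows "act K u x = (\<integral>\<^sup>+ y. K x y * u y \<partial>count_space A)"
  unfolding act_def by (rule nn_integral_count_space_eq) (use assms in auto)

lemma nn_integral_has_sum:
  fixes g :: "'a \<Rightarrow> real"
  assumes "(g has_sum s) A" "\<And>x. x \<in> A \<Longrightarrow> 0 \<le> g x"
  shows "(\<integral>\<^sup>+ x. ennreal (g x) \<partial>count_space A) = ennreal s"
proof -
  have "g summable_on A" "infsum g A = s" using assms(1) by (auto simp: summable_on_def infsumI)
  moreover from this(1) have "Infinite_Set_Sum.abs_summable_on g A"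
    unfolding abs_summable_equivalent[symmetric] by (rule summable_on_iff_abs_summable_on_real[THEN iffD1])
  ultimately show ?thesis
    using assms(2) nn_integral_conv_infsetsum[of g A] infsetsum_infsum[of g A] by simp
qed

lemma has_sum_nn_integral:
  fixes g :: "'a \<Rightarrow> real"
  assumes "(\<integral>\<^sup>+ x. ennreal (g x) \<partial>count_space A) < \<infinity>" "\<And>x. x \<in> A \<Longrightarrow> 0 \<le> g x"
  shows "(g has_sum enn2real (\<integral>\<^sup>+ x. ennreal (g x) \<partial>count_space A)) A"
proof -
  have "integrable (count_space A) g"
    using assms by (intro integrableI_nonneg) (auto simp: AE_count_space)
  then have "Infinite_Set_Sum.abs_summable_on g A"
    by (simp add: Infinite_Set_Sum.abs_summable_on_def)
  then have "g summable_on A"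
    unfolding abs_summable_equivalent[symmetric] by (rule summable_on_iff_abs_summable_on_real[THEN iffD2])
  then have "(g has_sum infsum g A) A" by simp
  moreover from nn_integral_has_sum[OF this assms(2)] have
    "enn2real (\<integral>\<^sup>+ x. ennreal (g x) \<partial>count_space A) = infsum g A"
    using assms(2) by (simp add: infsum_nonneg)
  ultimately show ?thesis by simp
qed

lemma changes_map: 
  "changes (z 0) (map (\<lambda>i. z (real i * d)) [1..<Suc m]) = card {i. i < m \<and> z (real i * d) \<noteq> z (real (Suc i) * d)}"
proof (induction m)
  case (Suc m)
  let ?I = "\<lambda>m. {i. i < m \<and> z (real i * d) \<noteq> z (real (Suc i) * d)}"
  have l: "last (z 0 # map (\<lambda>i. z (real i * d)) [1..<Suc m]) = z (real m * d)"
    by (cases m) auto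
  have "?I (Suc m) = ?I m \<union> (if z (real (Suc m) * d) = z (real m * d) then {} else {m})"
    by (auto simp: less_Suc_eq)
  then have "card (?I (Suc m)) = card (?I m) + (if z (real (Suc m) * d) = z (real m * d) then 0 else 1)"
    by (auto simp: card_insert_if)
  moreover have "map (\<lambda>i. z (real i * d)) [1..<Suc (Suc m)] = map (\<lambda>i. z (real i * d)) [1..<Suc m] @ [z (real (Suc m) * d)]"
    by simp
  ultimately show ?case using Suc.IH l by (simp only: changes_snoc)
qed simp

text \<open>A function without discontinuities on \<open>[a, b]\<close> into a discrete space is constant.  Right-continuity is
needed at \<open>a\<close> itself: a jump at \<open>a\<close> must be attributed to the interval that ends there, so that
consecutive intervals can be assigned different jumps.\<close>

lemma jump_in_interval:
  fixes z :: "real \<Rightarrow> state"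
  assumes reg: "regular_jump_path z" and ab: "0 \<le> a" "a < b" "z a \<noteq> z b"
  shows "\<exists>t. a < t \<and> t \<le> b \<and> \<not> continuous (at t within {0..}) z"
proof (rule ccontr)
  assume no: "\<not> ?thesis"
  obtain e where e: "e > 0" "\<And>s. s \<in> {a..<a+e} \<Longrightarrow> z s = z a"
    using reg ab(1) unfolding regular_jump_path_def by blast
  have "eventually (\<lambda>s. z s = z t) (at t within {a..b})" if t: "t \<in> {a..b}" for t
  proof (cases "t = a")
    case True
    have "eventually (\<lambda>s. s \<in> {a..<a+e}) (at a within {a..b})"
      unfolding eventually_at using e(1) by (intro exI[of _ e]) (auto simp: dist_real_def)
    then show ?thesis unfolding True by eventually_elim (rule e(2))
  next
    case False
    then have "continuous (at t within {0..}) z" using no t by auto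
    then have "continuous (at t within {a..b}) z" 
      by (rule continuous_within_subset) (use ab t in auto)
    then have lim: "(z \<longlongrightarrow> z t) (at t within {a..b})" by (simp add: continuous_within)
    have "eventually (\<lambda>s. fst (z s) = fst (z t)) (at t within {a..b})"
      using tendsto_fst[OF lim] by (simp add: tendsto_discrete)
    moreover have "eventually (\<lambda>s. snd (z s) = snd (z t)) (at t within {a..b})"
      using tendsto_snd[OF lim] by (simp add: tendsto_discrete)
    ultimately show ?thesis by eventually_elim (simp add: prod_eq_iff)
  qed
  then have "\<And>t. t \<in> {a..b} \<Longrightarrow> eventually (\<lambda>s. (z s = z a) = (z t = z a)) (at t within {a..b})"
    by (metis (mono_tags, lifting) eventually_mono)
  then have "continuous_on {a..b} (\<lambda>t. z t = z a)"
    unfolding continuous_on_def by (auto simp: tendsto_discrete elim!: eventually_mono)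
  moreover have "connected {a..b}" by simp
  ultimately obtain c where "\<forall>s\<in>{a..b}. (z s = z a) = c"
    unfolding connected_iff_const by blast
  then have "(z a = z a) = (z b = z a)" using ab(2) by auto
  then show False using ab(3) by simp
qed

lemma changes_le_discontinuities:
  fixes z :: "real \<Rightarrow> state"
  assumes reg: "regular_jump_path z" and d: "d > 0" "real m * d \<le> c"
  shows "changes (z 0) (map (\<lambda>i. z (real i * d)) [1..<Suc m])
    \<le> card {t\<in>{0..c}. \<not> continuous (at t within {0..}) z}"
proof -
  let ?I = "{i. i < m \<and> z (real i * d) \<noteq> z (real (Suc i) * d)}"
  let ?D = "{t\<in>{0..c}. \<not> continuous (at t within {0..}) z}"
  have c: "0 \<le> c" using d by (meson mult_nonneg_nonneg of_nat_0_le_iff less_imp_le order_trans)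
  have ex: "\<exists>t. real i * d < t \<and> t \<le> real (Suc i) * d \<and> \<not> continuous (at t within {0..}) z"
    if "i \<in> ?I" for i
    using d that by (intro jump_in_interval[OF reg]) auto
  define t where "t i = (SOME t. real i * d < t \<and> t \<le> real (Suc i) * d \<and> \<not> continuous (at t within {0..}) z)" for i
  have t: "\<And>i. i \<in> ?I \<Longrightarrow> real i * d < t i" "\<And>i. i \<in> ?I \<Longrightarrow> t i \<le> real (Suc i) * d"
      "\<And>i. i \<in> ?I \<Longrightarrow> \<not> continuous (at (t i) within {0..}) z"
    using someI_ex[OF ex] unfolding t_def by blast+
  have lt: "t i < t j" if "i \<in> ?I" "j \<in> ?I" "i < j" for i j
  proof -
    have "t i \<le> real (Suc i) * d" using t that by blast
    also have "\<dots> \<le> real j * d" using that d by (intro mult_right_mono) auto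
    also have "\<dots> < t j" using t that by blast
    finally show ?thesis .
  qed
  have "inj_on t ?I"
  proof (rule inj_onI)
    fix i j assume "i \<in> ?I" "j \<in> ?I" "t i = t j"
    then show "i = j" using lt[of i j] lt[of j i] by (cases i j rule: linorder_cases) auto
  qed
  moreover have "t ` ?I \<subseteq> ?D"
  proof clarify
    fix i assume i: "i < m" "z (real i * d) \<noteq> z (real (Suc i) * d)"
    then have "real (Suc i) * d \<le> real m * d" using d by (intro mult_right_mono) auto
    then have "t i \<le> c" using t(2)[of i] i d(2) by (auto simp del: of_nat_Suc)
    moreover have "0 \<le> real i * d" using d(1) by simp
    then have "0 \<le> t i" using t(1)[of i] i by (simp del: of_nat_Suc)
    ultimately show "t i \<in> {0..c} \<and> \<not> continuous (at (t i) within {0..}) z" using t(3)[of i] i by auto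
  qed
  moreover have "finite ?D" using reg c unfolding regular_jump_path_def by blast
  ultimately have "card ?I \<le> card ?D" by (intro card_inj_on_le) auto
  then show ?thesis unfolding changes_map .
qed

locale ctmc =
  fixes S :: "nat \<Rightarrow> nat" and M :: "state \<Rightarrow> 'w measure" and Z :: "real \<Rightarrow> 'w \<Rightarrow> state" and Q :: qmatrix
  assumes chain: "regular_jump_chain S M Z"
    and gen: "generator S M Z Q"
    and cons: "conservative S Q"
begin

abbreviation X :: "state set" where "X \<equiv> states S"

abbreviation P :: "real \<Rightarrow> qmatrix" where "P \<equiv> trans_prob M Z"

text \<open>Transition probabilities, extended by zero outside the state space.\<close>

definition kern :: "real \<Rightarrow> state \<Rightarrow> state \<Rightarrow> ennreal" where
  "kern t x y = (if x \<in> X \<and> y \<in> X then ennreal (P t x y) else 0)"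

definition R :: "state \<Rightarrow> state \<Rightarrow> ennreal" where
  "R x y = (if x \<in> X \<and> y \<in> X \<and> x \<noteq> y then ennreal (Q x y) else 0)"

lemma mc: "markov_chain S M Z" using chain by (simp add: regular_jump_chain_def)

lemma prob: "x \<in> X \<Longrightarrow> prob_space (M x)" using mc by (simp add: markov_chain_def)

lemma Z_measurable: "x \<in> X \<Longrightarrow> 0 \<le> t \<Longrightarrow> Z t \<in> measurable (M x) (count_space X)"
  using mc by (simp add: markov_chain_def)

lemma Z_in: "x \<in> X \<Longrightarrow> 0 \<le> t \<Longrightarrow> \<omega> \<in> space (M x) \<Longrightarrow> Z t \<omega> \<in> X"
  using measurable_space[OF Z_measurable] by auto

lemma Z_pred: 
  assumes "x \<in> X" "0 \<le> t" shows "{\<omega> \<in> space (M x). A (Z t \<omega>)} \<in> sets (M x)"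
proof -
  have "Z t -` {y \<in> X. A y} \<inter> space (M x) \<in> sets (M x)"
    using Z_measurable[OF assms] by (rule measurable_sets) auto
  also have "Z t -` {y \<in> X. A y} \<inter> space (M x) = {\<omega> \<in> space (M x). A (Z t \<omega>)}"
    using Z_in[OF assms] by auto
  finally show ?thesis .
qed

lemma P_nonneg: "0 \<le> P t x y" by (simp add: trans_prob_def)

lemma P_le_1: "x \<in> X \<Longrightarrow> P t x y \<le> 1"
  unfolding trans_prob_def using prob_space.prob_le_1[OF prob] by blast

lemma P_emeasure: "x \<in> X \<Longrightarrow> ennreal (P t x y) = emeasure (M x) {\<omega> \<in> space (M x). Z t \<omega> = y}"
  unfolding trans_prob_def using prob[of x] 
  by (simp add: finite_measure.emeasure_eq_measure prob_space.finite_measure)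

lemma total_emeasure:
  assumes "x \<in> X" "0 \<le> s" "E \<in> sets (M x)"
  shows "emeasure (M x) E = (\<integral>\<^sup>+ y. emeasure (M x) {\<omega> \<in> E. Z s \<omega> = y} \<partial>count_space X)"
proof -
  have sub: "\<omega> \<in> space (M x)" if "\<omega> \<in> E" for \<omega> using sets.sets_into_space[OF assms(3)] that by auto
  have "E = (\<Union>y\<in>X. {\<omega> \<in> E. Z s \<omega> = y})" using Z_in[OF assms(1,2)] sub by auto
  moreover have "{\<omega> \<in> E. Z s \<omega> = y} \<in> sets (M x)" for y
  proof -
    have "{\<omega> \<in> E. Z s \<omega> = y} = E \<inter> {\<omega> \<in> space (M x). Z s \<omega> = y}" using sub by auto
    then show ?thesis using Z_pred[OF assms(1,2), of "\<lambda>z. z = y"] assms(3) by auto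
  qed
  moreover have "disjoint_family_on (\<lambda>y. {\<omega> \<in> E. Z s \<omega> = y}) X"
    by (auto simp: disjoint_family_on_def)
  ultimately show ?thesis
    using emeasure_UN_countable[of X "\<lambda>y. {\<omega> \<in> E. Z s \<omega> = y}" "M x"] by auto
qed

lemma kern_stochastic: "x \<in> X \<Longrightarrow> 0 \<le> t \<Longrightarrow> act (kern t) (\<lambda>_. 1) x = 1"
proof -
  assume x: "x \<in> X" and t: "0 \<le> t"
  have "act (kern t) (\<lambda>_. 1) x = (\<integral>\<^sup>+ y. (if y \<in> X then emeasure (M x) {\<omega> \<in> space (M x). Z t \<omega> = y} else 0) \<partial>count_space UNIV)"
    unfolding act_def kern_def using x by (intro nn_integral_cong) (auto simp: P_emeasure)
  also have "\<dots> = emeasure (M x) (space (M x))"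
    unfolding nn_integral_extend_zero by (rule total_emeasure[symmetric]) (use x t in auto)
  also have "\<dots> = 1" using prob_space.emeasure_space_1[OF prob[OF x]] .
  finally show ?thesis .
qed

lemma kern_substochastic: "0 \<le> t \<Longrightarrow> act (kern t) (\<lambda>_. 1) x \<le> 1"
  using kern_stochastic[of x t] by (cases "x \<in> X") (auto simp: act_def kern_def)

lemma markov:
  assumes "x \<in> X" "y \<in> X" "z \<in> X" "0 \<le> s" "0 \<le> t" "finite T" "T \<subseteq> {0..s}"
  shows "emeasure (M x) {\<omega> \<in> space (M x). (\<forall>u\<in>T. Z u \<omega> = \<xi> u) \<and> Z s \<omega> = y \<and> Z (s + t) \<omega> = z} =
    emeasure (M x) {\<omega> \<in> space (M x). (\<forall>u\<in>T. Z u \<omega> = \<xi> u) \<and> Z s \<omega> = y} * ennreal (P t y z)"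
proof -
  interpret prob_space "M x" using prob assms(1) .
  have "measure (M x) {\<omega> \<in> space (M x). (\<forall>u\<in>T. Z u \<omega> = \<xi> u) \<and> Z s \<omega> = y \<and> Z (s + t) \<omega> = z} =
    measure (M x) {\<omega> \<in> space (M x). (\<forall>u\<in>T. Z u \<omega> = \<xi> u) \<and> Z s \<omega> = y} * P t y z"
    using mc assms unfolding markov_chain_def by blast
  then show ?thesis by (simp add: emeasure_eq_measure ennreal_mult P_nonneg)
qed

lemma chapman_kolmogorov:
  assumes "x \<in> X" "z \<in> X" "0 \<le> s" "0 \<le> t"
  shows "ennreal (P (s + t) x z) = act (kern s) (\<lambda>y. ennreal (P t y z)) x"
proof -
  have "ennreal (P (s + t) x z) = (\<integral>\<^sup>+ y. emeasure (M x) {\<omega> \<in> {\<omega> \<in> space (M x). Z (s + t) \<omega> = z}. Z s \<omega> = y} \<partial>count_space X)"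
    unfolding P_emeasure[OF assms(1)] by (rule total_emeasure) (use assms Z_pred[of x "s + t" "\<lambda>y. y = z"] in auto)
  also have "\<dots> = (\<integral>\<^sup>+ y. ennreal (P s x y) * ennreal (P t y z) \<partial>count_space X)"
  proof (intro nn_integral_cong)
    fix y assume "y \<in> space (count_space X)"
    then have y: "y \<in> X" by simp
    have "{\<omega> \<in> {\<omega> \<in> space (M x). Z (s + t) \<omega> = z}. Z s \<omega> = y} = {\<omega> \<in> space (M x). Z s \<omega> = y \<and> Z (s + t) \<omega> = z}" by auto
    then show "emeasure (M x) {\<omega> \<in> {\<omega> \<in> space (M x). Z (s + t) \<omega> = z}. Z s \<omega> = y} = ennreal (P s x y) * ennreal (P t y z)"
      using markov[of x y z s t "{}"] assms y by (simp add: P_emeasure)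
  qed
  also have "\<dots> = (\<integral>\<^sup>+ y. kern s x y * ennreal (P t y z) \<partial>count_space X)"
    by (intro nn_integral_cong) (use assms in \<open>auto simp: kern_def\<close>)
  also have "\<dots> = act (kern s) (\<lambda>y. ennreal (P t y z)) x"
    by (rule act_restrict[symmetric]) (auto simp: kern_def)
  finally show ?thesis .
qed

lemma diff_quot: "x \<in> X \<Longrightarrow> y \<in> X \<Longrightarrow>
  ((\<lambda>h. (P h x y - (if x = y then 1 else 0)) / h) \<longlongrightarrow> Q x y) (at_right 0)"
  using gen by (simp add: generator_def)

text \<open>Standardness of the transition function is implied by the existence of the derivative at zero.\<close>

lemma P_0: assumes "x \<in> X" "y \<in> X"
  shows "((\<lambda>h. P h x y) \<longlongrightarrow> (if x = y then 1 else 0)) (at_right 0)"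
proof -
  let ?d = "if x = y then 1 else 0 :: real"
  have "((\<lambda>h. h * ((P h x y - ?d) / h) + ?d) \<longlongrightarrow> 0 * Q x y + ?d) (at_right 0)"
    by (intro tendsto_intros diff_quot assms)
  moreover have "eventually (\<lambda>h. h * ((P h x y - ?d) / h) + ?d = P h x y) (at_right 0)"
    using eventually_at_right_less[of 0] by eventually_elim simp
  ultimately show ?thesis by (simp add: tendsto_cong)
qed

lemma Q_nonneg: assumes "x \<in> X" "y \<in> X" "x \<noteq> y" shows "0 \<le> Q x y"
proof (rule tendsto_lowerbound[OF diff_quot[OF assms(1,2)]])
  show "eventually (\<lambda>h. 0 \<le> (P h x y - (if x = y then 1 else 0)) / h) (at_right 0)"
    using eventually_at_right_less[of 0] by eventually_elim (use assms P_nonneg in auto)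
qed simp

lemma Q_off_sum: assumes "x \<in> X" shows "(Q x has_sum (- Q x x)) (X - {x})"
proof -
  have "(Q x has_sum 0) X" "(Q x has_sum Q x x) {x}" using cons assms by (auto simp: conservative_def intro: has_sum_finiteI)
  then have "(Q x has_sum (0 - Q x x)) (X - {x})"
    using assms by (intro has_sum_Diff) auto
  then show ?thesis by simp
qed

lemma rate_nonneg: "x \<in> X \<Longrightarrow> 0 \<le> - Q x x"
  using has_sum_nonneg[OF Q_off_sum[of x]] Q_nonneg[of x] by auto

lemma act_R: 
  assumes "x \<in> X"
  shows "act R u x = (\<integral>\<^sup>+ y. ennreal (Q x y) * u y \<partial>count_space (X - {x}))"
proof -
  have "act R u x = (\<integral>\<^sup>+ y. R x y * u y \<partial>count_space (X - {x}))"
    by (rule act_restrict) (auto simp: R_def)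
  also have "\<dots> = (\<integral>\<^sup>+ y. ennreal (Q x y) * u y \<partial>count_space (X - {x}))"
    by (intro nn_integral_cong) (use assms in \<open>auto simp: R_def\<close>)
  finally show ?thesis .
qed

lemma rate: "x \<in> X \<Longrightarrow> act R (\<lambda>_. 1) x = ennreal (- Q x x)"
  using nn_integral_has_sum[OF Q_off_sum[of x]] Q_nonneg[of x] by (auto simp: act_R)

lemma R_outside: "x \<notin> X \<or> y \<notin> X \<Longrightarrow> R x y = 0" by (auto simp: R_def)

lemma R_no_loop: "R x x = 0" by (simp add: R_def)

lemma rate_finite: "act R (\<lambda>_. 1) x < \<infinity>"
  using rate[of x] by (cases "x \<in> X") (auto simp: act_def R_def)

text \<open>The finite-dimensional distributions along a skeleton, by one application of the Markov property for each step.\<close>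

lemma skeleton_paths:
  assumes x: "x \<in> X" and d: "d > 0"
  shows "emeasure (M x) {\<omega> \<in> space (M x). \<forall>i\<le>length l. Z (real i * d) \<omega> = (x # l) ! i} = path_weight (kern d) x l"
proof (induction l rule: rev_induct)
  case Nil
  interpret prob_space "M x" using prob[OF x] .
  have "AE \<omega> in M x. Z 0 \<omega> = x" using mc x by (simp add: markov_chain_def)
  then show ?case using Z_pred[OF x, of 0 "\<lambda>z. z = x"] by (simp add: emeasure_eq_1_AE)
next
  case (snoc y l)
  let ?E = "\<lambda>l. {\<omega> \<in> space (M x). \<forall>i\<le>length l. Z (real i * d) \<omega> = (x # l) ! i}"
  define T where "T = (\<lambda>i. real i * d) ` {..<length l}"
  define s where "s = real (length l) * d"
  define \<xi> where "\<xi> u = (x # l) ! nat \<lfloor>u / d\<rfloor>" for u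
  let ?z = "last (x # l)"
  have z: "(x # l) ! length l = ?z" by (simp add: last_conv_nth)
  have E: "?E l = {\<omega> \<in> space (M x). (\<forall>u\<in>T. Z u \<omega> = \<xi> u) \<and> Z s \<omega> = ?z}"
    unfolding T_def s_def \<xi>_def using d z by (auto simp: le_less)
  have Ey: "?E (l @ [y]) = {\<omega> \<in> space (M x). (\<forall>u\<in>T. Z u \<omega> = \<xi> u) \<and> Z s \<omega> = ?z \<and> Z (s + d) \<omega> = y}"
  proof -
    have "(\<forall>i\<le>length (l @ [y]). Z (real i * d) \<omega> = (x # l @ [y]) ! i) \<longleftrightarrow>
      (\<forall>i\<le>length l. Z (real i * d) \<omega> = (x # l) ! i) \<and> Z (s + d) \<omega> = y" for \<omega>
      by (auto simp: le_Suc_eq s_def algebra_simps nth_append nth_Cons split: nat.split)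
    then have "?E (l @ [y]) = {\<omega> \<in> ?E l. Z (s + d) \<omega> = y}" by auto
    then show ?thesis unfolding E by auto
  qed
  show ?case
  proof (cases "?z \<in> X \<and> y \<in> X")
    case True
    have "emeasure (M x) (?E (l @ [y])) = emeasure (M x) (?E l) * ennreal (P d ?z y)"
      unfolding E Ey using True x d
      by (intro markov) (auto simp: T_def s_def intro!: mult_right_mono)
    then show ?thesis using snoc.IH True by (simp add: path_weight_snoc kern_def)
  next
    case False
    have "?E (l @ [y]) = {}"
    proof -
      have s: "0 \<le> s" "0 \<le> s + d" using d by (auto simp: s_def)
      show ?thesis
      proof (rule ccontr)
        assume "?E (l @ [y]) \<noteq> {}"
        then obtain \<omega> where "\<omega> \<in> space (M x)" "Z s \<omega> = ?z" "Z (s + d) \<omega> = y" unfolding Ey by blast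
        then show False using False Z_in[OF x s(1)] Z_in[OF x s(2)] by metis
      qed
    qed
    then have "emeasure (M x) (?E (l @ [y])) = 0" by (simp only: emeasure_empty)
    moreover have "path_weight (kern d) x (l @ [y]) = 0"
      using False by (auto simp: path_weight_snoc kern_def)
    ultimately show ?thesis by (simp only:)
  qed
qed

text \<open>The initial state is part of the event, as it is \<open>x\<close> only almost surely.\<close>

definition skeleton_changes :: "state \<Rightarrow> nat \<Rightarrow> nat \<Rightarrow> real \<Rightarrow> 'w set" where
  "skeleton_changes x n m d = {\<omega> \<in> space (M x). Z 0 \<omega> = x \<and>
     n \<le> changes (Z 0 \<omega>) (map (\<lambda>i. Z (real i * d) \<omega>) [1..<Suc m])}"

lemma skeleton_changes:
  assumes x: "x \<in> X" and d: "d > 0"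
  shows "skeleton_changes x n m d \<in> sets (M x)"
    and "emeasure (M x) (skeleton_changes x n m d) = many_changes (kern d) n m x"
proof -
  let ?E = "\<lambda>l. {\<omega> \<in> space (M x). \<forall>i\<le>length l. Z (real i * d) \<omega> = (x # l) ! i}"
  let ?L = "{l. length l = m \<and> n \<le> changes x l}"
  have Ei: "\<omega> \<in> ?E l \<longleftrightarrow> \<omega> \<in> space (M x) \<and> Z 0 \<omega> = x \<and> l = map (\<lambda>i. Z (real i * d) \<omega>) [1..<Suc m]"
    if "length l = m" for \<omega> l
  proof -
    have "(\<forall>i\<le>length l. Z (real i * d) \<omega> = (x # l) ! i) \<longleftrightarrow>
        Z 0 \<omega> = x \<and> (\<forall>i<length l. Z (real (Suc i) * d) \<omega> = l ! i)"
      by (auto simp: nth_Cons split: nat.splits simp del: of_nat_Suc)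
    moreover have "l = map (\<lambda>i. Z (real i * d) \<omega>) [1..<Suc m] \<longleftrightarrow> (\<forall>i<length l. Z (real (Suc i) * d) \<omega> = l ! i)"
      using that by (auto simp: list_eq_iff_nth_eq simp del: upt_Suc of_nat_Suc)
    ultimately show ?thesis by auto
  qed
  have eq: "skeleton_changes x n m d = (\<Union>l\<in>?L. ?E l)"
  proof (intro set_eqI iffI)
    fix \<omega> assume "\<omega> \<in> skeleton_changes x n m d"
    then show "\<omega> \<in> (\<Union>l\<in>?L. ?E l)"
      unfolding skeleton_changes_def 
      by (intro UN_I[of "map (\<lambda>i. Z (real i * d) \<omega>) [1..<Suc m]"], simp, subst Ei) auto
  next
    fix \<omega> assume "\<omega> \<in> (\<Union>l\<in>?L. ?E l)"
    then obtain l where "l \<in> ?L" "\<omega> \<in> ?E l" by blast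
    then show "\<omega> \<in> skeleton_changes x n m d"
      using Ei[of l \<omega>] unfolding skeleton_changes_def by auto
  qed
  have meas: "?E l \<in> sets (M x)" for l
  proof -
    have "?E l = (\<Inter>i\<in>{..length l}. {\<omega> \<in> space (M x). Z (real i * d) \<omega> = (x # l) ! i})"
      by auto
    also have "\<dots> \<in> sets (M x)"
      using x d by (intro sets.finite_INT) (auto intro!: Z_pred[where A="\<lambda>z. z = _"])
    finally show ?thesis .
  qed
  show "skeleton_changes x n m d \<in> sets (M x)"
    unfolding eq by (rule sets.countable_UN''[OF _ meas]) simp
  have disj: "disjoint_family_on ?E ?L"
    unfolding disjoint_family_on_def
  proof (intro ballI impI equals0I)
    fix k l \<omega> assume kl: "k \<in> ?L" "l \<in> ?L" "k \<noteq> l" and \<omega>: "\<omega> \<in> ?E k \<inter> ?E l"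
    have "k = map (\<lambda>i. Z (real i * d) \<omega>) [1..<Suc m]" using Ei[of k \<omega>] kl(1) \<omega> by blast
    moreover have "l = map (\<lambda>i. Z (real i * d) \<omega>) [1..<Suc m]" using Ei[of l \<omega>] kl(2) \<omega> by blast
    ultimately show False using kl(3) by simp
  qed
  have "emeasure (M x) (skeleton_changes x n m d) = (\<integral>\<^sup>+ l. emeasure (M x) (?E l) \<partial>count_space ?L)"
    unfolding eq by (rule emeasure_UN_countable[OF meas _ disj]) simp
  also have "\<dots> = (\<integral>\<^sup>+ l. (if l \<in> ?L then path_weight (kern d) x l else 0) \<partial>count_space UNIV)"
    by (simp only: nn_integral_extend_zero skeleton_paths[OF x d])
  also have "\<dots> = many_changes (kern d) n m x" unfolding many_changes_def by simp
  finally show "emeasure (M x) (skeleton_changes x n m d) = many_changes (kern d) n m x" .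
qed

lemma exit_rate_limit:
  assumes "x \<in> X" "\<gamma> > 0"
  shows "((\<lambda>h. (1 - exp (- \<gamma> * h) * P h x x) / h) \<longlongrightarrow> \<gamma> - Q x x) (at_right 0)"
proof -
  have "((\<lambda>h. exp (- \<gamma> * h)) has_real_derivative (- \<gamma>)) (at 0)"
    by (auto intro!: derivative_eq_intros)
  then have "((\<lambda>h. (exp (- \<gamma> * h) - 1) / h) \<longlongrightarrow> - \<gamma>) (at 0)"
    by (simp add: DERIV_def)
  then have e: "((\<lambda>h. (exp (- \<gamma> * h) - 1) / h) \<longlongrightarrow> - \<gamma>) (at_right 0)"
    by (rule filterlim_mono) (auto simp: at_le)
  have e1: "((\<lambda>h. exp (- \<gamma> * h)) \<longlongrightarrow> exp (- \<gamma> * 0)) (at_right 0)"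
    by (intro tendsto_intros)
  have "((\<lambda>h. - ((exp (- \<gamma> * h) - 1) / h) - exp (- \<gamma> * h) * ((P h x x - 1) / h)) \<longlongrightarrow> - (- \<gamma>) - exp (- \<gamma> * 0) * Q x x) (at_right 0)"
    using diff_quot[OF assms(1,1)] by (intro tendsto_intros e e1) auto
  moreover have "eventually (\<lambda>h. - ((exp (- \<gamma> * h) - 1) / h) - exp (- \<gamma> * h) * ((P h x x - 1) / h)
      = (1 - exp (- \<gamma> * h) * P h x x) / h) (at_right 0)"
    using eventually_at_right_less[of 0] by eventually_elim (simp add: field_simps)
  ultimately show ?thesis by (simp add: tendsto_cong)
qed

text \<open>The kernel of one change of state of the skeleton, discounted, converges to that of one jump.\<close>

lemma jump_kernel_limit:
  assumes xy: "x \<noteq> y" and g: "\<gamma> > 0"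
  shows "((\<lambda>h. ennreal (exp (- \<gamma> * h)) * kern h x y / (1 - ennreal (exp (- \<gamma> * h)) * kern h x x))
      \<longlongrightarrow> R x y / (ennreal \<gamma> + act R (\<lambda>_. 1) x)) (at_right 0)"
proof (cases "x \<in> X \<and> y \<in> X")
  case False
  then show ?thesis by (auto simp: kern_def R_def)
next
  case True
  then have x: "x \<in> X" and y: "y \<in> X" by auto
  have e1: "((\<lambda>h. exp (- \<gamma> * h)) \<longlongrightarrow> exp (- \<gamma> * 0)) (at_right 0)"
    by (intro tendsto_intros)
  have pos: "\<gamma> - Q x x > 0" using rate_nonneg[OF x] g by simp
  have "((\<lambda>h. exp (- \<gamma> * h) * (P h x y / h) / ((1 - exp (- \<gamma> * h) * P h x x) / h))
      \<longlongrightarrow> exp (- \<gamma> * 0) * Q x y / (\<gamma> - Q x x)) (at_right 0)"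
    using diff_quot[OF x y] xy pos by (intro tendsto_intros e1 exit_rate_limit x g) auto
  then have "((\<lambda>h. ennreal (exp (- \<gamma> * h) * (P h x y / h) / ((1 - exp (- \<gamma> * h) * P h x x) / h)))
      \<longlongrightarrow> ennreal (Q x y / (\<gamma> - Q x x))) (at_right 0)"
    by (intro tendsto_ennrealI) simp
  moreover have "ennreal (Q x y / (\<gamma> - Q x x)) = R x y / (ennreal \<gamma> + act R (\<lambda>_. 1) x)"
    using x y xy Q_nonneg[OF x y xy] pos g rate_nonneg[OF x]
    by (simp add: R_def rate divide_ennreal[symmetric] ennreal_plus[symmetric] del: ennreal_plus)
  moreover have "eventually (\<lambda>h. ennreal (exp (- \<gamma> * h) * (P h x y / h) / ((1 - exp (- \<gamma> * h) * P h x x) / h))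
     = ennreal (exp (- \<gamma> * h)) * kern h x y / (1 - ennreal (exp (- \<gamma> * h)) * kern h x x)) (at_right 0)"
    using eventually_at_right_less[of 0]
  proof eventually_elim
    case (elim h)
    let ?e = "exp (- \<gamma> * h)"
    have "?e < 1" using elim g by simp
    then have "?e * P h x x < 1" using P_le_1[OF x, of h x] P_nonneg[of h x x]
      by (metis exp_ge_zero le_less_trans mult.right_neutral mult_left_mono)
    then have "1 - ennreal ?e * kern h x x = ennreal (1 - ?e * P h x x)" 
      using x P_nonneg by (simp add: kern_def ennreal_mult''[symmetric] ennreal_1[symmetric] ennreal_minus del: ennreal_1)
    moreover have "ennreal ?e * kern h x y = ennreal (?e * P h x y)"
      using x y P_nonneg by (simp add: kern_def ennreal_mult''[symmetric])
    moreover have "?e * (P h x y / h) / ((1 - ?e * P h x x) / h) = ?e * P h x y / (1 - ?e * P h x x)"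
      using elim by simp
    ultimately show ?case using \<open>?e * P h x x < 1\<close> P_nonneg[of h x y] by (simp add: divide_ennreal)
  qed
  ultimately show ?thesis by (simp add: tendsto_cong)
qed

text \<open>The skeletons with \<open>k + 1\<close> steps of length \<open>t / (k + 1)\<close> all end at the same time \<open>t\<close>, so the discount
\<open>exp (- \<gamma> t)\<close> does not depend on \<open>k\<close>.\<close>

lemma exit_discounted_bound:
  assumes x: "x \<in> X" and g: "\<gamma> > 0" and t: "t > 0"
  shows "exit_discounted R (ennreal \<gamma>) n x \<le>
    emeasure (M x) (\<Union>k. skeleton_changes x n (Suc k) (t / Suc k)) + ennreal (exp (- \<gamma> * t))"
proof -
  let ?d = "\<lambda>k. t / Suc k"
  let ?r = "\<lambda>k. ennreal (exp (- \<gamma> * ?d k))"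
  have d: "?d k > 0" for k using t by simp
  have "(\<lambda>k. t / real (Suc k)) \<longlonglongrightarrow> 0"
    by (rule LIMSEQ_Suc[OF tendsto_divide_0[OF tendsto_const]]) (simp add: filterlim_real_sequentially filterlim_at_top_imp_at_infinity)
  then have lim: "filterlim ?d (at_right 0) sequentially"
    using t by (intro tendsto_imp_filterlim_at_right) auto
  have r1: "?r k < 1" for k using d[of k] g t by (simp add: ennreal_less_one_iff)
  have "exit_discounted R (ennreal \<gamma>) n x \<le> liminf (\<lambda>k. discounted (kern (?d k)) (?r k) n x)"
  proof (rule exit_discounted_le_liminf)
    show "(\<lambda>k. ?r k * kern (?d k) x y / (1 - ?r k * kern (?d k) x x)) \<longlonglongrightarrow> R x y / (ennreal \<gamma> + act R (\<lambda>_. 1) x)"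
      if "x \<noteq> y" for x y
      using filterlim_compose[OF jump_kernel_limit[OF that g] lim] .
    show "discounted (kern (?d k)) (?r k) n x \<le> 1" for k n x
      using d[of k] r1[of k] by (intro discounted_le_1 kern_substochastic) auto
  qed (use g R_no_loop in \<open>auto simp: R_def\<close>)
  also have "\<dots> \<le> liminf (\<lambda>k::nat. emeasure (M x) (\<Union>k. skeleton_changes x n (Suc k) (t / Suc k)) + ennreal (exp (- \<gamma> * t)))"
  proof (intro Liminf_mono always_eventually allI)
    fix k
    have "discounted (kern (?d k)) (?r k) n x \<le> many_changes (kern (?d k)) n (Suc k) x + ?r k ^ Suc k"
      using d[of k] r1[of k] x
      by (intro discounted_le_many_changes[where X=X] kern_substochastic kern_stochastic)
         (auto simp: kern_def split: if_splits)
    also have "?r k ^ Suc k = ennreal (exp (- \<gamma> * t))"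
      by (simp add: ennreal_power exp_of_nat_mult[symmetric] del: power_Suc of_nat_Suc)
    also have "many_changes (kern (?d k)) n (Suc k) x = emeasure (M x) (skeleton_changes x n (Suc k) (?d k))"
      using skeleton_changes(2)[OF x d] by simp
    also have "\<dots> \<le> emeasure (M x) (\<Union>k. skeleton_changes x n (Suc k) (t / Suc k))"
      by (intro emeasure_mono sets.countable_UN'' skeleton_changes(1) x d) auto
    finally show "discounted (kern (?d k)) (?r k) n x \<le> 
      emeasure (M x) (\<Union>k. skeleton_changes x n (Suc k) (t / Suc k)) + ennreal (exp (- \<gamma> * t))"
      by (simp add: add_right_mono)
  qed
  finally show ?thesis by (simp add: Liminf_const)
qed

text \<open>All skeletons on \<open>[0, t]\<close> change at most as often as the path has discontinuities there, and that number
is almost surely finite.\<close>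

lemma skeleton_changes_tendsto_0:
  assumes x: "x \<in> X" and t: "t > 0"
  shows "(\<lambda>n. emeasure (M x) (\<Union>k. skeleton_changes x n (Suc k) (t / Suc k))) \<longlonglongrightarrow> 0"
proof -
  interpret prob_space "M x" using prob[OF x] .
  let ?B = "\<lambda>n. \<Union>k. skeleton_changes x n (Suc k) (t / Suc k)"
  have meas: "?B n \<in> sets (M x)" for n
    using t by (intro sets.countable_UN'' skeleton_changes(1) x) auto
  have "decseq ?B" unfolding decseq_def skeleton_changes_def
    by (auto simp del: upt_Suc intro: order_trans)
  then have "(\<lambda>n. emeasure (M x) (?B n)) \<longlonglongrightarrow> emeasure (M x) (\<Inter>n. ?B n)"
    using meas by (intro Lim_emeasure_decseq) auto
  moreover have "emeasure (M x) (\<Inter>n. ?B n) = 0"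
  proof -
    have "AE \<omega> in M x. regular_jump_path (\<lambda>t. Z t \<omega>)"
      using chain x by (simp add: regular_jump_chain_def)
    then have "AE \<omega> in M x. \<omega> \<notin> (\<Inter>n. ?B n)"
    proof eventually_elim
      case (elim \<omega>)
      let ?D = "{s\<in>{0..t}. \<not> continuous (at s within {0..}) (\<lambda>t. Z t \<omega>)}"
      have le0: "changes (Z 0 \<omega>) (map (\<lambda>i. Z (real i * (t / Suc k)) \<omega>) [1..<Suc (Suc k)]) \<le> card ?D" for k
        using t by (intro changes_le_discontinuities[OF elim]) auto
      have le: "\<not> Suc (card ?D) \<le> changes (Z 0 \<omega>) (map (\<lambda>i. Z (real i * (t / Suc k)) \<omega>) [1..<Suc (Suc k)])" for k
        using le0[of k] by linarith
      have "\<omega> \<notin> ?B (Suc (card ?D))"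
      proof
        assume "\<omega> \<in> ?B (Suc (card ?D))"
        then obtain k where "\<omega> \<in> skeleton_changes x (Suc (card ?D)) (Suc k) (t / Suc k)" by blast
        then show False unfolding skeleton_changes_def using le[of k] by blast
      qed
      then show ?case by blast
    qed
    then show ?thesis
    proof (rule AE_iff_measurable[THEN iffD1, rotated 2])
      show "(\<Inter>n. ?B n) \<in> sets (M x)" by (intro sets.countable_INT image_subsetI meas) simp
      show "{\<omega> \<in> space (M x). \<not> \<omega> \<notin> (\<Inter>n. ?B n)} = (\<Inter>n. ?B n)"
        unfolding skeleton_changes_def by blast
    qed
  qed
  ultimately show ?thesis by simp
qed

text \<open>Letting first the number of jumps and then the time horizon tend to infinity, a subsolution is squeezed to zero.\<close>

lemma regular_rates_R: "regular_rates R"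
  unfolding regular_rates_def
proof (intro allI impI)
  fix \<gamma> :: real and \<zeta> x
  assume g: "\<gamma> > 0" and \<zeta>: "\<forall>x. \<zeta> x \<le> 1 \<and> (ennreal \<gamma> + act R (\<lambda>_. 1) x) * \<zeta> x \<le> act R \<zeta> x"
  show "\<zeta> x = 0"
  proof (cases "x \<in> X")
    case False
    then have "act R \<zeta> x = 0" by (simp add: act_def R_def)
    then have "(ennreal \<gamma> + act R (\<lambda>_. 1) x) * \<zeta> x = 0" using \<zeta> by (metis le_zero_eq)
    then show ?thesis using g by auto
  next
    case x: True
    have le: "\<zeta> x \<le> exit_discounted R (ennreal \<gamma>) n x" for n
      using \<zeta> g rate_finite by (intro subsolution_le_exit_discounted) auto
    have "\<zeta> x \<le> ennreal (exp (- \<gamma> * t))" if t: "t > 0" for t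
    proof (rule LIMSEQ_le_const)
      show "(\<lambda>n. emeasure (M x) (\<Union>k. skeleton_changes x n (Suc k) (t / Suc k)) + ennreal (exp (- \<gamma> * t)))
         \<longlonglongrightarrow> ennreal (exp (- \<gamma> * t))"
        using tendsto_add[OF skeleton_changes_tendsto_0[OF x t] tendsto_const[of "ennreal (exp (- \<gamma> * t))"]] by simp
      show "\<exists>N. \<forall>n\<ge>N. \<zeta> x \<le> emeasure (M x) (\<Union>k. skeleton_changes x n (Suc k) (t / Suc k)) + ennreal (exp (- \<gamma> * t))"
        using order_trans[OF le exit_discounted_bound[OF x g t]] by blast
    qed
    note le_exp = this
    have lim: "((\<lambda>t. ennreal (exp (- \<gamma> * t))) \<longlongrightarrow> ennreal 0) at_top"
    proof (intro tendsto_ennrealI)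
      have "filterlim (\<lambda>t. - \<gamma> * t) at_bot at_top"
        using g by (intro filterlim_tendsto_neg_mult_at_bot[OF tendsto_const _ filterlim_ident]) auto
      then show "((\<lambda>t. exp (- \<gamma> * t)) \<longlongrightarrow> 0) at_top" by (rule filterlim_compose[OF exp_at_bot])
    qed
    have "\<zeta> x \<le> ennreal 0"
      by (rule tendsto_lowerbound[OF lim eventually_mono[OF eventually_gt_at_top[of 0] le_exp]]) auto
    then show ?thesis by simp
  qed
qed

section \<open>The resolvent and the generator\<close>

text \<open>Condition on the state at time \<open>h\<close>: unless it is still \<open>x\<close>, which has probability \<open>P h x x\<close>, the error is at most one.\<close>

lemma P_increment:
  assumes x: "x \<in> X" and y: "y \<in> X" and "0 \<le> h" "0 \<le> t"
  shows "\<bar>P (h + t) x y - P t x y\<bar> \<le> 1 - P h x x"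
proof -
  let ?off = "\<lambda>x y. if y = x then 0 else kern h x y"
  have "act ?off (\<lambda>_. 1) x \<le> 1"
    by (rule order_trans[OF _ kern_substochastic[OF assms(3), of x]]) (auto simp: act_def intro!: nn_integral_mono)
  then have fin: "act ?off (\<lambda>_. 1) x \<noteq> \<top>" using ennreal_one_less_top by (metis leD top.not_eq_extremum)
  have 1: "1 = ennreal (P h x x) + act ?off (\<lambda>_. 1) x"
    using kern_stochastic[OF x assms(3)] act_off_diagonal[of "kern h" "\<lambda>_. 1" x] x by (simp add: kern_def)
  have o: "act ?off (\<lambda>_. 1) x = ennreal (1 - P h x x)"
    using 1 fin P_nonneg[of h x x] P_le_1[OF x, of h x]
    by (cases "act ?off (\<lambda>_. 1) x") (auto simp: ennreal_plus[symmetric] ennreal_1[symmetric] simp del: ennreal_plus ennreal_1)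
  let ?u = "act ?off (\<lambda>z. ennreal (P t z y)) x"
  have "?u \<le> act ?off (\<lambda>_. 1) x"
    by (intro act_mono) (auto simp: kern_def P_le_1 split: if_splits)
  then obtain c where c: "?u = ennreal c" "0 \<le> c" "c \<le> 1 - P h x x"
    using P_le_1[OF x, of h x] unfolding o by (cases ?u) (auto simp: top_unique)
  have "ennreal (P (h + t) x y) = ennreal (P h x x) * ennreal (P t x y) + ennreal c"
    using chapman_kolmogorov[OF x y assms(3,4)] act_off_diagonal[of "kern h" "\<lambda>z. ennreal (P t z y)" x] c x
    by (simp add: kern_def)
  then have "P (h + t) x y = P h x x * P t x y + c"
    using c P_nonneg by (simp add: ennreal_mult''[symmetric] ennreal_plus[symmetric] del: ennreal_plus)
  then have eq: "P (h + t) x y - P t x y = c - (1 - P h x x) * P t x y" by (simp add: algebra_simps)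
  have "0 \<le> (1 - P h x x) * P t x y" "(1 - P h x x) * P t x y \<le> 1 - P h x x"
    using P_le_1[OF x, of h x] P_nonneg[of t x y] mult_left_mono[OF P_le_1[OF x, of t y], of "1 - P h x x"] by auto
  then show ?thesis unfolding eq using c by linarith
qed

lemma P_continuous:
  assumes x: "x \<in> X" and y: "y \<in> X"
  shows "continuous_on UNIV (\<lambda>t. P (max 0 t) x y)"
  unfolding continuous_on_iff
proof (intro ballI allI impI)
  fix t e :: real assume "e > 0"
  then have "eventually (\<lambda>h. 1 - e < P h x x) (at_right 0)"
    using order_tendstoD(1)[OF P_0[OF x x]] by simp
  then obtain d where d: "d > 0" "\<And>h. 0 < h \<Longrightarrow> h < d \<Longrightarrow> 1 - e < P h x x"
    unfolding eventually_at_right_field by auto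
  have close: "\<bar>P b x y - P a x y\<bar> < e" if "0 \<le> a" "a \<le> b" "b - a < d" for a b
  proof (cases "a = b")
    case False
    then show ?thesis using P_increment[OF x y, of "b - a" a] d(2)[of "b - a"] that by simp
  qed (use \<open>e > 0\<close> in simp)
  show "\<exists>d>0. \<forall>s\<in>UNIV. dist s t < d \<longrightarrow> dist (P (max 0 s) x y) (P (max 0 t) x y) < e"
  proof (intro exI conjI ballI impI)
    fix s assume st: "dist s t < d"
    show "dist (P (max 0 s) x y) (P (max 0 t) x y) < e"
      unfolding dist_real_def
    proof (cases "s \<le> t")
      case True
      then show "\<bar>P (max 0 s) x y - P (max 0 t) x y\<bar> < e"
        using close[of "max 0 s" "max 0 t"] st by (simp add: dist_real_def abs_minus_commute max_def split: if_splits)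
    next
      case False
      then show "\<bar>P (max 0 s) x y - P (max 0 t) x y\<bar> < e"
        using close[of "max 0 t" "max 0 s"] st by (simp add: dist_real_def max_def split: if_splits)
    qed
  qed (use d in simp)
qed

lemma P_measurable [measurable]:
  assumes "x \<in> X" "y \<in> X"
  shows "(\<lambda>t. P (max 0 t) x y) \<in> borel_measurable borel"
  using P_continuous[OF assms] by (rule borel_measurable_continuous_onI)

context
  fixes \<beta> :: real and \<alpha> :: state
  assumes beta: "\<beta> > 0" and atom: "\<alpha> \<in> X"
begin

text \<open>The resolvent is the law of the chain at an independent exponential time.\<close>

definition Exp where "Exp = density lborel (\<lambda>t. ennreal (exponential_density \<beta> t))"

lemma prob_Exp: "prob_space Exp"
  unfolding Exp_def using prob_space_exponential_density[OF beta] .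

lemma sets_Exp [measurable_cong]: "sets Exp = sets borel" by (simp add: Exp_def)

abbreviation \<phi> where "\<phi> x \<equiv> resolvent M Z \<beta> x \<alpha>"

lemma resolvent_eq:
  assumes x: "x \<in> X" shows "\<phi> x = (\<integral>t. P (max 0 t) x \<alpha> \<partial>Exp)"
proof -
  have "(\<integral>t. P (max 0 t) x \<alpha> \<partial>Exp) = (\<integral>t. exponential_density \<beta> t *\<^sub>R P (max 0 t) x \<alpha> \<partial>lborel)"
    unfolding Exp_def using x atom beta by (intro integral_density) (auto simp: exponential_density_nonneg)
  also have "\<dots> = \<phi> x"
    unfolding resolvent_def set_lebesgue_integral_def
    by (intro Bochner_Integration.integral_cong) (auto simp: exponential_density_def indicator_def mult.commute)
  finally show ?thesis ..
qed

lemma resolvent_bounds: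
  assumes x: "x \<in> X" shows "0 \<le> \<phi> x" "\<phi> x \<le> 1"
    and "integrable Exp (\<lambda>t. P (max 0 t) x \<alpha>)"
proof -
  interpret E: prob_space Exp by (rule prob_Exp)
  show i: "integrable Exp (\<lambda>t. P (max 0 t) x \<alpha>)"
    using x atom P_le_1[OF x] P_nonneg
    by (intro E.integrable_const_bound[where B=1]) (auto simp: abs_of_nonneg)
  show "0 \<le> \<phi> x" unfolding resolvent_eq[OF x] by (intro integral_nonneg_AE) (simp add: P_nonneg)
  have "(\<integral>t. P (max 0 t) x \<alpha> \<partial>Exp) \<le> (\<integral>t. 1 \<partial>Exp)"
    using i P_le_1[OF x] by (intro integral_mono) auto
  then show "\<phi> x \<le> 1" unfolding resolvent_eq[OF x] by (simp add: E.prob_space)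
qed

lemma resolvent_pos:
  assumes x: "x \<in> X" and irr: "0 \<le> t0" "P t0 x \<alpha> > 0"
  shows "\<phi> x > 0"
proof (rule ccontr)
  interpret E: prob_space Exp by (rule prob_Exp)
  assume "\<not> \<phi> x > 0"
  then have "(\<integral>t. P (max 0 t) x \<alpha> \<partial>Exp) = 0" using resolvent_bounds(1)[OF x] resolvent_eq[OF x] by simp
  then have "AE t in Exp. P (max 0 t) x \<alpha> = 0"
    using resolvent_bounds(3)[OF x] by (subst (asm) integral_nonneg_eq_0_iff_AE) (auto simp: P_nonneg)
  then have ae: "AE t in lborel. 0 < exponential_density \<beta> t \<longrightarrow> P (max 0 t) x \<alpha> = 0"
    unfolding Exp_def by (subst (asm) AE_density) auto
  obtain d where d: "d > 0" "\<And>s. dist s t0 < d \<Longrightarrow> dist (P (max 0 s) x \<alpha>) (P (max 0 t0) x \<alpha>) < P t0 x \<alpha>"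
    using P_continuous[OF x atom] irr(2) unfolding continuous_on_iff by blast
  have "AE t in lborel. t \<notin> {t0<..<t0+d}"
    using ae
  proof eventually_elim
    case (elim t)
    show ?case
    proof
      assume t: "t \<in> {t0<..<t0+d}"
      then have "P (max 0 t) x \<alpha> = 0" using elim irr(1) beta by (auto simp: exponential_density_def)
      moreover have "dist (P (max 0 t) x \<alpha>) (P (max 0 t0) x \<alpha>) < P t0 x \<alpha>" using t by (intro d) (auto simp: dist_real_def)
      ultimately show False using irr by (simp add: dist_real_def)
    qed
  qed
  then have "emeasure lborel {t0<..<t0+d} = 0"
    by (subst (asm) AE_iff_measurable[of "{t0<..<t0+d}"]) auto
  then show False using d(1) by simp
qed

text \<open>Working with the complement of the resolvent gives Fatou's lemma the direction that is needed below.\<close>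

definition away :: "state \<Rightarrow> real" where "away x = 1 - \<phi> x"

lemma away_eq: assumes x: "x \<in> X"
  shows "ennreal (away x) = (\<integral>\<^sup>+ t. ennreal (1 - P (max 0 t) x \<alpha>) \<partial>Exp)"
proof -
  interpret E: prob_space Exp by (rule prob_Exp)
  have "(\<integral>\<^sup>+ t. ennreal (1 - P (max 0 t) x \<alpha>) \<partial>Exp) = ennreal (\<integral> t. 1 - P (max 0 t) x \<alpha> \<partial>Exp)"
    using resolvent_bounds(3)[OF x] P_le_1[OF x] by (intro nn_integral_eq_integral) auto
  also have "(\<integral> t. 1 - P (max 0 t) x \<alpha> \<partial>Exp) = away x"
    using resolvent_bounds(3)[OF x] by (simp add: away_def resolvent_eq[OF x] E.prob_space)
  finally show ?thesis ..
qed

lemma away_bounds: "x \<in> X \<Longrightarrow> 0 \<le> away x" "x \<in> X \<Longrightarrow> away x \<le> 1"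
  using resolvent_bounds[of x] by (auto simp: away_def)

lemma complement_step:
  assumes x: "x \<in> X" and "0 \<le> h" "0 \<le> t"
  shows "act (kern h) (\<lambda>y. ennreal (1 - P t y \<alpha>)) x = ennreal (1 - P (h + t) x \<alpha>)"
proof -
  have "act (kern h) (\<lambda>y. ennreal (1 - P t y \<alpha>)) x + ennreal (P (h + t) x \<alpha>)
      = act (kern h) (\<lambda>y. ennreal (1 - P t y \<alpha>) + ennreal (P t y \<alpha>)) x"
    using chapman_kolmogorov[OF x atom assms(2,3)] by (simp add: act_add)
  also have "\<dots> = act (kern h) (\<lambda>_. 1) x"
  proof (rule act_cong)
    fix y assume "kern h x y \<noteq> 0"
    then have "y \<in> X" by (auto simp: kern_def split: if_splits)
    then show "ennreal (1 - P t y \<alpha>) + ennreal (P t y \<alpha>) = 1"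
      using P_le_1[of y t \<alpha>] P_nonneg[of t y \<alpha>] by (simp add: ennreal_plus[symmetric] del: ennreal_plus)
  qed
  finally have *: "act (kern h) (\<lambda>y. ennreal (1 - P t y \<alpha>)) x + ennreal (P (h + t) x \<alpha>) = 1"
    using kern_stochastic[OF x assms(2)] by simp
  then show ?thesis
    using P_nonneg[of "h + t" x \<alpha>] P_le_1[OF x, of "h + t" \<alpha>]
    by (cases "act (kern h) (\<lambda>y. ennreal (1 - P t y \<alpha>)) x")
       (auto simp: ennreal_plus[symmetric] ennreal_1[symmetric] simp del: ennreal_plus ennreal_1)
qed

text \<open>The resolvent equation integrated over a short time, as an inequality.  A shift of the exponential time by \<open>h\<close> multiplies its density by
\<open>exp (\<beta> h)\<close> and removes the interval \<open>(0, h)\<close>.  That interval carries mass \<open>\<beta> h\<close> to first order, and there the chain is away from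
\<open>\<alpha>\<close> with probability at least \<open>\<kappa>\<close>.\<close>

lemma away_step:
  assumes x: "x \<in> X" and h: "0 < h" and k: "0 \<le> \<kappa>" "\<And>s. 0 < s \<Longrightarrow> s < h \<Longrightarrow> \<kappa> \<le> 1 - P s x \<alpha>"
  shows "act (kern h) (\<lambda>y. ennreal (away y)) x + ennreal (\<kappa> * (\<beta> * h)) \<le> ennreal (exp (\<beta> * h) * away x)"
proof -
  let ?D = "exponential_density \<beta>"
  let ?g = "\<lambda>s. ennreal (?D s) * ennreal (1 - P (max 0 s) x \<alpha>)"
  have D[measurable]: "?D \<in> borel_measurable borel" by simp
  have D0: "0 \<le> ?D s" for s using exponential_density_nonneg[OF beta] .
  have [measurable]: "(\<lambda>s. P (max 0 s) x \<alpha>) \<in> borel_measurable borel" using P_measurable[OF x atom] .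
  have "act (kern h) (\<lambda>y. ennreal (away y)) x = (\<integral>\<^sup>+ y. kern h x y * ennreal (away y) \<partial>count_space X)"
    by (rule act_restrict) (auto simp: kern_def)
  also have "\<dots> = (\<integral>\<^sup>+ y. \<integral>\<^sup>+ t. kern h x y * ennreal (1 - P (max 0 t) y \<alpha>) \<partial>Exp \<partial>count_space X)"
    using P_measurable[OF _ atom] by (intro nn_integral_cong) (auto simp: away_eq nn_integral_cmult)
  also have "\<dots> = (\<integral>\<^sup>+ t. \<integral>\<^sup>+ y. kern h x y * ennreal (1 - P (max 0 t) y \<alpha>) \<partial>count_space X \<partial>Exp)"
    using P_measurable[OF _ atom] by (intro nn_integral_count_space_nn_integral[symmetric]) auto
  also have "\<dots> = (\<integral>\<^sup>+ t. ennreal (1 - P (h + max 0 t) x \<alpha>) \<partial>Exp)"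
  proof (intro nn_integral_cong)
    fix t
    have "(\<integral>\<^sup>+ y. kern h x y * ennreal (1 - P (max 0 t) y \<alpha>) \<partial>count_space X) = 
      act (kern h) (\<lambda>y. ennreal (1 - P (max 0 t) y \<alpha>)) x"
      by (rule act_restrict[symmetric]) (auto simp: kern_def)
    then show "(\<integral>\<^sup>+ y. kern h x y * ennreal (1 - P (max 0 t) y \<alpha>) \<partial>count_space X) = ennreal (1 - P (h + max 0 t) x \<alpha>)"
      using complement_step[OF x, of h "max 0 t"] h by simp
  qed
  also have "\<dots> = (\<integral>\<^sup>+ t. ennreal (?D t) * ennreal (1 - P (max 0 (h + t)) x \<alpha>) \<partial>lborel)"
    unfolding Exp_def
  proof (subst nn_integral_density)
    have "(\<lambda>t. P (h + max 0 t) x \<alpha>) = (\<lambda>t. P (max 0 (h + max 0 t)) x \<alpha>)" using h by (simp add: max_def)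
    also have "\<dots> \<in> borel_measurable borel"
      using measurable_compose[OF _ P_measurable[OF x atom], of "\<lambda>t. h + max 0 t" borel] by simp
    finally show "(\<lambda>t. ennreal (1 - P (h + max 0 t) x \<alpha>)) \<in> borel_measurable lborel" by simp
  qed (use h in \<open>auto intro!: nn_integral_cong simp: exponential_density_def max_def\<close>)
  also have "\<dots> = (\<integral>\<^sup>+ s. ennreal (?D (s - h)) * ennreal (1 - P (max 0 s) x \<alpha>) \<partial>lborel)"
    by (subst nn_integral_real_affine[where c=1 and t=h]) (auto simp: add.commute)
  also have "\<dots> = (\<integral>\<^sup>+ s. ennreal (exp (\<beta> * h)) * (?g s * indicator {h..} s) \<partial>lborel)"
  proof (intro nn_integral_cong)
    fix s
    have "?D (s - h) = exp (\<beta> * h) * ?D s * indicator {h..} s"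
      using h by (auto simp: exponential_density_def indicator_def algebra_simps exp_add exp_diff exp_minus field_simps)
    then have "ennreal (?D (s - h)) = ennreal (exp (\<beta> * h)) * ennreal (?D s) * indicator {h..} s"
      using D0 by (auto simp: indicator_def ennreal_mult)
    then show "ennreal (?D (s - h)) * ennreal (1 - P (max 0 s) x \<alpha>) = ennreal (exp (\<beta> * h)) * (?g s * indicator {h..} s)"
      by (simp add: mult_ac)
  qed
  also have "\<dots> = ennreal (exp (\<beta> * h)) * (\<integral>\<^sup>+ s. ?g s * indicator {h..} s \<partial>lborel)"
    by (rule nn_integral_cmult) measurable
  finally have late: "act (kern h) (\<lambda>y. ennreal (away y)) x = \<dots>" .
  have "ennreal (\<kappa> * (\<beta> * h)) = ennreal (exp (\<beta> * h)) * (ennreal (\<beta> * exp (- \<beta> * h) * \<kappa>) * emeasure lborel {0<..<h})"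
    using beta h k by (simp add: ennreal_mult''[symmetric] exp_minus field_simps)
  also have "\<dots> = ennreal (exp (\<beta> * h)) * (\<integral>\<^sup>+ s. ennreal (\<beta> * exp (- \<beta> * h) * \<kappa>) * indicator {0<..<h} s \<partial>lborel)"
    by (subst nn_integral_cmult_indicator) auto
  also have "\<dots> \<le> ennreal (exp (\<beta> * h)) * (\<integral>\<^sup>+ s. ?g s * indicator {..<h} s \<partial>lborel)"
  proof (intro mult_left_mono nn_integral_mono)
    fix s
    show "ennreal (\<beta> * exp (- \<beta> * h) * \<kappa>) * indicator {0<..<h} s \<le> ?g s * indicator {..<h} s"
    proof (cases "0 < s \<and> s < h")
      case True
      have "\<beta> * exp (- \<beta> * h) * \<kappa> \<le> ?D s * (1 - P s x \<alpha>)"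
        using True beta k P_le_1[OF x, of s \<alpha>] by (intro mult_mono) (auto simp: exponential_density_def mult.commute)
      then show ?thesis using True D0 by (auto simp: ennreal_mult'[symmetric] intro!: ennreal_leI)
    qed auto
  qed simp
  finally have early: "ennreal (\<kappa> * (\<beta> * h)) \<le> ennreal (exp (\<beta> * h)) * (\<integral>\<^sup>+ s. ?g s * indicator {..<h} s \<partial>lborel)" .
  have "(\<integral>\<^sup>+ s. ?g s * indicator {h..} s \<partial>lborel) + (\<integral>\<^sup>+ s. ?g s * indicator {..<h} s \<partial>lborel) 
     = (\<integral>\<^sup>+ s. ?g s * indicator {h..} s + ?g s * indicator {..<h} s \<partial>lborel)"
    by (rule nn_integral_add[symmetric]) measurable
  also have "\<dots> = (\<integral>\<^sup>+ s. ?g s \<partial>lborel)"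
    by (intro nn_integral_cong) (auto simp: indicator_def)
  also have "\<dots> = ennreal (away x)"
    unfolding away_eq[OF x] Exp_def by (rule nn_integral_density[symmetric]) auto
  finally have total: "ennreal (exp (\<beta> * h)) * (\<integral>\<^sup>+ s. ?g s * indicator {h..} s \<partial>lborel)
     + ennreal (exp (\<beta> * h)) * (\<integral>\<^sup>+ s. ?g s * indicator {..<h} s \<partial>lborel) = ennreal (exp (\<beta> * h) * away x)"
    using away_bounds(1)[OF x] by (simp add: distrib_left[symmetric] ennreal_mult)
  show ?thesis unfolding late total[symmetric] by (rule add_left_mono[OF early])
qed

lemma exp_exit_limit:
  assumes "x \<in> X"
  shows "((\<lambda>h. (exp (\<beta> * h) - P h x x) / h) \<longlongrightarrow> \<beta> - Q x x) (at_right 0)"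
proof -
  have "((\<lambda>h. exp (\<beta> * h)) has_real_derivative \<beta>) (at 0)"
    by (auto intro!: derivative_eq_intros)
  then have "((\<lambda>h. (exp (\<beta> * h) - 1) / h) \<longlongrightarrow> \<beta>) (at 0)"
    by (simp add: DERIV_def)
  then have e: "((\<lambda>h. (exp (\<beta> * h) - 1) / h) \<longlongrightarrow> \<beta>) (at_right 0)"
    by (rule filterlim_mono) (auto simp: at_le)
  have "((\<lambda>h. (exp (\<beta> * h) - 1) / h - (P h x x - 1) / h) \<longlongrightarrow> \<beta> - Q x x) (at_right 0)"
    using diff_quot[OF assms assms] by (intro tendsto_intros e) auto
  then show ?thesis by (simp add: diff_divide_distrib[symmetric])
qed

text \<open>Divide \<open>away_step\<close> by \<open>h\<close> and let \<open>h\<close> tend to zero.  Only an inequality is claimed, so Fatou's lemma suffices.\<close>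

lemma away_generator_aux:
  assumes x: "x \<in> X" and k: "0 \<le> \<kappa>" "eventually (\<lambda>h. \<kappa> \<le> 1 - P h x \<alpha>) (at_right 0)"
  shows "act R (\<lambda>y. ennreal (away y)) x + ennreal (\<kappa> * \<beta>) \<le> ennreal ((\<beta> - Q x x) * away x)"
proof -
  let ?u = "\<lambda>y. ennreal (away y)"
  define b where "b h = (exp (\<beta> * h) - P h x x) / h * away x - \<kappa> * \<beta>" for h
  define hs where "hs k = inverse (real (Suc k))" for k
  have hs: "filterlim hs (at_right 0) sequentially" 
    unfolding hs_def
    by (intro tendsto_imp_filterlim_at_right LIMSEQ_inverse_real_of_nat) auto
  obtain d where d: "d > 0" "\<And>h. 0 < h \<Longrightarrow> h < d \<Longrightarrow> \<kappa> \<le> 1 - P h x \<alpha>"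
    using k(2) unfolding eventually_at_right_field by auto
  have step: "0 \<le> b h \<and> act (\<lambda>x y. if y = x then 0 else kern h x y / ennreal h) ?u x \<le> ennreal (b h)"
    if h: "0 < h" "h < d" for h
  proof -
    let ?off = "\<lambda>x y. if y = x then 0 else kern h x y"
    have "act (kern h) ?u x + ennreal (\<kappa> * (\<beta> * h)) \<le> ennreal (exp (\<beta> * h) * away x)"
      using h d k by (intro away_step x) auto
    then have le: "ennreal (P h x x * away x) + act ?off ?u x + ennreal (\<kappa> * (\<beta> * h)) \<le> ennreal (exp (\<beta> * h) * away x)"
      using x away_bounds[OF x] P_nonneg[of h x x]
      by (subst (asm) act_off_diagonal) (simp add: kern_def ennreal_mult)
    then obtain c where c: "act ?off ?u x = ennreal c" "0 \<le> c"
      by (cases "act ?off ?u x") (auto simp: top_unique)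
    have "P h x x * away x + c + \<kappa> * (\<beta> * h) \<le> exp (\<beta> * h) * away x"
      using le away_bounds[OF x] P_nonneg[of h x x] k(1) beta h c(2) unfolding c(1)
      by (simp add: ennreal_plus[symmetric] del: ennreal_plus)
    then have "c / h \<le> b h"
      unfolding b_def using h by (simp add: field_simps)
    moreover have "act (\<lambda>x y. if y = x then 0 else kern h x y / ennreal h) ?u x = ennreal (c / h)"
    proof -
      have "act (\<lambda>x y. if y = x then 0 else kern h x y / ennreal h) ?u x 
         = (\<integral>\<^sup>+ y. inverse (ennreal h) * (?off x y * ?u y) \<partial>count_space UNIV)"
        unfolding act_def by (intro nn_integral_cong) (auto simp: divide_ennreal_def mult_ac)
      also have "\<dots> = inverse (ennreal h) * act ?off ?u x"
        by (subst nn_integral_cmult) (auto simp: act_def)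
      also have "\<dots> = ennreal (c / h)" using c h by (simp add: divide_ennreal[symmetric] divide_ennreal_def mult.commute)
      finally show ?thesis .
    qed
    moreover have "0 \<le> c / h" using c h by simp
    ultimately show ?thesis by (auto intro!: ennreal_leI)
  qed
  have ev: "eventually (\<lambda>k. 0 < hs k \<and> hs k < d) sequentially"
    using order_tendstoD(2)[OF LIMSEQ_inverse_real_of_nat d(1)]
    by eventually_elim (simp add: hs_def del: of_nat_Suc)
  have lim: "((\<lambda>k. b (hs k)) \<longlongrightarrow> (\<beta> - Q x x) * away x - \<kappa> * \<beta>) sequentially"
    unfolding b_def by (intro tendsto_intros filterlim_compose[OF exp_exit_limit[OF x] hs])
  have B0: "0 \<le> (\<beta> - Q x x) * away x - \<kappa> * \<beta>"
    by (rule tendsto_lowerbound[OF lim]) (use ev step in \<open>auto elim: eventually_mono\<close>)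
  have "act R ?u x = (\<integral>\<^sup>+ y. liminf (\<lambda>k. (if y = x then 0 else kern (hs k) x y / ennreal (hs k)) * ?u y) \<partial>count_space UNIV)"
    unfolding act_def
  proof (intro nn_integral_cong)
    fix y
    have "(\<lambda>k. (if y = x then 0 else kern (hs k) x y / ennreal (hs k)) * ?u y) \<longlonglongrightarrow> R x y * ?u y"
    proof (cases "y \<in> X \<and> y \<noteq> x")
      case False
      then have "(if y = x then 0 else kern (hs k) x y / ennreal (hs k)) * ?u y = 0" for k
        by (auto simp: kern_def)
      moreover have "R x y = 0" using False by (auto simp: R_def)
      ultimately show ?thesis by (simp only: mult_zero_left tendsto_const)
    next
      case True
      then have "(\<lambda>k. P (hs k) x y / hs k * away y) \<longlonglongrightarrow> Q x y * away y"
        using filterlim_compose[OF diff_quot[OF x, of y] hs] by (intro tendsto_intros) auto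
      then have "(\<lambda>k. ennreal (P (hs k) x y / hs k * away y)) \<longlonglongrightarrow> ennreal (Q x y * away y)"
        by (rule tendsto_ennrealI)
      moreover have "ennreal (P (hs k) x y / hs k * away y) =
          (if y = x then 0 else kern (hs k) x y / ennreal (hs k)) * ?u y" for k
      proof -
        have "hs k > 0" by (simp add: hs_def)
        then show ?thesis
          using True x P_nonneg[of "hs k" x y] away_bounds[of y]
          by (subst ennreal_mult'') (auto simp: kern_def divide_ennreal)
      qed
      moreover have "ennreal (Q x y * away y) = R x y * ?u y"
        using True x away_bounds[of y] by (auto simp: R_def ennreal_mult'')
      ultimately show ?thesis by simp
    qed
    then show "R x y * ?u y = liminf (\<lambda>k. (if y = x then 0 else kern (hs k) x y / ennreal (hs k)) * ?u y)"
      by (simp add: lim_imp_Liminf)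
  qed
  also have "\<dots> \<le> liminf (\<lambda>k. act (\<lambda>x y. if y = x then 0 else kern (hs k) x y / ennreal (hs k)) ?u x)"
    unfolding act_def by (intro nn_integral_liminf) auto
  also have "\<dots> \<le> liminf (\<lambda>k. ennreal (b (hs k)))"
    by (intro Liminf_mono eventually_mono[OF ev]) (use step in blast)
  also have "\<dots> = ennreal ((\<beta> - Q x x) * away x - \<kappa> * \<beta>)"
    by (intro lim_imp_Liminf tendsto_ennrealI lim) simp
  finally show ?thesis
    using B0 k beta add_right_mono[of "act R ?u x" _ "ennreal (\<kappa> * \<beta>)"]
    by (fastforce simp: ennreal_plus[symmetric] simp del: ennreal_plus)
qed

text \<open>The constant \<open>\<kappa>\<close> may be taken as zero at \<open>\<alpha>\<close> and arbitrarily close to one elsewhere, since the chain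
has not moved yet at small times.\<close>

lemma away_generator:
  assumes x: "x \<in> X"
  shows "((\<lambda>y. Q x y * away y) has_sum enn2real (act R (\<lambda>y. ennreal (away y)) x)) (X - {x})"
    and "enn2real (act R (\<lambda>y. ennreal (away y)) x) - - Q x x * away x \<le> \<beta> * (if x = \<alpha> then 1 else 0) - \<beta> * \<phi> x"
proof -
  let ?u = "\<lambda>y. ennreal (away y)"
  have "act R ?u x + ennreal (0 * \<beta>) \<le> ennreal ((\<beta> - Q x x) * away x)"
    by (rule away_generator_aux[OF x]) (use P_le_1[OF x] in auto)
  then have le0: "act R ?u x \<le> ennreal ((\<beta> - Q x x) * away x)" by simp
  then have fin: "act R ?u x < \<infinity>" using le_less_trans by fastforce
  have rr: "act R ?u x = (\<integral>\<^sup>+ y. ennreal (Q x y * away y) \<partial>count_space (X - {x}))"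
    unfolding act_R[OF x] using Q_nonneg[OF x] by (intro nn_integral_cong) (auto simp: ennreal_mult' away_bounds)
  show "((\<lambda>y. Q x y * away y) has_sum enn2real (act R ?u x)) (X - {x})"
    unfolding rr by (rule has_sum_nn_integral) (use fin rr Q_nonneg[OF x] away_bounds in auto)
  have nn: "0 \<le> (\<beta> - Q x x) * away x" using rate_nonneg[OF x] beta away_bounds[OF x] by simp
  show "enn2real (act R ?u x) - - Q x x * away x \<le> \<beta> * (if x = \<alpha> then 1 else 0) - \<beta> * \<phi> x"
  proof (cases "x = \<alpha>")
    case True
    have "enn2real (act R ?u x) \<le> (\<beta> - Q x x) * away x" using le0 nn by (simp add: enn2real_leI)
    then show ?thesis using True by (simp add: away_def algebra_simps)
  next
    case False
    have "enn2real (act R ?u x) + \<beta> \<le> (\<beta> - Q x x) * away x + e" if "e > 0" for e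
    proof -
      define \<kappa> where "\<kappa> = max 0 (1 - e / \<beta>)"
      have "1 - 0 > \<kappa>" using that beta by (simp add: \<kappa>_def)
      have "((\<lambda>h. 1 - P h x \<alpha>) \<longlongrightarrow> 1 - (if x = \<alpha> then 1 else 0)) (at_right 0)"
        by (intro tendsto_intros P_0 x atom)
      then have "eventually (\<lambda>h. \<kappa> < 1 - P h x \<alpha>) (at_right 0)"
        using False \<open>1 - 0 > \<kappa>\<close> by (intro order_tendstoD(1)) auto
      then have "eventually (\<lambda>h. \<kappa> \<le> 1 - P h x \<alpha>) (at_right 0)" by eventually_elim simp
      then have "act R ?u x + ennreal (\<kappa> * \<beta>) \<le> ennreal ((\<beta> - Q x x) * away x)"
        by (intro away_generator_aux x) (auto simp: \<kappa>_def)
      then have "enn2real (act R ?u x) + \<kappa> * \<beta> \<le> (\<beta> - Q x x) * away x"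
        using fin nn beta by (cases "act R ?u x") (auto simp: \<kappa>_def ennreal_plus[symmetric] simp del: ennreal_plus)
      moreover have "\<beta> - e \<le> \<kappa> * \<beta>" 
      proof -
        have "(1 - e / \<beta>) * \<beta> \<le> \<kappa> * \<beta>" using beta by (intro mult_right_mono) (auto simp: \<kappa>_def)
        moreover have "(1 - e / \<beta>) * \<beta> = \<beta> - e" using beta by (simp add: left_diff_distrib)
        ultimately show ?thesis by simp
      qed
      ultimately show ?thesis by linarith
    qed
    then have "enn2real (act R ?u x) + \<beta> \<le> (\<beta> - Q x x) * away x" by (rule field_le_epsilon)
    then show ?thesis using False by (simp add: away_def algebra_simps)
  qed
qed

end

end

section \<open>The truncated generator\<close>

lemma has_sum_remove:
  fixes g :: "'a \<Rightarrow> real"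
  assumes "(g has_sum s) A" "x \<in> A"
  shows "(g has_sum (s - g x)) (A - {x})"
  using assms by (intro has_sum_Diff) (auto intro: has_sum_finiteI)

lemma has_sum_restore:
  fixes g :: "'a \<Rightarrow> real"
  assumes "(g has_sum s) (A - {x})" "x \<in> A"
  shows "(g has_sum (s + g x)) A"
proof -
  have "(g has_sum (s + g x)) ((A - {x}) \<union> {x})"
    using assms by (intro has_sum_Un_disjoint) (auto intro: has_sum_finiteI)
  then show ?thesis using assms(2) by (simp add: insert_absorb)
qed

lemma summable_on_dominated:
  fixes g h :: "'a \<Rightarrow> real"
  assumes "h summable_on A" "\<And>x. x \<in> A \<Longrightarrow> \<bar>g x\<bar> \<le> h x"
  shows "g summable_on A"
proof -
  have "(\<lambda>x. norm (g x)) summable_on A"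
    by (rule summable_on_comparison_test[OF assms(1)]) (use assms(2) in auto)
  then show ?thesis by (rule abs_summable_summable)
qed

lemma has_sum_subtract:
  fixes g h :: "'a \<Rightarrow> real"
  assumes "(g has_sum s) A" "(h has_sum t) A"
  shows "((\<lambda>x. g x - h x) has_sum (s - t)) A"
  using has_sum_add[OF assms(1), of "\<lambda>x. - h x" "- t"] assms(2) by (simp add: has_sum_uminus)

lemma summable_on_subtract:
  fixes g h :: "'a \<Rightarrow> real"
  assumes "g summable_on A" "h summable_on A"
  shows "(\<lambda>x. g x - h x) summable_on A"
  using assms unfolding summable_on_def by (blast intro: has_sum_subtract)

lemma infsum_finite_sum:
  fixes g :: "'b \<Rightarrow> 'a \<Rightarrow> real"
  assumes "finite J" "\<And>j. j \<in> J \<Longrightarrow> g j summable_on A"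
  shows "(\<Sum>\<^sub>\<infinity>x\<in>A. \<Sum>j\<in>J. g j x) = (\<Sum>j\<in>J. infsum (g j) A)"
proof -
  have "((\<lambda>x. \<Sum>j\<in>J. g j x) has_sum (\<Sum>j\<in>J. infsum (g j) A)) A"
    using assms by (induction J rule: finite_induct) (auto intro!: has_sum_add)
  then show ?thesis by (rule infsumI)
qed

lemma infsum_subtract:
  fixes g h :: "'a \<Rightarrow> real"
  assumes "g summable_on A" "h summable_on A"
  shows "(\<Sum>\<^sub>\<infinity>x\<in>A. g x - h x) = infsum g A - infsum h A"
  using assms by (intro infsumI has_sum_subtract has_sum_infsum)

lemma finite_states_upto: "finite (states_upto S n)"
  by (simp add: states_upto_def level_def)

lemma states_upto_subset: "states_upto S n \<subseteq> states S"
  by (auto simp: states_upto_def states_def)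

lemma mem_states: "(k, i) \<in> states S \<longleftrightarrow> i \<le> S k"
  by (auto simp: states_def level_def)

lemma mem_states_upto: "(k, i) \<in> states_upto S n \<longleftrightarrow> k \<le> n \<and> i \<le> S k"
  by (auto simp: states_upto_def level_def)

text \<open>The error bound sums level by level; this turns its double sums into sums over sets of states.\<close>

lemma tail_Sigma: "states S - states_upto S n = Sigma {n<..} (\<lambda>m. {0..S m})"
  by (auto simp: mem_states mem_states_upto)

lemma upto_Sigma: "states_upto S n = Sigma {0..n} (\<lambda>k. {0..S k})"
  by (auto simp: mem_states_upto)

text \<open>The truncated row sends the rates into \<open>(m, j)\<close> with \<open>m > n\<close> to \<open>(n, j)\<close>.  This is possible because all levels from
\<open>1\<close> on have the same size.\<close>

lemma trunc_row:
  assumes lv: "\<forall>k\<ge>1. S k = S 1" and n: "1 \<le> n" and x: "x \<in> states_upto S n"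
    and sQ: "Q x summable_on states S"
    and sh: "(\<lambda>y. Q x y * h y) summable_on states S"
  shows "(\<lambda>y. Q x y * h (n, snd y)) summable_on (states S - states_upto S n)"
    and "(\<Sum>y\<in>states_upto S n. lc_trunc Q n x y * h y) =
      (\<Sum>\<^sub>\<infinity>y\<in>states S. Q x y * h y) +
      (\<Sum>\<^sub>\<infinity>y\<in>states S - states_upto S n. Q x y * (h (n, snd y) - h y))"
proof -
  let ?X = "states S" and ?F = "states_upto S n"
  obtain k i where xk: "x = (k, i)" "k \<le> n" using x by (cases x) (auto simp: mem_states_upto)
  have Sn: "S m = S n" if "m > n" for m using lv n that by (metis le_trans less_imp_le)
  have sQt: "Q x summable_on (?X - ?F)" by (rule summable_on_subset_banach[OF sQ]) auto
  have sht: "(\<lambda>y. Q x y * h y) summable_on (?X - ?F)" by (rule summable_on_subset_banach[OF sh]) auto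
  have sQa: "(\<lambda>y. \<bar>Q x y\<bar>) summable_on (?X - ?F)"
    using sQt summable_on_iff_abs_summable_on_real[of "Q x"] by simp
  show shn: "(\<lambda>y. Q x y * h (n, snd y)) summable_on (?X - ?F)"
  proof (rule summable_on_dominated)
    show "(\<lambda>y. \<bar>Q x y\<bar> * (\<Sum>j=0..S n. \<bar>h (n, j)\<bar>)) summable_on (?X - ?F)"
      by (intro summable_on_cmult_left sQa)
    fix y assume "y \<in> ?X - ?F"
    then have "snd y \<le> S n" using Sn by (cases y) (auto simp: mem_states mem_states_upto)
    then have "\<bar>h (n, snd y)\<bar> \<le> (\<Sum>j=0..S n. \<bar>h (n, j)\<bar>)"
      by (intro member_le_sum) auto
    then show "\<bar>Q x y * h (n, snd y)\<bar> \<le> \<bar>Q x y\<bar> * (\<Sum>j=0..S n. \<bar>h (n, j)\<bar>)"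
      by (simp add: abs_mult mult_left_mono)
  qed
  \<comment> \<open>The rate added to column \<open>y\<close> by the augmentation.\<close>
  define E where "E y = (if fst y = n then (\<Sum>\<^sub>\<infinity>m\<in>{n<..}. Q x (m, snd y)) else 0)" for y
  have tr: "lc_trunc Q n x y = Q x y + E y" if yF: "y \<in> ?F" for y
  proof -
    obtain l j where y: "y = (l, j)" "l \<le> n" using yF by (cases y) (auto simp: mem_states_upto)
    have "{m. m > n \<and> m \<noteq> k} = {n<..}" using xk by auto
    then show ?thesis using y xk by (auto simp: E_def)
  qed
  have "(\<Sum>y\<in>?F. E y * h y) = (\<Sum>j=0..S n. (\<Sum>\<^sub>\<infinity>m\<in>{n<..}. Q x (m, j)) * h (n, j))"
  proof -
    have "(\<Sum>y\<in>?F. E y * h y) = (\<Sum>y\<in>{n} \<times> {0..S n}. E y * h y)"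
      by (rule sum.mono_neutral_right[OF finite_states_upto]) (auto simp: mem_states_upto E_def)
    also have "\<dots> = (\<Sum>j=0..S n. E (n, j) * h (n, j))"
      using sum.cartesian_product[of "\<lambda>l j. E (l, j) * h (l, j)" "{0..S n}" "{n}"] by (simp add: case_prod_unfold)
    finally show ?thesis by (simp add: E_def)
  qed
  also have "\<dots> = (\<Sum>j=0..S n. (\<Sum>\<^sub>\<infinity>m\<in>{n<..}. Q x (m, j) * h (n, j)))"
    by (simp add: infsum_cmult_left')
  also have "\<dots> = (\<Sum>\<^sub>\<infinity>m\<in>{n<..}. \<Sum>j=0..S n. Q x (m, j) * h (n, j))"
  proof (rule infsum_finite_sum[symmetric], simp)
    fix j assume j: "j \<in> {0..S n}"
    have "Q x summable_on (\<lambda>m. (m, j)) ` {n<..}"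
    proof (rule summable_on_subset_banach[OF sQt], rule image_subsetI)
      fix m assume "m \<in> {n<..}"
      then show "(m, j) \<in> ?X - ?F" using j Sn[of m] by (simp add: mem_states mem_states_upto)
    qed
    then have "(\<lambda>m. Q x (m, j)) summable_on {n<..}"
      by (subst (asm) summable_on_reindex) (auto simp: inj_on_def o_def)
    then show "(\<lambda>m. Q x (m, j) * h (n, j)) summable_on {n<..}" by (rule summable_on_cmult_left)
  qed
  also have "\<dots> = (\<Sum>\<^sub>\<infinity>m\<in>{n<..}. \<Sum>j=0..S m. Q x (m, j) * h (n, j))"
    by (intro infsum_cong) (simp add: Sn)
  also have "\<dots> = (\<Sum>\<^sub>\<infinity>y\<in>?X - ?F. Q x y * h (n, snd y))"
    using infsum_Sigma_banach[of "\<lambda>y. Q x y * h (n, snd y)" "{n<..}" "\<lambda>m. {0..S m}"] shn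
    by (simp add: tail_Sigma)
  finally have Eh: "(\<Sum>y\<in>?F. E y * h y) = (\<Sum>\<^sub>\<infinity>y\<in>?X - ?F. Q x y * h (n, snd y))" .
  have "(\<Sum>\<^sub>\<infinity>y\<in>?F \<union> (?X - ?F). Q x y * h y) = (\<Sum>\<^sub>\<infinity>y\<in>?F. Q x y * h y) + (\<Sum>\<^sub>\<infinity>y\<in>?X - ?F. Q x y * h y)"
    using finite_states_upto sht by (intro infsum_Un_disjoint) auto
  then have split: "(\<Sum>\<^sub>\<infinity>y\<in>?X. Q x y * h y) = (\<Sum>y\<in>?F. Q x y * h y) + (\<Sum>\<^sub>\<infinity>y\<in>?X - ?F. Q x y * h y)"
    using states_upto_subset[of S n] finite_states_upto[of S n] by (simp add: Un_absorb1)
  have "(\<Sum>y\<in>?F. lc_trunc Q n x y * h y) = (\<Sum>y\<in>?F. Q x y * h y) + (\<Sum>y\<in>?F. E y * h y)"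
    by (simp add: tr distrib_right sum.distrib)
  also have "\<dots> = (\<Sum>\<^sub>\<infinity>y\<in>?X. Q x y * h y) +
     ((\<Sum>\<^sub>\<infinity>y\<in>?X - ?F. Q x y * h (n, snd y)) - (\<Sum>\<^sub>\<infinity>y\<in>?X - ?F. Q x y * h y))"
    unfolding split Eh by simp
  also have "(\<Sum>\<^sub>\<infinity>y\<in>?X - ?F. Q x y * h (n, snd y)) - (\<Sum>\<^sub>\<infinity>y\<in>?X - ?F. Q x y * h y)
     = (\<Sum>\<^sub>\<infinity>y\<in>?X - ?F. Q x y * (h (n, snd y) - h y))"
    by (subst infsum_subtract[OF shn sht, symmetric]) (simp add: right_diff_distrib)
  finally show "(\<Sum>y\<in>?F. lc_trunc Q n x y * h y) = (\<Sum>\<^sub>\<infinity>y\<in>?X. Q x y * h y) +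
      (\<Sum>\<^sub>\<infinity>y\<in>?X - ?F. Q x y * (h (n, snd y) - h y))" .
qed

section \<open>The Poisson equation\<close>

text \<open>The drift condition with respect to a single state, in real-valued form.\<close>

locale atom_poisson = ctmc S M Z Q 
  for S and M :: "state \<Rightarrow> 'w measure" and Z Q +
  fixes \<pi> :: "state \<Rightarrow> real" and f w :: "state \<Rightarrow> real" and \<alpha> :: state
  assumes stat: "stationary_distribution S Q \<pi>"
    and atom: "\<alpha> \<in> states S"
    and w_nonneg: "x \<in> states S \<Longrightarrow> 0 \<le> w x"
    and f1: "x \<in> states S \<Longrightarrow> 1 \<le> f x"
    and Qw: "x \<in> states S \<Longrightarrow> (\<lambda>y. Q x y * w y) summable_on states S"
    and Qw_drift: "x \<in> states S - {\<alpha>} \<Longrightarrow> (\<Sum>\<^sub>\<infinity>y\<in>states S. Q x y * w y) \<le> - f x"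
begin

lemma Qw_off: "x \<in> X \<Longrightarrow> ((\<lambda>y. Q x y * w y) has_sum ((\<Sum>\<^sub>\<infinity>y\<in>X. Q x y * w y) - Q x x * w x)) (X - {x})"
  using Qw by (intro has_sum_remove) auto

lemma act_R_real:
  assumes x: "x \<in> X" and u: "\<And>y. y \<in> X \<Longrightarrow> 0 \<le> u y"
  shows "act R (\<lambda>y. ennreal (u y)) x = (\<integral>\<^sup>+ y. ennreal (Q x y * u y) \<partial>count_space (X - {x}))"
  unfolding act_R[OF x] using Q_nonneg[OF x] u by (intro nn_integral_cong) (auto simp: ennreal_mult')

lemma act_R_w:
  assumes x: "x \<in> X"
  shows "act R (\<lambda>y. ennreal (w y)) x = ennreal ((\<Sum>\<^sub>\<infinity>y\<in>X. Q x y * w y) - Q x x * w x)"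
proof -
  have "act R (\<lambda>y. ennreal (w y)) x = (\<integral>\<^sup>+ y. ennreal (Q x y * w y) \<partial>count_space (X - {x}))"
    by (rule act_R_real[OF x w_nonneg])
  also have "\<dots> = ennreal ((\<Sum>\<^sub>\<infinity>y\<in>X. Q x y * w y) - Q x x * w x)"
    using Q_nonneg[OF x] w_nonneg
    by (intro nn_integral_has_sum[OF Qw_off[OF x]] mult_nonneg_nonneg) auto
  finally show ?thesis .
qed

abbreviation \<pi>' :: "state \<Rightarrow> ennreal" where "\<pi>' x \<equiv> (if x \<in> X then ennreal (\<pi> x) else 0)"

lemma pi_nonneg: "x \<in> X \<Longrightarrow> 0 \<le> \<pi> x" using stat by (simp add: stationary_distribution_def)

sublocale A: atom_drift_stationary R X \<alpha> "\<lambda>x. ennreal (f x)" "\<lambda>x. ennreal (w x)" \<pi>'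
proof unfold_locales
  show "x \<notin> X \<or> y \<notin> X \<Longrightarrow> R x y = 0" for x y by (rule R_outside)
  show "R x x = 0" for x by (rule R_no_loop)
  show "\<alpha> \<in> X" by (rule atom)
  show "act R (\<lambda>_. 1) x < \<infinity>" for x by (rule rate_finite)
  show "ennreal (w x) < \<infinity>" for x by simp
  show "regular_rates R" by (rule regular_rates_R)
  show "1 \<le> ennreal (f x)" if "x \<in> X - {\<alpha>}" for x using f1[of x] that by simp
  show "\<pi>' x = 0" if "x \<notin> X" for x using that by simp
  show "\<pi>' x < \<infinity>" for x by simp
  show "ennreal (f x) + act R (\<lambda>x. ennreal (w x)) x \<le> act R (\<lambda>_. 1) x * ennreal (w x)" if x: "x \<in> X - {\<alpha>}" for x
  proof -
    have "0 \<le> (\<Sum>\<^sub>\<infinity>y\<in>X. Q x y * w y) - Q x x * w x"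
      using x Q_nonneg[of x] w_nonneg by (intro has_sum_nonneg[OF Qw_off]) auto
    then show ?thesis
      using x f1[of x] Qw_drift[OF x] w_nonneg[of x] rate_nonneg[of x]
      by (simp add: act_R_w rate ennreal_plus[symmetric] ennreal_mult'[symmetric] del: ennreal_plus)
  qed
  show "(\<integral>\<^sup>+ x. \<pi>' x * R x y \<partial>count_space UNIV) = \<pi>' y * act R (\<lambda>_. 1) y" for y
  proof (cases "y \<in> X")
    case False
    then show ?thesis by (simp add: R_outside)
  next
    case y: True
    have "((\<lambda>x. \<pi> x * Q x y) has_sum 0) X" using stat y by (simp add: stationary_distribution_def)
    then have hs: "((\<lambda>x. \<pi> x * Q x y) has_sum (0 - \<pi> y * Q y y)) (X - {y})" by (rule has_sum_remove) fact
    have "(\<integral>\<^sup>+ x. \<pi>' x * R x y \<partial>count_space UNIV) = (\<integral>\<^sup>+ x. \<pi>' x * R x y \<partial>count_space (X - {y}))"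
      by (rule nn_integral_count_space_eq) (auto simp: R_def)
    also have "\<dots> = (\<integral>\<^sup>+ x. ennreal (\<pi> x * Q x y) \<partial>count_space (X - {y}))"
      using y Q_nonneg pi_nonneg by (intro nn_integral_cong) (auto simp: R_def ennreal_mult')
    also have "\<dots> = ennreal (0 - \<pi> y * Q y y)"
      using y Q_nonneg pi_nonneg by (intro nn_integral_has_sum[OF hs]) auto
    also have "\<dots> = \<pi>' y * act R (\<lambda>_. 1) y"
      using y pi_nonneg[OF y] rate[OF y] by (simp add: ennreal_mult'[symmetric])
    finally show ?thesis .
  qed
qed

lemma off_atom_sum:
  assumes g: "\<And>x. x \<in> X \<Longrightarrow> 0 \<le> g x"
  shows "(\<integral>\<^sup>+ x. ennreal (\<pi> x * g x) \<partial>count_space (X - {\<alpha>})) = ennreal (\<pi> \<alpha>) * act R (A.pot (\<lambda>x. ennreal (g x))) \<alpha>"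
proof -
  have "(\<integral>\<^sup>+ x. ennreal (\<pi> x * g x) \<partial>count_space (X - {\<alpha>})) =
      (\<integral>\<^sup>+ x. \<pi>' x * ennreal (g x) * indicator (- {\<alpha>}) x \<partial>count_space (X - {\<alpha>}))"
    using g pi_nonneg by (intro nn_integral_cong) (auto simp: ennreal_mult')
  also have "\<dots> = (\<integral>\<^sup>+ x. \<pi>' x * ennreal (g x) * indicator (- {\<alpha>}) x \<partial>count_space UNIV)"
    by (rule nn_integral_count_space_eq) auto
  finally show ?thesis using A.stationary_cycle_formula[of "\<lambda>x. ennreal (g x)"] atom by simp
qed

text \<open>Otherwise the cycle formula would give \<open>\<pi>\<close> total mass zero.\<close>

lemma pi_atom_pos: "\<pi> \<alpha> > 0"
proof (rule ccontr)
  assume "\<not> \<pi> \<alpha> > 0"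
  then have 0: "\<pi> \<alpha> = 0" using pi_nonneg[OF atom] by simp
  have "(\<pi> has_sum 1) X" using stat by (simp add: stationary_distribution_def)
  then have hs: "(\<pi> has_sum (1 - \<pi> \<alpha>)) (X - {\<alpha>})" by (rule has_sum_remove) (rule atom)
  have "(\<integral>\<^sup>+ x. ennreal (\<pi> x * 1) \<partial>count_space (X - {\<alpha>})) = 0"
    by (subst off_atom_sum) (auto simp: 0)
  then show False using nn_integral_has_sum[OF hs] pi_nonneg 0 by auto
qed

lemma pot_finite:
  assumes g: "\<forall>x\<in>X. 0 \<le> g x \<and> g x \<le> f x"
  defines "h \<equiv> \<lambda>x. enn2real (A.pot (\<lambda>x. ennreal (g x)) x)"
  shows "\<And>x. A.pot (\<lambda>x. ennreal (g x)) x = ennreal (h x)"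
    and "\<And>x. 0 \<le> h x" and "\<And>x. x \<in> X \<Longrightarrow> h x \<le> w x"
    and "\<And>x. x \<in> X \<Longrightarrow> act R (\<lambda>x. ennreal (h x)) x < \<infinity>"
proof -
  have le: "A.pot (\<lambda>x. ennreal (g x)) x \<le> ennreal (w x)" for x
    using g by (intro A.pot_le) (auto intro: ennreal_leI)
  show eq: "A.pot (\<lambda>x. ennreal (g x)) x = ennreal (h x)" for x
    using le_less_trans[OF le ennreal_less_top] by (simp add: h_def)
  show "0 \<le> h x" for x by (simp add: h_def)
  show "h x \<le> w x" if "x \<in> X" for x
    using le[of x] w_nonneg[OF that] unfolding eq by simp
  show "act R (\<lambda>x. ennreal (h x)) x < \<infinity>" if "x \<in> X" for x
  proof (rule le_less_trans)
    show "act R (\<lambda>x. ennreal (h x)) x \<le> act R (\<lambda>x. ennreal (w x)) x"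
      using le unfolding eq by (intro act_mono)
    show "act R (\<lambda>x. ennreal (w x)) x < \<infinity>" using act_R_w[OF that] by simp
  qed
qed

text \<open>By the cycle formula the mean of \<open>f\<close> off the atom is \<open>\<pi> \<alpha>\<close> times \<open>Q\<close> applied to a potential below \<open>w\<close>.\<close>

lemma pi_f_summable: "(\<lambda>x. \<pi> x * f x) summable_on X"
proof -
  have f: "\<forall>x\<in>X. 0 \<le> f x \<and> f x \<le> f x" using f1 by (metis order_refl order_trans zero_le_one)
  have "(\<integral>\<^sup>+ x. ennreal (\<pi> x * f x) \<partial>count_space (X - {\<alpha>})) < \<infinity>"
    using f pot_finite(4)[of f, OF f atom] pot_finite(1)[of f, OF f]
    by (subst off_atom_sum) (auto simp: ennreal_mult_less_top)
  then have "((\<lambda>x. \<pi> x * f x) has_sum (enn2real (\<integral>\<^sup>+ x. ennreal (\<pi> x * f x) \<partial>count_space (X - {\<alpha>})))) (X - {\<alpha>})"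
    using f pi_nonneg by (intro has_sum_nn_integral) auto
  then show ?thesis using has_sum_restore[OF _ atom] unfolding summable_on_def by blast
qed

text \<open>The defect of the Poisson equation at the atom is the mean of \<open>g\<close> per unit of time spent there,
a multiple of \<open>\<pi> g\<close> that cancels for the two parts of a centred function.\<close>

lemma pot_poisson:
  assumes g: "\<forall>x\<in>X. 0 \<le> g x \<and> g x \<le> f x"
  defines "h \<equiv> \<lambda>x. enn2real (A.pot (\<lambda>x. ennreal (g x)) x)"
  shows "\<And>x. x \<in> X - {\<alpha>} \<Longrightarrow> ((\<lambda>y. Q x y * h y) has_sum (- g x)) X"
    and "((\<lambda>y. Q \<alpha> y * h y) has_sum ((\<Sum>\<^sub>\<infinity>x\<in>X. \<pi> x * g x) / \<pi> \<alpha> - g \<alpha>)) X"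
proof -
  have h_app: "h x = enn2real (A.pot (\<lambda>x. ennreal (g x)) x)" for x by (simp add: h_def)
  note p = pot_finite[of g, OF g, folded h_app]
  have hs: "((\<lambda>y. Q x y * h y) has_sum (enn2real (act R (\<lambda>x. ennreal (h x)) x))) (X - {x})" if x: "x \<in> X" for x
    using p(4)[OF x] p(2) Q_nonneg[OF x] unfolding act_R_real[OF x p(2)]
    by (intro has_sum_nn_integral) auto
  show "((\<lambda>y. Q x y * h y) has_sum (- g x)) X" if x: "x \<in> X - {\<alpha>}" for x
  proof -
    have "act R (\<lambda>_. 1) x * ennreal (h x) = ennreal (g x) + act R (\<lambda>x. ennreal (h x)) x"
      using A.pot_eq[OF x, of "\<lambda>x. ennreal (g x)"] by (simp add: p(1)[abs_def])
    moreover have "0 \<le> - (Q x x * h x)"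
      using x p(2)[of x] rate_nonneg[of x] by (simp add: mult_nonpos_nonneg)
    ultimately have "enn2real (act R (\<lambda>x. ennreal (h x)) x) = - Q x x * h x - g x"
      using x bspec[OF g, of x] p(2)[of x] p(4)[of x] rate_nonneg[of x]
      by (cases "act R (\<lambda>x. ennreal (h x)) x")
         (auto simp: rate ennreal_mult'[symmetric] ennreal_plus[symmetric] simp del: ennreal_plus)
    then show ?thesis using has_sum_restore[OF hs, of x] x by simp
  qed
  have h0: "h \<alpha> = 0" by (simp add: h_def A.pot_atom)
  have sm: "(\<lambda>x. \<pi> x * g x) summable_on X"
    using g pi_nonneg by (intro summable_on_dominated[OF pi_f_summable]) (auto simp: abs_mult intro!: mult_left_mono)
  then have hs': "((\<lambda>x. \<pi> x * g x) has_sum ((\<Sum>\<^sub>\<infinity>x\<in>X. \<pi> x * g x) - \<pi> \<alpha> * g \<alpha>)) (X - {\<alpha>})"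
    by (intro has_sum_remove) (auto simp: atom)
  have nn: "0 \<le> (\<Sum>\<^sub>\<infinity>x\<in>X. \<pi> x * g x) - \<pi> \<alpha> * g \<alpha>"
    using g pi_nonneg by (intro has_sum_nonneg[OF hs']) auto
  have "ennreal ((\<Sum>\<^sub>\<infinity>x\<in>X. \<pi> x * g x) - \<pi> \<alpha> * g \<alpha>) = ennreal (\<pi> \<alpha>) * act R (\<lambda>x. ennreal (h x)) \<alpha>"
    using off_atom_sum[of g] nn_integral_has_sum[OF hs'] g pi_nonneg by (simp add: p(1)[abs_def])
  then have "(\<Sum>\<^sub>\<infinity>x\<in>X. \<pi> x * g x) - \<pi> \<alpha> * g \<alpha> = \<pi> \<alpha> * enn2real (act R (\<lambda>x. ennreal (h x)) \<alpha>)"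
    using nn pi_nonneg[OF atom] p(4)[OF atom]
    by (cases "act R (\<lambda>x. ennreal (h x)) \<alpha>") (auto simp: ennreal_mult'[symmetric])
  then have "enn2real (act R (\<lambda>x. ennreal (h x)) \<alpha>) = (\<Sum>\<^sub>\<infinity>x\<in>X. \<pi> x * g x) / \<pi> \<alpha> - g \<alpha>"
    using pi_atom_pos by (simp add: field_simps)
  then show "((\<lambda>y. Q \<alpha> y * h y) has_sum ((\<Sum>\<^sub>\<infinity>x\<in>X. \<pi> x * g x) / \<pi> \<alpha> - g \<alpha>)) X"
    using has_sum_restore[OF hs[OF atom] atom] h0 by simp
qed

lemma poisson_solution:
  assumes u: "\<And>x. x \<in> X \<Longrightarrow> \<bar>u x\<bar> \<le> f x" and centred: "((\<lambda>x. \<pi> x * u x) has_sum 0) X"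
  obtains h where "\<And>x. x \<in> X \<Longrightarrow> \<bar>h x\<bar> \<le> w x" "\<And>x. x \<in> X \<Longrightarrow> ((\<lambda>y. Q x y * h y) has_sum (- u x)) X"
proof -
  let ?p = "\<lambda>x. max 0 (u x)" and ?n = "\<lambda>x. max 0 (- u x)"
  define hp where "hp x = enn2real (A.pot (\<lambda>x. ennreal (?p x)) x)" for x
  define hn where "hn x = enn2real (A.pot (\<lambda>x. ennreal (?n x)) x)" for x
  have bp: "\<forall>x\<in>X. 0 \<le> ?p x \<and> ?p x \<le> f x" and bn: "\<forall>x\<in>X. 0 \<le> ?n x \<and> ?n x \<le> f x"
    using u f1 by (fastforce simp: abs_le_iff)+
  note fp = pot_finite[of ?p, OF bp, folded hp_def] and fn = pot_finite[of ?n, OF bn, folded hn_def]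
  note pp = pot_poisson[of ?p, OF bp, folded hp_def] and pn = pot_poisson[of ?n, OF bn, folded hn_def]
  have sp: "(\<lambda>x. \<pi> x * ?p x) summable_on X" and sn: "(\<lambda>x. \<pi> x * ?n x) summable_on X"
    using bp bn pi_nonneg by (auto intro!: summable_on_dominated[OF pi_f_summable] mult_left_mono simp: abs_mult)
  have "(\<Sum>\<^sub>\<infinity>x\<in>X. \<pi> x * ?p x) - (\<Sum>\<^sub>\<infinity>x\<in>X. \<pi> x * ?n x) = (\<Sum>\<^sub>\<infinity>x\<in>X. \<pi> x * ?p x - \<pi> x * ?n x)"
    by (rule infsum_subtract[OF sp sn, symmetric])
  also have "\<dots> = (\<Sum>\<^sub>\<infinity>x\<in>X. \<pi> x * u x)"
    by (intro infsum_cong) (auto simp: max_def)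
  also have "\<dots> = 0" using centred by (rule infsumI)
  finally have eq: "(\<Sum>\<^sub>\<infinity>x\<in>X. \<pi> x * ?p x) = (\<Sum>\<^sub>\<infinity>x\<in>X. \<pi> x * ?n x)" by simp
  show ?thesis
  proof (rule that[of "\<lambda>x. hp x - hn x"])
    show "\<bar>hp x - hn x\<bar> \<le> w x" if "x \<in> X" for x
      using fp(2)[of x] fp(3)[OF that] fn(2)[of x] fn(3)[OF that] by linarith
    show "((\<lambda>y. Q x y * (hp y - hn y)) has_sum (- u x)) X" if x: "x \<in> X" for x
    proof (cases "x = \<alpha>")
      case True
      have "((\<lambda>y. Q \<alpha> y * hp y - Q \<alpha> y * hn y) has_sum (- ?p \<alpha> - - ?n \<alpha>)) X"
        using has_sum_subtract[OF pp(2) pn(2)] eq by simp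
      moreover have "- ?p \<alpha> - - ?n \<alpha> = - u \<alpha>" by (simp add: max_def)
      ultimately show ?thesis using True by (simp add: right_diff_distrib)
    next
      case False
      then have "((\<lambda>y. Q x y * hp y - Q x y * hn y) has_sum (- ?p x - - ?n x)) X"
        using x by (intro has_sum_subtract pp(1) pn(1)) auto
      moreover have "- ?p x - - ?n x = - u x" by (simp add: max_def)
      ultimately show ?thesis by (simp add: right_diff_distrib)
    qed
  qed
qed

text \<open>On a level \<open>l > n\<close> the truncated rates into the level come only from the level itself, so \<open>p\<close> restricted to it is
invariant under the square block of \<open>Q\<close>.  That block applied to \<open>w\<close> is at most \<open>- 1\<close>, as the rates out of the level
are nonnegative; a nonzero invariant measure would contradict this.\<close>

lemma trunc_support:
  assumes tr: "stationary_distribution S (lc_trunc Q n) p" and far: "\<alpha> \<in> states_upto S n"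
    and x: "x \<in> X - states_upto S n"
  shows "p x = 0"
proof -
  obtain l i where xl: "x = (l, i)" "n < l" "i \<le> S l" using x by (cases x) (auto simp: mem_states mem_states_upto)
  let ?L = "level S l"
  have L: "finite ?L" "?L \<subseteq> X" "x \<in> ?L" "\<alpha> \<notin> ?L"
    using xl far by (auto simp: level_def mem_states states_upto_def)
  have p0: "0 \<le> p z" if "z \<in> X" for z using tr that by (simp add: stationary_distribution_def)
  have col: "(\<Sum>z\<in>?L. p z * Q z y) = 0" if y: "y \<in> ?L" for y
  proof -
    have "((\<lambda>z. p z * lc_trunc Q n z y) has_sum 0) X"
      using tr y L(2) by (auto simp: stationary_distribution_def)
    moreover have "((\<lambda>z. p z * lc_trunc Q n z y) has_sum 0) X \<longleftrightarrow> ((\<lambda>z. p z * Q z y) has_sum 0) ?L"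
      using y xl(2) L(2) by (intro has_sum_cong_neutral) (auto simp: level_def mem_states split: if_splits)
    ultimately show ?thesis using has_sum_finite[OF L(1)] has_sum_unique by blast
  qed
  have row: "(\<Sum>y\<in>?L. Q z y * w y) \<le> - 1" if z: "z \<in> ?L" for z
  proof -
    have zX: "z \<in> X - {\<alpha>}" using z L by auto
    have "(\<Sum>y\<in>?L. Q z y * w y) \<le> (\<Sum>\<^sub>\<infinity>y\<in>X. Q z y * w y)"
    proof (rule has_sum_mono2)
      show "((\<lambda>y. Q z y * w y) has_sum (\<Sum>y\<in>?L. Q z y * w y)) ?L" using L(1) by simp
      show "((\<lambda>y. Q z y * w y) has_sum (\<Sum>\<^sub>\<infinity>y\<in>X. Q z y * w y)) X" using Qw zX by simp
      show "0 \<le> Q z y * w y" if "y \<in> X - ?L" for y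
        using that z zX Q_nonneg[of z y] w_nonneg[of y] by (intro mult_nonneg_nonneg) auto
    qed (use L in auto)
    then show ?thesis using Qw_drift[OF zX] f1[of z] zX by simp
  qed
  have "0 = (\<Sum>y\<in>?L. (\<Sum>z\<in>?L. p z * Q z y) * w y)" by (simp add: col)
  also have "\<dots> = (\<Sum>z\<in>?L. p z * (\<Sum>y\<in>?L. Q z y * w y))"
    unfolding sum_distrib_left sum_distrib_right by (subst sum.swap) (simp add: mult.assoc)
  also have "\<dots> \<le> (\<Sum>z\<in>?L. p z * (- 1))"
    using row p0 L(2) by (intro sum_mono mult_left_mono) auto
  finally have "(\<Sum>z\<in>?L. p z) \<le> 0" by (simp add: sum_negf)
  moreover have nn: "0 \<le> p z" if "z \<in> ?L" for z using that p0 L(2) by blast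
  ultimately have "(\<Sum>z\<in>?L. p z) = 0" by (intro antisym sum_nonneg) auto
  then have "\<forall>z\<in>?L. p z = 0" using sum_nonneg_eq_0_iff[of ?L p, OF L(1) nn] by blast
  then show ?thesis using L(3) by blast
qed

text \<open>The perturbation identity for \<open>\<pi> - p\<close>, with the Poisson solution for the sign-weighted test function.\<close>

lemma truncation_error:
  assumes lv: "\<forall>k\<ge>1. S k = S 1" and n: "1 \<le> n"
    and tr: "stationary_distribution S (lc_trunc Q n) p" and support: "\<forall>x\<in>X - states_upto S n. p x = 0"
    and v_row: "\<forall>x\<in>X. (\<lambda>y. Q x y * v y) summable_on X"
    and w_bound: "\<forall>x\<in>X. w x \<le> v x + c"
    and g_bound: "\<forall>x\<in>X. 0 \<le> g x \<and> g x \<le> f x"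
  shows "(\<lambda>x. \<pi> x * g x) summable_on X" and "(\<lambda>x. \<bar>\<pi> x - p x\<bar> * g x) summable_on X"
    and "(\<Sum>\<^sub>\<infinity>x\<in>X. \<bar>\<pi> x - p x\<bar> * g x) \<le> ((\<Sum>\<^sub>\<infinity>x\<in>X. \<pi> x * g x) + 1) *
      (\<Sum>x\<in>states_upto S n. p x * (\<Sum>\<^sub>\<infinity>y\<in>X - states_upto S n. Q x y * (v y + v (n, snd y) + 2 * c)))"
proof -
  let ?F = "states_upto S n"
  note supp = bspec[OF support] and Qv = bspec[OF v_row] and wv = bspec[OF w_bound] and g = bspec[OF g_bound]
  have F: "finite ?F" "?F \<subseteq> X" by (auto simp: finite_states_upto states_upto_subset[THEN subsetD])
  have Sn: "S m = S n" if "m > n" for m using lv n that by (metis le_trans less_imp_le)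
  have p0: "0 \<le> p x" if "x \<in> X" for x using tr that by (simp add: stationary_distribution_def)
  have toF: "((\<lambda>x. p x * k x) has_sum (\<Sum>x\<in>?F. p x * k x)) X" for k
  proof -
    have "((\<lambda>x. p x * k x) has_sum (\<Sum>x\<in>?F. p x * k x)) ?F" using F by simp
    then show ?thesis using F supp by (subst has_sum_cong_neutral[where T="?F"]) auto
  qed
  have mass: "(\<Sum>x\<in>?F. p x) = 1"
    using toF[of "\<lambda>_. 1"] tr has_sum_unique unfolding stationary_distribution_def by fastforce
  have pi1: "(\<pi> has_sum 1) X" using stat by (simp add: stationary_distribution_def)
  show sg: "(\<lambda>x. \<pi> x * g x) summable_on X"
    using g pi_nonneg by (intro summable_on_dominated[OF pi_f_summable]) (auto simp: abs_mult intro!: mult_left_mono)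
  define a where "a = (\<Sum>\<^sub>\<infinity>x\<in>X. \<pi> x * g x)"
  have a0: "0 \<le> a" unfolding a_def using g pi_nonneg by (intro infsum_nonneg) auto
  \<comment> \<open>The test function whose mean under the signed measure is the weighted total variation.\<close>
  define G where "G x = sgn (\<pi> x - p x) * g x" for x
  have Gg: "\<bar>G x\<bar> \<le> g x" if "x \<in> X" for x
    using g[OF that] by (auto simp: G_def abs_mult sgn_if)
  have sG: "(\<lambda>x. \<pi> x * G x) summable_on X"
    using Gg pi_nonneg by (intro summable_on_dominated[OF sg]) (auto simp: abs_mult intro!: mult_left_mono)
  define s where "s = (\<Sum>\<^sub>\<infinity>x\<in>X. \<pi> x * G x)"
  have hsG: "((\<lambda>x. \<pi> x * G x) has_sum s) X" unfolding s_def using sG by simp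
  have sa: "\<bar>s\<bar> \<le> a"
  proof -
    have "s \<le> a" unfolding s_def a_def
      using Gg pi_nonneg by (intro infsum_mono sG sg mult_left_mono) (auto simp: abs_le_iff)
    moreover have "- s \<le> a"
    proof -
      have "- s = (\<Sum>\<^sub>\<infinity>x\<in>X. - (\<pi> x * G x))" unfolding s_def by (simp add: infsum_uminus)
      also have "\<dots> \<le> a" unfolding a_def
      proof (intro infsum_mono sg)
        show "(\<lambda>x. - (\<pi> x * G x)) summable_on X" using sG by (simp add: summable_on_uminus)
        show "- (\<pi> x * G x) \<le> \<pi> x * g x" if "x \<in> X" for x
          using mult_left_mono[of "- G x" "g x" "\<pi> x"] Gg[OF that] pi_nonneg[OF that] by (auto simp: abs_le_iff)
      qed
      finally show ?thesis .
    qed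
    ultimately show ?thesis by linarith
  qed
  have abs_eq: "\<bar>\<pi> x - p x\<bar> * g x = \<pi> x * G x - p x * G x" for x
    by (simp add: G_def left_diff_distrib[symmetric] mult.assoc[symmetric] linordered_idom_class.abs_sgn)
  have hs_err: "((\<lambda>x. \<bar>\<pi> x - p x\<bar> * g x) has_sum (s - (\<Sum>x\<in>?F. p x * G x))) X"
    unfolding abs_eq by (intro has_sum_subtract hsG toF)
  then show "(\<lambda>x. \<bar>\<pi> x - p x\<bar> * g x) summable_on X"
    by (auto simp: summable_on_def)
  have err: "(\<Sum>\<^sub>\<infinity>x\<in>X. \<bar>\<pi> x - p x\<bar> * g x) = s - (\<Sum>x\<in>?F. p x * G x)"
    using hs_err by (rule infsumI)
  define D where "D = a + 1"
  have D: "D > 0" using a0 by (simp add: D_def)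
  \<comment> \<open>Centred, and scaled to lie below \<open>f\<close>; this uses \<open>1 \<le> f\<close> for the constant part.\<close>
  define u where "u x = (G x - s) / D" for x
  have u_le: "\<bar>u x\<bar> \<le> f x" if x: "x \<in> X" for x
  proof -
    have "\<bar>G x - s\<bar> \<le> g x + a" using Gg[OF x] sa by linarith
    also have "\<dots> \<le> f x + a * f x"
      using g[OF x] mult_left_mono[OF f1[OF x] a0] by simp
    also have "\<dots> = D * f x" by (simp add: D_def algebra_simps)
    finally show ?thesis using D by (simp add: u_def abs_divide field_simps)
  qed
  have "((\<lambda>x. (\<pi> x * G x - \<pi> x * s) * (1 / D)) has_sum ((s - 1 * s) * (1 / D))) X"
    by (intro has_sum_cmult_left has_sum_subtract hsG pi1)
  then have u0: "((\<lambda>x. \<pi> x * u x) has_sum 0) X"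
    by (simp add: u_def right_diff_distrib diff_divide_distrib)
  obtain h where h: "\<And>x. x \<in> X \<Longrightarrow> \<bar>h x\<bar> \<le> w x" "\<And>x. x \<in> X \<Longrightarrow> ((\<lambda>y. Q x y * h y) has_sum (- u x)) X"
    using poisson_solution[OF u_le u0] by blast
  have sQ: "Q x summable_on X" if "x \<in> X" for x
    using cons that unfolding conservative_def summable_on_def by blast
  define T where "T x = (\<Sum>\<^sub>\<infinity>y\<in>X - ?F. Q x y * (h (n, snd y) - h y))" for x
  have row: "(\<Sum>y\<in>?F. lc_trunc Q n x y * h y) = - u x + T x"
    if x: "x \<in> ?F" for x
  proof -
    have xX: "x \<in> X" using x F by auto
    have "(\<lambda>y. Q x y * h y) summable_on X" using h(2)[OF xX] by (auto simp: summable_on_def)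
    from trunc_row(2)[where Q=Q and h=h, OF lv n x sQ[OF xX] this] show ?thesis using infsumI[OF h(2)[OF xX]] by (simp add: T_def)
  qed
  have col: "(\<Sum>x\<in>?F. p x * lc_trunc Q n x y) = 0" if y: "y \<in> ?F" for y
  proof (rule has_sum_unique[OF toF])
    show "((\<lambda>x. p x * lc_trunc Q n x y) has_sum 0) X"
      using tr subsetD[OF F(2) y] by (simp add: stationary_distribution_def)
  qed
  have "0 = (\<Sum>y\<in>?F. (\<Sum>x\<in>?F. p x * lc_trunc Q n x y) * h y)" by (simp add: col)
  also have "\<dots> = (\<Sum>x\<in>?F. p x * (\<Sum>y\<in>?F. lc_trunc Q n x y * h y))"
    unfolding sum_distrib_left sum_distrib_right by (subst sum.swap) (simp add: mult.assoc)
  also have "\<dots> = (\<Sum>x\<in>?F. p x * (- u x + T x))"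
    by (intro sum.cong) (simp_all add: row)
  also have "\<dots> = (\<Sum>x\<in>?F. p x * T x) - (\<Sum>x\<in>?F. p x * u x)"
    by (simp add: right_diff_distrib sum_subtractf)
  finally have pu: "(\<Sum>x\<in>?F. p x * u x) = (\<Sum>x\<in>?F. p x * T x)"
    by simp
  have "(\<Sum>x\<in>?F. p x * u x) = ((\<Sum>x\<in>?F. p x * G x) - (\<Sum>x\<in>?F. p x) * s) / D"
    by (simp add: u_def right_diff_distrib sum_divide_distrib[symmetric] sum_subtractf sum_distrib_right)
  then have "s - (\<Sum>x\<in>?F. p x * G x) = D * - (\<Sum>x\<in>?F. p x * u x)"
    using D by (simp add: mass field_simps)
  also have "\<dots> = D * (\<Sum>x\<in>?F. p x * - T x)"
    unfolding pu by (simp add: sum_negf)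
  also have "\<dots> \<le> D * (\<Sum>x\<in>?F. p x * (\<Sum>\<^sub>\<infinity>y\<in>X - ?F. Q x y * (v y + v (n, snd y) + 2 * c)))"
  proof (intro mult_left_mono sum_mono)
    fix x assume x: "x \<in> ?F"
    then have xX: "x \<in> X" using F by auto
    have st: "k summable_on X \<Longrightarrow> k summable_on (X - ?F)" for k :: "state \<Rightarrow> real"
      by (rule summable_on_subset_banach) auto
    have sh: "(\<lambda>y. Q x y * h y) summable_on X" using h(2)[OF xX] by (auto simp: summable_on_def)
    have "- T x = (\<Sum>\<^sub>\<infinity>y\<in>X - ?F. - (Q x y * (h (n, snd y) - h y)))"
      by (simp add: T_def infsum_uminus)
    also have "\<dots> \<le> (\<Sum>\<^sub>\<infinity>y\<in>X - ?F. Q x y * (v y + v (n, snd y) + 2 * c))"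
    proof (rule infsum_mono)
      have "(\<lambda>y. Q x y * h y - Q x y * h (n, snd y)) summable_on (X - ?F)"
        by (intro summable_on_subtract st sh trunc_row(1)[where Q=Q and h=h, OF lv n x sQ[OF xX] sh])
      then show "(\<lambda>y. - (Q x y * (h (n, snd y) - h y))) summable_on (X - ?F)"
        by (simp add: algebra_simps)
      have "(\<lambda>y. Q x y * v y + Q x y * v (n, snd y) + Q x y * (2 * c)) summable_on (X - ?F)"
        by (intro summable_on_add st Qv[OF xX] trunc_row(1)[where Q=Q and h=v, OF lv n x sQ[OF xX] Qv[OF xX]] summable_on_cmult_left sQ xX)
      then show "(\<lambda>y. Q x y * (v y + v (n, snd y) + 2 * c)) summable_on (X - ?F)"
        by (simp add: distrib_left)
      fix y assume y: "y \<in> X - ?F"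
      obtain m j where mj: "y = (m, j)" "n < m" "j \<le> S m"
        using y by (cases y) (auto simp: mem_states mem_states_upto)
      have yX: "y \<in> X" using y by blast
      have yn: "(n, snd y) \<in> X" using mj Sn[of m] by (simp add: mem_states)
      have "- (h (n, snd y) - h y) \<le> v y + v (n, snd y) + 2 * c"
        using h(1)[OF yn] h(1)[OF yX] wv[OF yn] wv[OF yX] by linarith
      moreover have "0 \<le> Q x y" using Q_nonneg[OF xX yX] y x by blast
      ultimately have "Q x y * - (h (n, snd y) - h y) \<le> Q x y * (v y + v (n, snd y) + 2 * c)"
        by (rule mult_left_mono)
      then show "- (Q x y * (h (n, snd y) - h y)) \<le> Q x y * (v y + v (n, snd y) + 2 * c)"
        unfolding mult_minus_right .
    qed
    finally show "- T x \<le> (\<Sum>\<^sub>\<infinity>y\<in>X - ?F. Q x y * (v y + v (n, snd y) + 2 * c))" .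
  qed (use p0 F D in auto)
  finally show "(\<Sum>\<^sub>\<infinity>x\<in>X. \<bar>\<pi> x - p x\<bar> * g x) \<le> ((\<Sum>\<^sub>\<infinity>x\<in>X. \<pi> x * g x) + 1) *
      (\<Sum>x\<in>?F. p x * (\<Sum>\<^sub>\<infinity>y\<in>X - ?F. Q x y * (v y + v (n, snd y) + 2 * c)))"
    unfolding err D_def a_def by simp
qed

end

text \<open>The factor \<open>b / (\<beta> \<delta>)\<close> is chosen so that the term \<open>- \<beta> \<phi>\<close> in the generator of \<open>away\<close> compensates \<open>b\<close> on \<open>F\<^sub>K\<close>,
where \<open>\<phi> \<ge> \<delta>\<close>.\<close>

lemma (in ctmc) atom_poisson_from_drift:
  assumes stat: "stationary_distribution S Q \<pi>" and v: "\<And>x. x \<in> X \<Longrightarrow> 0 \<le> v x" and f: "\<And>x. x \<in> X \<Longrightarrow> 1 \<le> f x"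
    and drift: "drift_condition S Q v f b K" and b: "b > 0" and beta: "\<beta> > 0" and atom: "\<alpha> \<in> X"
    and d: "\<delta> > 0" "\<And>x. x \<in> states_upto S K \<Longrightarrow> \<delta> \<le> resolvent M Z \<beta> x \<alpha>"
  shows "atom_poisson S M Z Q \<pi> f (\<lambda>x. v x + b / (\<beta> * \<delta>) * away \<beta> \<alpha> x) \<alpha>"
proof unfold_locales
  let ?c = "b / (\<beta> * \<delta>)"
  note aw = away_bounds[OF beta atom]
  have hs: "((\<lambda>y. Q x y * (v y + ?c * away \<beta> \<alpha> y)) has_sum ((\<Sum>\<^sub>\<infinity>y\<in>X. Q x y * v y) +
    ?c * (enn2real (act R (\<lambda>y. ennreal (away \<beta> \<alpha> y)) x) + Q x x * away \<beta> \<alpha> x))) X" if x: "x \<in> X" for x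
  proof -
    have "((\<lambda>y. Q x y * v y) has_sum (\<Sum>\<^sub>\<infinity>y\<in>X. Q x y * v y)) X"
      using drift x by (simp add: drift_condition_def)
    from has_sum_add[OF this has_sum_cmult_right[OF has_sum_restore[OF away_generator(1)[OF beta atom x] x], of ?c]]
    show ?thesis by (simp add: algebra_simps)
  qed
  show "0 \<le> v x + ?c * away \<beta> \<alpha> x" if "x \<in> X" for x
    using v[OF that] aw(1)[OF that] b beta d by (intro add_nonneg_nonneg mult_nonneg_nonneg) auto
  show "(\<lambda>y. Q x y * (v y + ?c * away \<beta> \<alpha> y)) summable_on X" if "x \<in> X" for x
    using hs[OF that] by (auto simp: summable_on_def)
  show "(\<Sum>\<^sub>\<infinity>y\<in>X. Q x y * (v y + ?c * away \<beta> \<alpha> y)) \<le> - f x" if x: "x \<in> X - {\<alpha>}" for x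
  proof -
    let ?phi = "resolvent M Z \<beta> x \<alpha>"
    have "(\<Sum>\<^sub>\<infinity>y\<in>X. Q x y * v y) \<le> - f x + b * indicator (states_upto S K) x"
      using drift x by (simp add: drift_condition_def)
    moreover have "?c * (enn2real (act R (\<lambda>y. ennreal (away \<beta> \<alpha> y)) x) + Q x x * away \<beta> \<alpha> x) \<le> ?c * (- \<beta> * ?phi)"
      using away_generator(2)[OF beta atom, of x] x b beta d by (intro mult_left_mono) auto
    moreover have "?c * (- \<beta> * ?phi) = - (b / \<delta> * ?phi)" using beta by simp
    moreover have "b * indicator (states_upto S K) x \<le> b / \<delta> * ?phi"
    proof (cases "x \<in> states_upto S K")
      case True
      have "b / \<delta> * \<delta> \<le> b / \<delta> * ?phi" using d b True by (intro mult_left_mono) auto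
      then show ?thesis using True d by simp
    next
      case False
      have "0 \<le> b / \<delta> * ?phi" using resolvent_bounds(1)[OF beta atom, of x] x b d by simp
      then show ?thesis using False by simp
    qed
    ultimately show ?thesis using infsumI[OF hs, of x] x by auto
  qed
qed (use stat atom f in auto)

section \<open>The truncation error bound\<close>

theorem theorem2p1:
  fixes S :: "nat \<Rightarrow> nat"
    and M :: "state \<Rightarrow> 'w measure" and Z :: "real \<Rightarrow> 'w \<Rightarrow> state"
    and Q :: qmatrix
    and \<pi> :: "state \<Rightarrow> real" and \<pi>n :: "nat \<Rightarrow> state \<Rightarrow> real"
    and v f :: "state \<Rightarrow> real"
    and b \<beta> :: real and K :: nat
  assumes levels: "\<forall>k\<ge>1. S k = S 1"
    and chain: "regular_jump_chain S M Z"
    and generator: "generator S M Z Q"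
    and conservative: "conservative S Q"
    and ergodic: "ergodic_chain S M Z"
    and stationary: "stationary_distribution S Q \<pi>"
    and unique_class: "\<forall>n\<ge>1. \<exists>!C. C \<subseteq> states_upto S n \<and>
      communicating_class S (lc_trunc Q n) C \<and> closed_class S (lc_trunc Q n) C"
    and stationary_trunc: "\<forall>n\<ge>1. stationary_distribution S (lc_trunc Q n) (\<pi>n n)"
    and b_pos: "b > 0"
    and v_nonneg: "\<forall>x\<in>states S. 0 \<le> v x"
    and f_ge_1: "\<forall>x\<in>states S. 1 \<le> f x"
    and drift: "drift_condition S Q v f b K"
    and beta_pos: "\<beta> > 0"
    and pi_v_finite: "(\<lambda>x. \<pi> x * v x) summable_on states S"
  shows "\<forall>n\<ge>1.
    (\<forall>g. (\<forall>x\<in>states S. 0 \<le> g x \<and> g x \<le> f x) \<longrightarrow>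
      (\<lambda>x. \<pi> x * g x) summable_on states S \<and>
      (\<lambda>x. \<bar>\<pi> x - \<pi>n n x\<bar> * g x) summable_on states S \<and>
      row_times_col S (\<lambda>x. \<bar>\<pi> x - \<pi>n n x\<bar>) g
        \<le> (row_times_col S \<pi> g + 1) / 2 * error_bound S M Z Q \<pi> (\<pi>n n) v b K \<beta> n) \<and>
    (SUP g\<in>{g. \<forall>x\<in>states S. 1 \<le> g x \<and> g x \<le> f x}.
        ereal (row_times_col S (\<lambda>x. \<bar>\<pi> x - \<pi>n n x\<bar>) g / row_times_col S \<pi> g))
      \<le> ereal (error_bound S M Z Q \<pi> (\<pi>n n) v b K \<beta> n)"
proof (intro allI impI)
  fix n :: nat assume n: "1 \<le> n"
  interpret ctmc S M Z Q using chain generator conservative by unfold_locales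
  let ?p = "\<pi>n n" and ?F = "states_upto S n"
  define \<mu> where "\<mu> y = (MIN x\<in>states_upto S K. resolvent M Z \<beta> x y)" for y
  define \<Phi> where "\<Phi> = phi_bar S M Z \<beta> K"
  have \<Phi>: "\<Phi> = (SUP y\<in>X. \<mu> y)" by (simp add: \<Phi>_def phi_bar_def \<mu>_def)
  have K0: "(0, 0) \<in> states_upto S K" "(0, 0) \<in> X" "(0, 0) \<in> ?F" by (auto simp: mem_states mem_states_upto)
  have finK: "finite (states_upto S K)" "states_upto S K \<subseteq> X"
    by (auto simp: finite_states_upto states_upto_subset[THEN subsetD])
  have pos: "resolvent M Z \<beta> x y > 0" if xy: "x \<in> X" "y \<in> X" for x y
  proof -
    have "\<exists>t\<ge>0. P t x y > 0"
      using ergodic xy by (simp add: ergodic_chain_def irreducible_chain_def)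
    then show ?thesis using resolvent_pos[OF beta_pos xy(2) xy(1)] by blast
  qed
  have \<mu>_pos: "\<mu> y > 0" if "y \<in> X" for y
    unfolding \<mu>_def using finK(1) K0(1) by (subst Min_gr_iff) (auto intro!: pos[OF subsetD[OF finK(2)] that])
  have \<mu>_le: "\<mu> y \<le> resolvent M Z \<beta> x y" if "x \<in> states_upto S K" for x y
    unfolding \<mu>_def using finK that by (intro Min_le) auto
  have bdd: "bdd_above (\<mu> ` X)"
  proof (rule bdd_aboveI2)
    show "\<mu> y \<le> 1" if "y \<in> X" for y
      using \<mu>_le[OF K0(1), of y] resolvent_bounds(2)[OF beta_pos that K0(2)] by linarith
  qed
  have "\<mu> (0, 0) \<le> \<Phi>" unfolding \<Phi> by (rule cSUP_upper[OF K0(2) bdd])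
  then have \<Phi>_pos: "\<Phi> > 0" using \<mu>_pos[OF K0(2)] by linarith
  have ne: "X \<noteq> {}" using K0(2) by blast
  have "\<Phi> / 2 < (SUP y\<in>X. \<mu> y)" using \<Phi>_pos unfolding \<Phi>[symmetric] by simp
  \<comment> \<open>Half of the supremum is exceeded at some state, which absorbs the factor two in the error bound.\<close>
  then obtain \<alpha> where \<alpha>: "\<alpha> \<in> X" "\<Phi> / 2 < \<mu> \<alpha>"
    using less_cSUP_iff[OF ne bdd, of "\<Phi> / 2"] by blast
  have tr: "stationary_distribution S (lc_trunc Q n) ?p" using stationary_trunc n by blast
  have ap: "atom_poisson S M Z Q \<pi> f (\<lambda>x. v x + b / (\<beta> * \<mu> y) * away \<beta> y x) y" if "y \<in> X" for y
    by (rule atom_poisson_from_drift[OF stationary _ _ drift b_pos beta_pos that \<mu>_pos[OF that] \<mu>_le])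
       (use v_nonneg f_ge_1 in auto)
  \<comment> \<open>Any atom inside the truncation serves here; the origin always lies there.\<close>
  have supp: "?p x = 0" if "x \<in> X - ?F" for x
    using atom_poisson.trunc_support[OF ap[OF K0(2)] tr K0(3) that] .
  interpret H: atom_poisson S M Z Q \<pi> f "\<lambda>x. v x + b / (\<beta> * \<mu> \<alpha>) * away \<beta> \<alpha> x" \<alpha>
    by (rule ap) (rule \<alpha>)
  define c where "c = row_times_col S \<pi> v + 2 * b / (\<beta> * \<Phi>)"
  have piv: "0 \<le> row_times_col S \<pi> v"
    unfolding row_times_col_def
    by (intro infsum_nonneg mult_nonneg_nonneg) (use v_nonneg H.pi_nonneg in blast)+
  have bc: "b / (\<beta> * \<mu> \<alpha>) \<le> c"
  proof -
    have "b / (\<beta> * \<mu> \<alpha>) \<le> b / (\<beta> * (\<Phi> / 2))"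
      by (intro divide_left_mono mult_left_mono mult_pos_pos)
        (use \<alpha>(2) \<Phi>_pos b_pos beta_pos \<mu>_pos[OF \<alpha>(1)] in simp_all)
    also have "\<dots> = 2 * b / (\<beta> * \<Phi>)" by simp
    finally show ?thesis using piv by (simp add: c_def)
  qed
  have wv: "v x + b / (\<beta> * \<mu> \<alpha>) * away \<beta> \<alpha> x \<le> v x + c" if "x \<in> X" for x
  proof -
    have "b / (\<beta> * \<mu> \<alpha>) * away \<beta> \<alpha> x \<le> b / (\<beta> * \<mu> \<alpha>) * 1"
      using away_bounds[OF beta_pos \<alpha>(1) that] b_pos beta_pos \<mu>_pos[OF \<alpha>(1)] by (intro mult_left_mono) auto
    then show ?thesis using bc by simp
  qed
  have Qv: "(\<lambda>y. Q x y * v y) summable_on X" if "x \<in> X" for x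
    using drift that by (simp add: drift_condition_def)
  define E where "E = (\<Sum>x\<in>?F. ?p x * (\<Sum>\<^sub>\<infinity>y\<in>X - ?F. Q x y * (v y + v (n, snd y) + 2 * c)))"
  have sQ: "Q x summable_on X" if "x \<in> X" for x
    using conservative that unfolding conservative_def summable_on_def by blast
  have err: "error_bound S M Z Q \<pi> ?p v b K \<beta> n = 2 * E"
  proof -
    have tail: "(\<Sum>\<^sub>\<infinity>m\<in>{n<..}. \<Sum>j=0..S m. Q x (m, j) * (v (m, j) + v (n, j) + 2 * c)) =
       (\<Sum>\<^sub>\<infinity>y\<in>X - ?F. Q x y * (v y + v (n, snd y) + 2 * c))" if x: "x \<in> ?F" for x
    proof -
      have xX: "x \<in> X" using x states_upto_subset by blast
      have st: "k summable_on X \<Longrightarrow> k summable_on (X - ?F)" for k :: "state \<Rightarrow> real"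
        by (rule summable_on_subset_banach) auto
      have "(\<lambda>y. Q x y * v y + Q x y * v (n, snd y) + Q x y * (2 * c)) summable_on (X - ?F)"
        by (intro summable_on_add st Qv[OF xX] trunc_row(1)[where Q=Q and h=v, OF levels n x sQ[OF xX] Qv[OF xX]] summable_on_cmult_left sQ xX)
      then have "(\<lambda>y. Q x y * (v y + v (n, snd y) + 2 * c)) summable_on Sigma {n<..} (\<lambda>m. {0..S m})"
        by (simp add: distrib_left tail_Sigma)
      from infsum_Sigma_banach[OF this] show ?thesis by (simp add: tail_Sigma)
    qed
    have "E = (\<Sum>x\<in>?F. ?p x * (\<Sum>\<^sub>\<infinity>m\<in>{n<..}. \<Sum>j=0..S m. Q x (m, j) * (v (m, j) + v (n, j) + 2 * c)))"
      unfolding E_def by (intro sum.cong) (simp_all add: tail)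
    also have "\<dots> = (\<Sum>k=0..n. \<Sum>i=0..S k. ?p (k, i) * (\<Sum>\<^sub>\<infinity>m\<in>{n<..}. \<Sum>j=0..S m. Q (k, i) (m, j) * (v (m, j) + v (n, j) + 2 * c)))"
      unfolding upto_Sigma by (subst sum.Sigma) (auto simp: case_prod_unfold)
    finally show ?thesis by (simp add: error_bound_def Let_def c_def \<Phi>_def)
  qed
  have E0: "0 \<le> E"
    unfolding E_def
  proof (intro sum_nonneg mult_nonneg_nonneg infsum_nonneg)
    fix x assume x: "x \<in> ?F"
    then have xX: "x \<in> X" using states_upto_subset by blast
    then show "0 \<le> ?p x" using tr by (simp add: stationary_distribution_def)
    fix y assume y: "y \<in> X - ?F"
    then have yX: "y \<in> X" by blast
    show "0 \<le> Q x y" using Q_nonneg[OF xX yX] y x by blast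
    obtain m j where mj: "y = (m, j)" "n < m" "j \<le> S m"
      using y by (cases y) (auto simp: mem_states mem_states_upto)
    have "1 \<le> m" using n mj(2) by linarith
    then have "S m = S n" using levels n by metis
    then have "(n, snd y) \<in> X" using mj by (simp add: mem_states)
    moreover have "0 \<le> b / (\<beta> * \<mu> \<alpha>)" using b_pos beta_pos \<mu>_pos[OF \<alpha>(1)] by simp
    ultimately have "0 \<le> v y" "0 \<le> v (n, snd y)" "0 \<le> c"
      using yX v_nonneg bc by (blast, blast, linarith)
    then show "0 \<le> v y + v (n, snd y) + 2 * c" by simp
  qed
  have main: "(\<lambda>x. \<pi> x * g x) summable_on X \<and> (\<lambda>x. \<bar>\<pi> x - ?p x\<bar> * g x) summable_on X \<and>
      row_times_col S (\<lambda>x. \<bar>\<pi> x - ?p x\<bar>) g \<le> (row_times_col S \<pi> g + 1) * E"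
    if g: "\<forall>x\<in>X. 0 \<le> g x \<and> g x \<le> f x" for g
  proof -
    have "\<forall>x\<in>X - ?F. ?p x = 0" "\<forall>x\<in>X. (\<lambda>y. Q x y * v y) summable_on X"
      "\<forall>x\<in>X. v x + b / (\<beta> * \<mu> \<alpha>) * away \<beta> \<alpha> x \<le> v x + c"
      using supp Qv wv by blast+
    from H.truncation_error[OF levels n tr this g] show ?thesis
      unfolding row_times_col_def E_def by blast
  qed
  show "(\<forall>g. (\<forall>x\<in>X. 0 \<le> g x \<and> g x \<le> f x) \<longrightarrow>
      (\<lambda>x. \<pi> x * g x) summable_on X \<and>
      (\<lambda>x. \<bar>\<pi> x - ?p x\<bar> * g x) summable_on X \<and>
      row_times_col S (\<lambda>x. \<bar>\<pi> x - ?p x\<bar>) g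
        \<le> (row_times_col S \<pi> g + 1) / 2 * error_bound S M Z Q \<pi> ?p v b K \<beta> n) \<and>
    (SUP g\<in>{g. \<forall>x\<in>X. 1 \<le> g x \<and> g x \<le> f x}.
        ereal (row_times_col S (\<lambda>x. \<bar>\<pi> x - ?p x\<bar>) g / row_times_col S \<pi> g))
      \<le> ereal (error_bound S M Z Q \<pi> ?p v b K \<beta> n)"
  proof (intro conjI allI impI SUP_least)
    fix g assume g: "\<forall>x\<in>X. 0 \<le> g x \<and> g x \<le> f x"
    show "(\<lambda>x. \<pi> x * g x) summable_on X" "(\<lambda>x. \<bar>\<pi> x - ?p x\<bar> * g x) summable_on X"
      using main[OF g] by auto
    show "row_times_col S (\<lambda>x. \<bar>\<pi> x - ?p x\<bar>) g \<le> (row_times_col S \<pi> g + 1) / 2 * error_bound S M Z Q \<pi> ?p v b K \<beta> n"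
      using main[OF g] by (simp add: err)
  next
    fix g assume "g \<in> {g. \<forall>x\<in>X. 1 \<le> g x \<and> g x \<le> f x}"
    then have g1: "1 \<le> g x" "g x \<le> f x" if "x \<in> X" for x using that by auto
    then have g: "\<forall>x\<in>X. 0 \<le> g x \<and> g x \<le> f x" by (meson order_trans zero_le_one)
    have "(\<pi> has_sum 1) X" using stationary by (simp add: stationary_distribution_def)
    moreover have "((\<lambda>x. \<pi> x * g x) has_sum (row_times_col S \<pi> g)) X"
      unfolding row_times_col_def using main[OF g] by simp
    ultimately have one: "1 \<le> row_times_col S \<pi> g"
    proof (rule has_sum_mono)
      fix x assume x: "x \<in> X"
      show "\<pi> x \<le> \<pi> x * g x" using mult_left_mono[OF g1(1)[OF x] H.pi_nonneg[OF x]] by simp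
    qed
    \<comment> \<open>As \<open>g \<ge> 1\<close> has mean at least one, \<open>\<pi> g + 1 \<le> 2 \<pi> g\<close>.\<close>
    have "row_times_col S (\<lambda>x. \<bar>\<pi> x - ?p x\<bar>) g \<le> (row_times_col S \<pi> g + 1) * E" using main[OF g] by blast
    also have "\<dots> \<le> (2 * row_times_col S \<pi> g) * E" using one E0 by (intro mult_right_mono) auto
    finally have "row_times_col S (\<lambda>x. \<bar>\<pi> x - ?p x\<bar>) g / row_times_col S \<pi> g \<le> 2 * E"
      using one by (simp add: pos_divide_le_eq mult_ac)
    then show "ereal (row_times_col S (\<lambda>x. \<bar>\<pi> x - ?p x\<bar>) g / row_times_col S \<pi> g)
      \<le> ereal (error_bound S M Z Q \<pi> ?p v b K \<beta> n)" by (simp add: err)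
  qed
qed

end
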